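(* Let $m\geq 3$. The only spacelike hypersurface $\Sigma$ in the Lorentz-Minkowski space $\mathbb{L}^{m+1}$ such that at each point $q\in\Sigma$ its intersections with two normal hyperplanes are $(m-1)$-dimensional hyperbolic spaces is the $m$-dimensional hyperbolic space. That is, a spacelike hypersurface $\Sigma$ of $\mathbb{L}^{m+1}$ is an $m$-dimensional hyperbolic space if and only if for each $q\in\Sigma$ there are two different affine hyperplanes through $q$, normal to $\Sigma$ at $q$, each of whose intersections with $\Sigma$ is an $(m-1)$-dimensional hyperbolic space.
   Context: $\mathbb{L}^{m+1}$ is $\mathbb{R}^{m+1}$ with the flat Lorentzian metric $\langle\cdot,\cdot\rangle$ of signature $(-,+,\dots,+)$. A hypersurface is spacelike if its induced metric is Riemannian. An affine hyperplane through a point $q\in\Sigma$ is normal to $\Sigma$ at $q$ if its direction contains the normal line $T_q^{\bot}\Sigma$. A $k$-dimensional hyperbolic space is a (full) connected component of a two-sheeted hyperboloid $\{x\in E:\langle x-c,x-c\rangle=-R^2\}$, where $E$ is a $(k+1)$-dimensional timelike (i.e. with Lorentzian induced metric) affine subspace, and $c\in E$ and $R>0$ are arbitrary.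
   Formalization: The spacelike hypersurface Σ is additionally assumed to be nonempty and a closed subset of the space; without closedness the claim fails, e.g. for an open half of a hyperbolic space cut off by a hyperplane through its centre. *)

theory Defs
  imports "HOL-Analysis.Analysis"
begin

section \<open>Lorentz-Minkowski space\<close>

text \<open>
  The space of dimension \<open>CARD('m) + 1\<close>; the first factor is the time coordinate.  Topology and
  calculus are the Euclidean ones of the product type.
\<close>

type_synonym 'm minkowski = "real \<times> (real ^ 'm)"

definition lorentz :: "'m::finite minkowski \<Rightarrow> 'm minkowski \<Rightarrow> real"
  where "lorentz x y = - (fst x * fst y) + snd x \<bullet> snd y"

text \<open>
  The restriction of the metric to a linear subspace has signature \<open>(-,+,\<dots>,+)\<close>: it is
  negative on a line and positive definite on the orthogonal complement of that line in the
  subspace.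
\<close>

definition timelike_subspace :: "'m::finite minkowski set \<Rightarrow> bool"
  where "timelike_subspace V \<longleftrightarrow> subspace V \<and>
    (\<exists>u\<in>V. lorentz u u < 0 \<and> (\<forall>v\<in>V. lorentz u v = 0 \<and> v \<noteq> 0 \<longrightarrow> lorentz v v > 0))"

definition affine_direction :: "'a::real_vector set \<Rightarrow> 'a set"
  where "affine_direction E = {x - y |x y. x \<in> E \<and> y \<in> E}"

definition hyperbolic_space :: "nat \<Rightarrow> 'm::finite minkowski set \<Rightarrow> bool"
  where "hyperbolic_space k H \<longleftrightarrow>
    (\<exists>E c R. affine E \<and> aff_dim E = int k + 1 \<and> timelike_subspace (affine_direction E) \<and>
       c \<in> E \<and> R > 0 \<and> H \<in> components {x \<in> E. lorentz (x - c) (x - c) = - R\<^sup>2})"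


section \<open>Spacelike hypersurfaces\<close>

primrec Ck_on :: "nat \<Rightarrow> 'a::real_normed_vector set \<Rightarrow> ('a \<Rightarrow> 'b::real_normed_vector) \<Rightarrow> bool"
  where
    "Ck_on 0 U f \<longleftrightarrow> continuous_on U f"
  | "Ck_on (Suc k) U f \<longleftrightarrow> (\<forall>x\<in>U. f differentiable (at x)) \<and>
       (\<forall>v. Ck_on k U (\<lambda>x. frechet_derivative f (at x) v))"

definition smooth_on :: "'a::real_normed_vector set \<Rightarrow> ('a \<Rightarrow> 'b::real_normed_vector) \<Rightarrow> bool"
  where "smooth_on U f \<longleftrightarrow> (\<forall>k. Ck_on k U f)"

text \<open>
  Embedded smooth submanifold of codimension one, neither assumed closed nor connected: locally the
  zero set of a smooth function without critical points.
\<close>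

definition hypersurface :: "'m::finite minkowski set \<Rightarrow> bool"
  where "hypersurface S \<longleftrightarrow>
    (\<forall>q\<in>S. \<exists>U (f :: 'm minkowski \<Rightarrow> real). open U \<and> q \<in> U \<and> smooth_on U f \<and>
       (\<forall>x\<in>U. \<exists>v. frechet_derivative f (at x) v \<noteq> 0) \<and> S \<inter> U = {x \<in> U. f x = 0})"

text \<open>
  Velocity vectors of curves in \<open>S\<close>.  For an embedded submanifold it makes no difference whether
  the curves are smooth or only differentiable at the base point.
\<close>

definition tangent_space :: "'m::finite minkowski set \<Rightarrow> 'm minkowski \<Rightarrow> 'm minkowski set"
  where "tangent_space S q =
    {v. \<exists>\<gamma>. \<gamma> 0 = q \<and> (\<forall>\<^sub>F t in at (0::real). \<gamma> t \<in> S) \<and> (\<gamma> has_vector_derivative v) (at 0)}"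

definition normal_line :: "'m::finite minkowski set \<Rightarrow> 'm minkowski \<Rightarrow> 'm minkowski set"
  where "normal_line S q = {w. \<forall>v \<in> tangent_space S q. lorentz w v = 0}"

definition spacelike_hypersurface :: "'m::finite minkowski set \<Rightarrow> bool"
  where "spacelike_hypersurface S \<longleftrightarrow> hypersurface S \<and>
    (\<forall>q\<in>S. \<forall>v \<in> tangent_space S q. v \<noteq> 0 \<longrightarrow> lorentz v v > 0)"

definition normal_hyperplane :: "'m::finite minkowski set \<Rightarrow> 'm minkowski \<Rightarrow> 'm minkowski set \<Rightarrow> bool"
  where "normal_hyperplane S q P \<longleftrightarrow>
    affine P \<and> aff_dim P = int CARD('m) \<and> q \<in> P \<and> normal_line S q \<subseteq> affine_direction P"

text \<open>
  The characterization of hyperbolic spaces by normal hyperplane sections needs the hypersurface to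
  be a closed subset.  Otherwise an open half of a hyperbolic space \<open>H\<close>, cut off by a hyperplane
  through the centre, is a counterexample: through each of its points there are many totally
  geodesic hypersurfaces of \<open>H\<close> that do not meet the boundary of the half space, and each of them
  is its section with a normal hyperplane.  A complete spacelike hypersurface is always closed.
\<close>

end

theory Submission
  imports Defs "HOL-Complex_Analysis.Great_Picard"
begin

text \<open>
  A closed spacelike hypersurface is locally the graph of a strictly contracting function. Lifting
  straight segments of the spatial factor shows that each of its components is a graph over the
  whole spatial factor, any two points of which are spacelike separated.

  Let \<open>n(q)\<close> be the future unit normal. A section by a normal hyperplane at \<open>q\<close> has the form
  \<open>c + R m\<close>, where \<open>m\<close> ranges over the future unit vectors of the hyperplane and
  \<open>c = q - R n(q)\<close>, and \<open>R\<close> is the same for both sections at \<open>q\<close>. If a section at \<open>q\<close> and one at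
  \<open>p\<close> have a null direction in common, then \<open>c(p) - c(q)\<close> is orthogonal to it, since otherwise two
  points of the sections far out in that direction would be causally related. For \<open>p\<close> near \<open>q\<close> on
  a section at \<open>q\<close> this leaves only \<open>R(p) = R(q) cosh s\<close> or \<open>R(q) = R(p) cosh s\<close>, where \<open>s\<close> is the
  angle between \<open>n(p)\<close> and the hyperplane, which is of first order in the distance of \<open>p\<close> and
  \<open>q\<close>. So \<open>R\<close> is flat along two sections whose tangent spaces span, and a minimisation argument
  that needs no differentiability of \<open>R\<close> shows that \<open>R\<close> is constant. Then \<open>s = 0\<close>, so \<open>c\<close> is locally
  constant along the sections and, by the same argument, constant. Hence every component is a
  hyperbolic space. There is only one of them because a normal hyperplane of one component meets
  every other, while its intersection with the hypersurface is connected.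
\<close>

section \<open>Lorentzian linear algebra\<close>

text \<open>The sections are given point by point. Neither their radius nor their hyperplanes are
  known to depend continuously on the point, so the radius cannot be differentiated. What closedness
  of \<Sigma> provides is that a convergent sequence of radii at points tending to \<open>q\<close>
  has the radius at \<open>q\<close> as its limit; this is enough for a minimum to be attained.

  Orthogonality to the common null directions is strong because these span: if \<open>a\<close> and
  \<open>b\<close> are the unit normals of the two hyperplanes and
  \<open>\<bar>lorentz a b\<bar> < 1\<close>, then the plane of \<open>a\<close> and
  \<open>b\<close> is spacelike, its complement is Lorentzian of dimension at least two since m
  \<ge> 3, and the difference of the centres must lie in the plane. The bound can fail for one
  section at \<open>q\<close>, which is one use of the second section: for \<open>p\<close> near
  \<open>q\<close>, no unit vector orthogonal to the normal at \<open>p\<close> violates it for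
  both.

  That \<open>R\<close> has the same sign everywhere comes from the same comparison at infinity:
  sections opening into opposite time directions would contain timelike separated points.\<close>

lemma lorentz_commute: "lorentz x y = lorentz y x"
  by (simp add: lorentz_def inner_commute mult.commute)

lemma lorentz_algebra [simp]:
  "lorentz (x + y) z = lorentz x z + lorentz y z"
  "lorentz z (x + y) = lorentz z x + lorentz z y"
  "lorentz (x - y) z = lorentz x z - lorentz y z"
  "lorentz z (x - y) = lorentz z x - lorentz z y"
  "lorentz (- x) z = - lorentz x z"
  "lorentz z (- x) = - lorentz z x"
  "lorentz (r *\<^sub>R x) z = r * lorentz x z"
  "lorentz z (r *\<^sub>R x) = r * lorentz z x"
  "lorentz 0 z = 0"
  "lorentz z 0 = 0"
  by (simp_all add: lorentz_def inner_left_distrib inner_right_distrib inner_diff_left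
      inner_diff_right algebra_simps)

text \<open>Exchanges the Lorentzian and the Euclidean product, so that dimension counts and
  hyperplane facts for the inner product carry over to Lorentzian orthogonality.\<close>

definition time_reflection :: "'m::finite minkowski \<Rightarrow> 'm minkowski"
  where "time_reflection x = (- fst x, snd x)"

lemma lorentz_eq_inner: "lorentz x y = time_reflection x \<bullet> y"
  by (simp add: lorentz_def time_reflection_def inner_prod_def)

lemma lorentz_time_reflection: "lorentz (time_reflection x) y = x \<bullet> y"
  by (simp add: lorentz_def time_reflection_def inner_prod_def)

lemma tendsto_lorentz [tendsto_intros]:
  assumes "(f \<longlongrightarrow> a) F" "(g \<longlongrightarrow> b) F"
  shows "((\<lambda>x. lorentz (f x) (g x)) \<longlongrightarrow> lorentz a b) F"
  unfolding lorentz_def by (intro tendsto_intros assms)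

lemma continuous_on_lorentz [continuous_intros]:
  assumes "continuous_on S f" "continuous_on S g"
  shows "continuous_on S (\<lambda>x. lorentz (f x) (g x))"
  unfolding lorentz_def by (intro continuous_intros assms)

lemma abs_lorentz_le: "\<bar>lorentz x y\<bar> \<le> norm x * norm y"
proof -
  have "norm (time_reflection x) = norm x"
    by (simp add: time_reflection_def norm_prod_def)
  then show ?thesis
    by (metis Cauchy_Schwarz_ineq2 lorentz_eq_inner)
qed

lemma lorentz_pos_iff: "lorentz x x > 0 \<longleftrightarrow> \<bar>fst x\<bar> < norm (snd x)"
proof -
  have "lorentz x x = (norm (snd x))\<^sup>2 - \<bar>fst x\<bar>\<^sup>2"
    by (simp add: lorentz_def dot_square_norm power2_eq_square)
  then show ?thesis
    using power_mono_iff[of "norm (snd x)" "\<bar>fst x\<bar>" 2] by (simp add: not_le[symmetric])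
qed

lemma lorentz_neg_iff: "lorentz x x < 0 \<longleftrightarrow> norm (snd x) < \<bar>fst x\<bar>"
proof -
  have "lorentz x x = (norm (snd x))\<^sup>2 - \<bar>fst x\<bar>\<^sup>2"
    by (simp add: lorentz_def dot_square_norm power2_eq_square)
  then show ?thesis
    using power_mono_iff[of "\<bar>fst x\<bar>" "norm (snd x)" 2] by (simp add: not_le[symmetric])
qed

text \<open>Cauchy-Schwarz in the spatial factor passes the inequality
  \<open>norm (snd u) < \<bar>fst u\<bar>\<close> on to \<open>v\<close> in reversed form. Later,
  vectors are shown to vanish this way: they are orthogonal to a timelike vector and have square
  zero.\<close>

lemma timelike_orthogonal_pos:
  assumes "lorentz u u < 0" "lorentz u v = 0" "v \<noteq> 0"
  shows "lorentz v v > 0"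
proof (cases "snd v = 0")
  case True
  then have "fst u * fst v = 0"
    using assms(2) by (simp add: lorentz_def)
  moreover have "fst u \<noteq> 0"
    using assms(1) by (auto simp: lorentz_neg_iff)
  ultimately show ?thesis
    using True assms(3) by (simp add: prod_eq_iff)
next
  case False
  have "\<bar>fst u\<bar> * \<bar>fst v\<bar> = \<bar>snd u \<bullet> snd v\<bar>"
    using assms(2) by (simp add: lorentz_def flip: abs_mult)
  also have "\<dots> \<le> norm (snd u) * norm (snd v)"
    by (rule Cauchy_Schwarz_ineq2)
  also have "\<dots> < \<bar>fst u\<bar> * norm (snd v)"
    using False assms(1) by (simp add: lorentz_neg_iff)
  finally have "\<bar>fst v\<bar> < norm (snd v)"
    by (simp add: mult_less_cancel_left)
  then show ?thesis
    by (simp add: lorentz_pos_iff)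
qed

lemma timelike_orthogonal_nonneg:
  assumes "lorentz u u < 0" "lorentz u v = 0"
  shows "lorentz v v \<ge> 0"
  using timelike_orthogonal_pos[OF assms] by (cases "v = 0") auto

text \<open>The standard hyperbolic space. The hyperbolic spaces below are images of parts of it
  under m -> c + R m, where the sign of R takes care of past-directed sheets.\<close>

definition future_unit :: "'m::finite minkowski \<Rightarrow> bool"
  where "future_unit m \<longleftrightarrow> lorentz m m = -1 \<and> fst m > 0"

lemma timelike_lorentz_neg:
  assumes "lorentz m m < 0" "lorentz n n < 0" "fst m > 0" "fst n > 0"
  shows "lorentz m n < 0"
proof -
  have "snd m \<bullet> snd n \<le> norm (snd m) * norm (snd n)"
    by (rule norm_cauchy_schwarz)
  also have "\<dots> < fst m * fst n"
    using assms by (intro mult_strict_mono') (auto simp: lorentz_neg_iff)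
  finally show ?thesis
    by (simp add: lorentz_def)
qed

lemma timelike_future:
  assumes "lorentz m m < 0" "future_unit n" "lorentz m n < 0"
  shows "fst m > 0"
proof (rule ccontr)
  assume "\<not> fst m > 0"
  moreover have "fst m \<noteq> 0"
    using assms(1) by (auto simp: lorentz_neg_iff)
  ultimately have "fst (- m) > 0" by simp
  then have "lorentz (- m) n < 0"
    using assms timelike_lorentz_neg[of "- m" n] by (auto simp: future_unit_def)
  then show False using assms(3) by simp
qed

text \<open>The reversed Cauchy-Schwarz inequality: the part \<open>w\<close> of \<open>n\<close>
  orthogonal to \<open>m\<close> has square \<open>a\<^sup>2 - 1\<close>, which is nonnegative and
  vanishes only with \<open>w\<close>.\<close>

lemma future_unit_lorentz:
  assumes "future_unit m" "future_unit n"
  shows "lorentz m n \<le> -1" "lorentz m n = -1 \<Longrightarrow> m = n"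
proof -
  define a where "a = - lorentz m n"
  define w where "w = n - a *\<^sub>R m"
  have a: "a > 0"
    using timelike_lorentz_neg[of m n] assms by (simp add: a_def future_unit_def)
  have w: "lorentz m w = 0"
    using assms by (simp add: w_def a_def future_unit_def)
  have ww: "lorentz w w = a\<^sup>2 - 1"
    using assms by (simp add: w_def future_unit_def a_def lorentz_commute[of n m] power2_eq_square)
  have "lorentz w w \<ge> 0"
    using timelike_orthogonal_nonneg[OF _ w] assms by (simp add: future_unit_def)
  then have "1 \<le> a" using ww a power2_le_imp_le[of 1 a] by simp
  then show "lorentz m n \<le> -1" by (simp add: a_def)
  assume "lorentz m n = -1"
  then have "a = 1" by (simp add: a_def)
  then have "lorentz w w = 0" by (simp add: ww)
  then have "w = 0"
    using timelike_orthogonal_pos[OF _ w] assms by (auto simp: future_unit_def)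
  then show "m = n" using \<open>a = 1\<close> by (simp add: w_def)
qed

text \<open>The factor is exported explicitly because the unit normal must later be differentiated
  as a function of the gradient.\<close>

lemma timelike_normalize:
  assumes "lorentz u u < 0"
  obtains s where "s = sgn (fst u) / sqrt (- lorentz u u)" "s \<noteq> 0" "future_unit (s *\<^sub>R u)"
proof -
  define s where "s = sgn (fst u) / sqrt (- lorentz u u)"
  have fst0: "fst u \<noteq> 0" using assms by (auto simp: lorentz_neg_iff)
  then have s0: "s \<noteq> 0" using assms by (simp add: s_def sgn_0_0)
  have "s * s = (sgn (fst u) * sgn (fst u)) / (sqrt (- lorentz u u) * sqrt (- lorentz u u))"
    by (simp add: s_def)
  also have "sgn (fst u) * sgn (fst u) = 1" using fst0 by (simp add: sgn_real_def)
  finally have "s * s * lorentz u u = -1"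
    using assms by simp
  moreover have "s * fst u > 0"
  proof -
    have "s * fst u = \<bar>fst u\<bar> / sqrt (- lorentz u u)"
      by (simp add: s_def abs_sgn mult.commute)
    also have "\<dots> > 0" using fst0 assms by simp
    finally show ?thesis .
  qed
  ultimately have "future_unit (s *\<^sub>R u)"
    by (simp add: future_unit_def mult.assoc)
  then show thesis using that s_def s0 by blast
qed

text \<open>With \<open>y\<close> the hyperbolic sine of arc length this is the geodesic of the unit
  hyperboloid through \<open>n\<close> in direction \<open>v\<close>.\<close>

lemma future_unit_hyperbola:
  assumes "future_unit n" "lorentz v v = 1" "lorentz n v = 0"
  shows "future_unit (sqrt (1 + y\<^sup>2) *\<^sub>R n + y *\<^sub>R v)"
proof -
  let ?m = "sqrt (1 + y\<^sup>2) *\<^sub>R n + y *\<^sub>R v"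
  have vn: "lorentz v n = 0" using assms(3) by (simp add: lorentz_commute)
  have s: "sqrt (1 + y\<^sup>2) * sqrt (1 + y\<^sup>2) = 1 + y\<^sup>2" by (simp add: add_nonneg_nonneg)
  have m: "lorentz ?m ?m = -1"
  proof -
    have "lorentz ?m ?m = (sqrt (1 + y\<^sup>2) * sqrt (1 + y\<^sup>2)) * lorentz n n + y\<^sup>2"
      using assms(2,3) vn by (simp add: power2_eq_square)
    then show ?thesis
      using assms(1) unfolding s by (simp add: future_unit_def)
  qed
  have "lorentz ?m n = - sqrt (1 + y\<^sup>2)"
    using assms vn by (simp add: future_unit_def)
  also have "\<dots> < 0" by (simp add: add_pos_nonneg)
  finally have "lorentz ?m n < 0" .
  then have "fst ?m > 0"
    by (intro timelike_future[OF _ assms(1)]) (simp only: m, simp)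
  with m show ?thesis
    unfolding future_unit_def by blast
qed

section \<open>Vectors orthogonal to given ones\<close>

lemma exists_orthogonal3:
  fixes a b c :: "'m::finite minkowski"
  assumes "CARD('m) \<ge> 3"
  obtains w where "w \<noteq> 0" "lorentz a w = 0" "lorentz b w = 0" "lorentz c w = 0"
proof -
  let ?S = "time_reflection ` {a, b, c}"
  have "dim ?S \<le> card ?S" by (rule dim_le_card') simp
  also have "\<dots> \<le> card {a, b, c}" by (rule card_image_le) simp
  also have "\<dots> \<le> 3" by (simp add: card_insert_if)
  also have "\<dots> < DIM('m minkowski)" using assms by simp
  finally obtain w where "w \<noteq> 0" and w: "\<And>y. y \<in> span ?S \<Longrightarrow> orthogonal w y"
    using orthogonal_to_subspace_exists by blast
  have "lorentz u w = 0" if "u \<in> {a, b, c}" for u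
  proof -
    have "time_reflection u \<in> span ?S"
      using that by (intro span_base imageI)
    from w[OF this] show ?thesis
      by (simp add: orthogonal_def lorentz_eq_inner inner_commute)
  qed
  then show thesis using that \<open>w \<noteq> 0\<close> by blast
qed

text \<open>Three linear conditions have a nonzero solution in dimension at least four, hence m
  \<ge> 3; orthogonality to the timelike \<open>n\<close> makes it spacelike.\<close>

lemma exists_unit_orthogonal3:
  fixes n :: "'m::finite minkowski"
  assumes "CARD('m) \<ge> 3" "lorentz n n < 0"
  obtains v where "lorentz v v = 1" "lorentz n v = 0" "lorentz a v = 0" "lorentz b v = 0"
proof -
  obtain w where w: "w \<noteq> 0" "lorentz n w = 0" "lorentz a w = 0" "lorentz b w = 0"
    using exists_orthogonal3[OF assms(1)] by metis
  have pos: "lorentz w w > 0"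
    using timelike_orthogonal_pos[OF assms(2)] w by blast
  define v where "v = (1 / sqrt (lorentz w w)) *\<^sub>R w"
  have "lorentz v v = 1"
    using pos by (simp add: v_def)
  moreover have "lorentz n v = 0" "lorentz a v = 0" "lorentz b v = 0"
    using w by (simp_all add: v_def)
  ultimately show thesis using that by blast
qed

text \<open>The Lorentzian square does not control the Euclidean size of a spacelike vector, but
  orthogonality to \<open>n\<close> does, through Cauchy-Schwarz. This makes unit vectors orthogonal
  to a bounded family of normals a bounded set.\<close>

lemma norm_unit_orthogonal_le:
  assumes "future_unit n" "lorentz v v = 1" "lorentz n v = 0"
  shows "norm v \<le> 2 * fst n"
proof -
  let ?a = "(norm (snd n))\<^sup>2" and ?b = "(norm (snd v))\<^sup>2"
  have a: "?a = (fst n)\<^sup>2 - 1" and b: "?b = (fst v)\<^sup>2 + 1"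
    using assms(1,2) by (simp_all add: future_unit_def lorentz_def dot_square_norm power2_eq_square)
  have "\<bar>fst n * fst v\<bar> \<le> norm (snd n) * norm (snd v)"
    using assms(3) Cauchy_Schwarz_ineq2[of "snd n" "snd v"] by (simp add: lorentz_def)
  then have "(fst n * fst v)\<^sup>2 \<le> (norm (snd n) * norm (snd v))\<^sup>2"
    by (simp flip: abs_le_square_iff add: abs_mult)
  then have "(fst n)\<^sup>2 * (fst v)\<^sup>2 \<le> ((fst n)\<^sup>2 - 1) * ((fst v)\<^sup>2 + 1)"
    by (simp add: power_mult_distrib a b)
  then have le: "(fst v)\<^sup>2 + 1 \<le> (fst n)\<^sup>2"
    by (simp add: algebra_simps)
  have "(norm v)\<^sup>2 = (fst v)\<^sup>2 + ?b"
    by (simp add: norm_prod_def)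
  also have "\<dots> \<le> (2 * fst n)\<^sup>2"
  proof -
    have "(2 * fst n)\<^sup>2 = 4 * (fst n)\<^sup>2" by (simp add: power_mult_distrib)
    then show ?thesis
      using le b zero_le_power2[of "fst v"] zero_le_power2[of "fst n"] by linarith
  qed
  finally show ?thesis
    by (rule power2_le_imp_le) (use assms(1) in \<open>simp add: future_unit_def\<close>)
qed

text \<open>A double orthogonal complement: the defect \<open>z\<close> of the projection of
  \<open>x\<close> to the plane of \<open>n\<close> and \<open>a\<close> is orthogonal to both,
  hence to \<open>x\<close> and to itself, and the complement of \<open>n\<close> is
  definite.\<close>

lemma orthogonal_complement_unit:
  fixes n :: "'a::finite minkowski"
  assumes n: "future_unit n" and "\<And>w. lorentz n w = 0 \<Longrightarrow> lorentz a w = 0 \<Longrightarrow> lorentz x w = 0"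
    and a: "lorentz a a = 1" "lorentz n a = 0"
  shows "x = (- lorentz x n) *\<^sub>R n + lorentz x a *\<^sub>R a"
proof -
  define z where "z = x + lorentz x n *\<^sub>R n - lorentz x a *\<^sub>R a"
  have z: "lorentz n z = 0" "lorentz a z = 0"
    using n a by (simp_all add: z_def future_unit_def lorentz_commute[of n x] lorentz_commute[of a x]
        lorentz_commute[of a n])
  have "lorentz z z = lorentz x z + lorentz x n * lorentz n z - lorentz x a * lorentz a z"
    by (subst (1) z_def) simp
  then have "lorentz z z = 0" using assms(2)[OF z] z by simp
  then have "z = 0"
    using timelike_orthogonal_pos[of n z] z n by (auto simp: future_unit_def)
  moreover have "p = - q + r" if "p + q - r = 0" for p q r :: "'a minkowski"
    using that by (simp add: algebra_simps)
  ultimately show ?thesis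
    unfolding z_def scaleR_minus_left by blast
qed

lemma orthogonal_complement_future_unit:
  fixes n :: "'a::finite minkowski"
  assumes n: "future_unit n" and "\<And>w. lorentz n w = 0 \<Longrightarrow> lorentz x w = 0"
  shows "x = (- lorentz x n) *\<^sub>R n"
proof -
  define z where "z = x + lorentz x n *\<^sub>R n"
  have z: "lorentz n z = 0"
    using n by (simp add: z_def future_unit_def lorentz_commute[of n x])
  have "lorentz z z = lorentz x z + lorentz x n * lorentz n z"
    by (subst (1) z_def) simp
  then have "lorentz z z = 0" using assms(2)[OF z] z by simp
  then have "z = 0"
    using timelike_orthogonal_pos[of n z] z n by (auto simp: future_unit_def)
  moreover have "p = - q" if "p + q = 0" for p q :: "'a minkowski"
    using that by (simp add: eq_neg_iff_add_eq_0)
  ultimately show ?thesis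
    unfolding z_def scaleR_minus_left by blast
qed

text \<open>The bound \<open>ab\<close> makes the plane of \<open>a\<close> and \<open>b\<close>
  positive definite. Its complement is then Lorentzian and, having dimension at least two, spanned
  by its null vectors \<open>e + w\<close>.\<close>

lemma orthogonal_null_vectors_span:
  fixes a b d :: "'m::finite minkowski"
  assumes card: "CARD('m) \<ge> 3" and a: "lorentz a a = 1" and b: "lorentz b b = 1"
    and ab: "\<bar>lorentz a b\<bar> < 1"
    and null: "\<And>e w. future_unit e \<Longrightarrow> lorentz w w = 1 \<Longrightarrow> lorentz e w = 0 \<Longrightarrow>
      lorentz a e = 0 \<Longrightarrow> lorentz a w = 0 \<Longrightarrow> lorentz b e = 0 \<Longrightarrow> lorentz b w = 0 \<Longrightarrow>
      lorentz d (e + w) = 0"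
  obtains x y where "d = x *\<^sub>R a + y *\<^sub>R b"
proof -
  define k where "k = lorentz a b"
  have ba: "lorentz b a = k" by (simp add: k_def lorentz_commute)
  have k1: "1 - k\<^sup>2 > 0"
    using ab abs_square_less_1[of k] by (simp add: k_def)
  \<comment> \<open>Orthogonal projection to the plane, from the inverse of the Gram matrix, whose
    determinant is \<open>1 - k\<^sup>2\<close>.\<close>
  define pr :: "'m minkowski \<Rightarrow> 'm minkowski" where
    "pr v = ((lorentz a v - k * lorentz b v) / (1 - k\<^sup>2)) *\<^sub>R a
          + ((lorentz b v - k * lorentz a v) / (1 - k\<^sup>2)) *\<^sub>R b" for v
  have pra: "lorentz a (pr v) = lorentz a v" for v
  proof -
    have "lorentz a (pr v) = ((lorentz a v - k * lorentz b v) + (lorentz b v - k * lorentz a v) * k) / (1 - k\<^sup>2)"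
      by (simp add: pr_def a k_def[symmetric] add_divide_distrib)
    also have "\<dots> = lorentz a v * (1 - k\<^sup>2) / (1 - k\<^sup>2)"
      by (simp add: algebra_simps power2_eq_square)
    finally show ?thesis using k1 by simp
  qed
  have prb: "lorentz b (pr v) = lorentz b v" for v
  proof -
    have "lorentz b (pr v) = ((lorentz a v - k * lorentz b v) * k + (lorentz b v - k * lorentz a v)) / (1 - k\<^sup>2)"
      by (simp add: pr_def b ba add_divide_distrib)
    also have "\<dots> = lorentz b v * (1 - k\<^sup>2) / (1 - k\<^sup>2)"
      by (simp add: algebra_simps power2_eq_square)
    finally show ?thesis using k1 by simp
  qed
  define t :: "'m minkowski" where "t = (1, 0)"
  \<comment> \<open>Removing its component in a positive definite plane keeps a timelike vector
    timelike, so the complement of the plane contains one.\<close>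
  define e0 where "e0 = t - pr t"
  have e0: "lorentz a e0 = 0" "lorentz b e0 = 0"
    by (simp_all add: e0_def pra prb)
  have pos: "lorentz (x *\<^sub>R a + y *\<^sub>R b) (x *\<^sub>R a + y *\<^sub>R b) \<ge> 0" for x y
  proof -
    have "lorentz (x *\<^sub>R a + y *\<^sub>R b) (x *\<^sub>R a + y *\<^sub>R b) = (x + k * y)\<^sup>2 + (1 - k\<^sup>2) * y\<^sup>2"
      by (simp add: a b ba k_def[symmetric] algebra_simps power2_eq_square)
    also have "\<dots> \<ge> 0" using k1 by simp
    finally show ?thesis .
  qed
  have e0pr: "lorentz e0 (pr v) = 0" for v
    using e0 by (simp add: pr_def lorentz_commute)
  have "lorentz t t = lorentz (e0 + pr t) (e0 + pr t)"
    by (simp add: e0_def)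
  also have "\<dots> = lorentz e0 e0 + lorentz (pr t) (pr t)"
    unfolding lorentz_algebra using e0pr[of t] lorentz_commute[of "pr t" e0] by linarith
  finally have tt: "lorentz t t = lorentz e0 e0 + lorentz (pr t) (pr t)" .
  have "lorentz (pr t) (pr t) \<ge> 0"
    unfolding pr_def by (rule pos)
  moreover have "lorentz t t = -1" by (simp add: t_def lorentz_def)
  ultimately have e0neg: "lorentz e0 e0 < 0" using tt by linarith
  obtain s where e': "future_unit (s *\<^sub>R e0)"
    using timelike_normalize[OF e0neg] by blast
  define e where "e = s *\<^sub>R e0"
  have e: "future_unit e" using e' by (simp add: e_def)
  have ae: "lorentz a e = 0" "lorentz b e = 0" using e0 by (simp_all add: e_def)
  \<comment> \<open>Both \<open>e + w\<close> and \<open>e - w\<close> are admissible null vectors,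
    which separates the conditions on \<open>e\<close> and on \<open>w\<close>.\<close>
  have dw: "lorentz d e = 0 \<and> lorentz d w = 0"
    if w: "lorentz w w = 1" "lorentz e w = 0" "lorentz a w = 0" "lorentz b w = 0" for w
    using null[OF e w(1,2) ae(1) w(3) ae(2) w(4)] null[OF e, of "- w"] w ae by simp
  obtain w0 where w0: "lorentz w0 w0 = 1" "lorentz e w0 = 0" "lorentz a w0 = 0" "lorentz b w0 = 0"
    using exists_unit_orthogonal3[OF card, of e a b] e by (auto simp: future_unit_def)
  have de: "lorentz d e = 0" using dw[OF w0] by simp
  define z where "z = d - pr d"
  have z: "lorentz a z = 0" "lorentz b z = 0"
    by (simp_all add: z_def pra prb)
  have ez: "lorentz e z = 0"
    using de ae by (simp add: z_def pr_def lorentz_commute)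
  have "z = 0"
  proof (rule ccontr)
    assume "z \<noteq> 0"
    then have zz: "lorentz z z > 0"
      using timelike_orthogonal_pos[OF _ ez] e by (simp add: future_unit_def)
    define w where "w = (1 / sqrt (lorentz z z)) *\<^sub>R z"
    have "lorentz w w = 1" using zz by (simp add: w_def)
    then have "lorentz d w = 0"
      using dw[of w] z ez by (simp add: w_def)
    then have "lorentz d z = 0" using zz by (simp add: w_def)
    moreover have "lorentz (pr d) z = 0" using z by (simp add: pr_def)
    ultimately have "lorentz z z = 0" by (simp add: z_def)
    then show False using zz by simp
  qed
  then have "d = pr d" unfolding z_def by (rule iffD1[OF right_minus_eq])
  then show thesis using that unfolding pr_def by blast
qed

section \<open>Lifting straight segments to a locally acausal set\<close>

text \<open>A maximum of \<phi> cannot lie to the right of \<open>a\<close>, because a larger value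
  is found on its left. This turns strict contraction near each point into strict contraction over a
  whole segment.\<close>

lemma locally_left_decreasing_imp_less:
  fixes \<phi> :: "real \<Rightarrow> real"
  assumes "a < b" and cont: "continuous_on {a..b} \<phi>"
    and dec: "\<And>s. a < s \<Longrightarrow> s \<le> b \<Longrightarrow> \<exists>s'. a \<le> s' \<and> s' < s \<and> \<phi> s < \<phi> s'"
  shows "\<phi> b < \<phi> a"
proof -
  obtain m where m: "m \<in> {a..b}" and max: "\<And>s. s \<in> {a..b} \<Longrightarrow> \<phi> s \<le> \<phi> m"
    using continuous_attains_sup[of "{a..b}" \<phi>] assms(1) cont by auto
  have "m = a"
  proof (rule ccontr)
    assume "m \<noteq> a"
    then obtain s where "a \<le> s" "s < m" "\<phi> m < \<phi> s"
      using dec[of m] m by auto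
    then show False using max[of s] m by auto
  qed
  moreover obtain s where "a \<le> s" "s < b" "\<phi> b < \<phi> s"
    using dec[of b] assms(1) by auto
  ultimately show ?thesis using max[of s] by auto
qed

text \<open>Path lifting for the projection \<open>snd\<close>: \<open>g\<close> is the time
  coordinate of a path in \<open>S\<close> above the segment from \<open>snd x\<close> with velocity
  \<open>w\<close>. The length \<open>T\<close> varies in the continuation argument, while
  compactness works with \<open>T = 1\<close>.\<close>

definition lift :: "(real \<times> 'a::euclidean_space) set \<Rightarrow> real \<Rightarrow> real \<times> 'a \<Rightarrow> 'a \<Rightarrow> (real \<Rightarrow> real) \<Rightarrow> bool"
  where "lift S T x w g \<longleftrightarrow> continuous_on {0..T} g \<and> g 0 = fst x \<and>
    (\<forall>s\<in>{0..T}. (g s, snd x + s *\<^sub>R w) \<in> S)"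

lemma lift_rescale:
  assumes "lift S T x w g" "T \<ge> 0"
  shows "lift S 1 x (T *\<^sub>R w) (\<lambda>s. g (T * s))"
proof -
  have "continuous_on {0..1} (\<lambda>s. g (T * s))"
    by (rule continuous_on_compose2[of "{0..T}" g])
       (use assms in \<open>auto simp: lift_def intro!: continuous_intros mult_left_le\<close>)
  moreover have "(g (T * s), snd x + s *\<^sub>R T *\<^sub>R w) \<in> S" if "s \<in> {0..1}" for s
  proof -
    have "T * s \<in> {0..T}" using that assms(2) by (auto intro: mult_left_le)
    then have "(g (T * s), snd x + (T * s) *\<^sub>R w) \<in> S" using assms(1) by (auto simp: lift_def)
    then show ?thesis by (simp add: mult.commute)
  qed
  ultimately show ?thesis using assms by (simp add: lift_def)
qed

lemma lift_rescale':
  assumes "lift S 1 x (T *\<^sub>R w) h" "T > 0"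
  shows "lift S T x w (\<lambda>s. h (s / T))"
proof -
  have "continuous_on {0..T} (\<lambda>s. h (s / T))"
    by (rule continuous_on_compose2[of "{0..1}" h])
       (use assms in \<open>auto simp: lift_def intro!: continuous_intros\<close>)
  moreover have "(h (s / T), snd x + s *\<^sub>R w) \<in> S" if "s \<in> {0..T}" for s
  proof -
    have "s / T \<in> {0..1}" using that assms(2) by auto
    then have "(h (s / T), snd x + (s / T) *\<^sub>R T *\<^sub>R w) \<in> S" using assms(1) unfolding lift_def by blast
    then show ?thesis using assms(2) by simp
  qed
  ultimately show ?thesis using assms by (simp add: lift_def)
qed

lemma lift_reverse:
  assumes "lift S 1 x w g"
  shows "lift S 1 (g 1, snd x + w) (- w) (\<lambda>s. g (1 - s))"
proof -
  have "continuous_on {0..1} (\<lambda>s. g (1 - s))"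
    by (rule continuous_on_compose2[of "{0..1}" g])
       (use assms in \<open>auto simp: lift_def intro!: continuous_intros\<close>)
  moreover have "(g (1 - s), snd x + w + s *\<^sub>R (- w)) \<in> S" if "s \<in> {0..1}" for s
  proof -
    have "1 - s \<in> {0..1}" using that by auto
    then have "(g (1 - s), snd x + (1 - s) *\<^sub>R w) \<in> S" using assms(1) by (auto simp: lift_def)
    then show ?thesis by (simp add: algebra_simps)
  qed
  ultimately show ?thesis by (simp add: lift_def)
qed

text \<open>The input of the lifting argument: \<open>locally_onto\<close> gives existence of a
  height over nearby spatial points, \<open>locally_acausal\<close> its uniqueness and
  continuity.\<close>

locale locally_spacelike_graph =
  fixes S :: "(real \<times> 'a::euclidean_space) set"
  assumes closed: "closed S"
    and locally_acausal: "\<And>z. z \<in> S \<Longrightarrow> \<exists>\<delta>>0. \<forall>z1\<in>S \<inter> ball z \<delta>. \<forall>z2\<in>S \<inter> ball z \<delta>.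
      z1 \<noteq> z2 \<longrightarrow> \<bar>fst z1 - fst z2\<bar> < norm (snd z1 - snd z2)"
    and locally_onto: "\<And>z \<epsilon>. z \<in> S \<Longrightarrow> \<epsilon> > 0 \<Longrightarrow>
      \<exists>\<eta>>0. \<forall>y\<in>ball (snd z) \<eta>. \<exists>t. \<bar>t - fst z\<bar> < \<epsilon> \<and> (t, y) \<in> S"
begin

lemma lift_local:
  assumes g: "lift S T x w g" and s: "s \<in> {0..T}" and e: "e > 0"
  shows "\<exists>d>0. \<forall>s'\<in>{0..T}. \<bar>s' - s\<bar> < d \<longrightarrow> (g s', snd x + s' *\<^sub>R w) \<in> S \<inter> ball (g s, snd x + s *\<^sub>R w) e"
proof -
  have "continuous_on {0..T} (\<lambda>s. (g s, snd x + s *\<^sub>R w))"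
    using g by (auto simp: lift_def intro!: continuous_intros)
  then obtain d where "d > 0" "\<forall>s'\<in>{0..T}. dist s' s < d \<longrightarrow>
      dist (g s', snd x + s' *\<^sub>R w) (g s, snd x + s *\<^sub>R w) < e"
    using s e unfolding continuous_on_iff by blast
  then show ?thesis
    using g by (intro exI[of _ d]) (auto simp: lift_def dist_real_def dist_commute)
qed

text \<open>The slope \<open>c\<close> is kept apart from \<open>norm w\<close> so that the strict
  inequality survives for \<open>w = 0\<close>. Local acausality gives the contraction just to the
  left of each parameter.\<close>

lemma lift_less:
  assumes g: "lift S T x w g" and s: "0 \<le> s0" "s0 < s1" "s1 \<le> T" and c: "c > 0" "c \<ge> norm w"
  shows "\<bar>g s1 - g s0\<bar> < c * (s1 - s0)"
proof -
  have loc: "\<exists>s'. s0 \<le> s' \<and> s' < s \<and> \<bar>g s - g s'\<bar> < c * (s - s')" if "s0 < s" "s \<le> s1" for s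
  proof -
    let ?p = "\<lambda>s. (g s, snd x + s *\<^sub>R w)"
    have sT: "s \<in> {0..T}" using s that by auto
    then have "?p s \<in> S" using g by (simp add: lift_def)
    then obtain e where "e > 0" and e: "\<And>z1 z2. z1 \<in> S \<inter> ball (?p s) e \<Longrightarrow> z2 \<in> S \<inter> ball (?p s) e \<Longrightarrow>
        z1 \<noteq> z2 \<Longrightarrow> \<bar>fst z1 - fst z2\<bar> < norm (snd z1 - snd z2)"
      using locally_acausal by blast
    obtain d where "d > 0" and d: "\<And>s'. s' \<in> {0..T} \<Longrightarrow> \<bar>s' - s\<bar> < d \<Longrightarrow> ?p s' \<in> S \<inter> ball (?p s) e"
      using lift_local[OF g sT \<open>e > 0\<close>] by blast
    define s' where "s' = max s0 (s - d / 2)"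
    have s': "s0 \<le> s'" "s' < s" "\<bar>s' - s\<bar> < d" "s' \<in> {0..T}"
      using \<open>d > 0\<close> that s by (auto simp: s'_def)
    have "\<bar>g s - g s'\<bar> < c * (s - s')"
    proof (cases "g s = g s'")
      case True
      then show ?thesis using s' c by simp
    next
      case False
      then have "\<bar>g s - g s'\<bar> < norm ((snd x + s *\<^sub>R w) - (snd x + s' *\<^sub>R w))"
        using e[of "?p s" "?p s'"] d[of s] d[of s'] s' sT \<open>d > 0\<close> by auto
      also have "\<dots> = norm ((s - s') *\<^sub>R w)" by (simp add: algebra_simps)
      also have "\<dots> = norm w * (s - s')" using s' by simp
      also have "\<dots> \<le> c * (s - s')" using c s' by (intro mult_right_mono) auto
      finally show ?thesis .
    qed
    with s' show ?thesis by blast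
  qed
  have cont: "continuous_on {s0..s1} g"
    by (rule continuous_on_subset[of "{0..T}"]) (use g s in \<open>auto simp: lift_def\<close>)
  have "g s1 - c * s1 < g s0 - c * s0"
  proof (rule locally_left_decreasing_imp_less[of s0 s1 "\<lambda>s. g s - c * s"])
    show "continuous_on {s0..s1} (\<lambda>s. g s - c * s)" by (intro continuous_intros cont)
    show "\<exists>s'\<ge>s0. s' < s \<and> g s - c * s < g s' - c * s'" if "s0 < s" "s \<le> s1" for s
      using loc[OF that] by (auto simp: algebra_simps abs_less_iff)
  qed fact
  moreover have "- g s1 - c * s1 < - g s0 - c * s0"
  proof (rule locally_left_decreasing_imp_less[of s0 s1 "\<lambda>s. - g s - c * s"])
    show "continuous_on {s0..s1} (\<lambda>s. - g s - c * s)" by (intro continuous_intros cont)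
    show "\<exists>s'\<ge>s0. s' < s \<and> - g s - c * s < - g s' - c * s'" if "s0 < s" "s \<le> s1" for s
      using loc[OF that] by (auto simp: algebra_simps abs_less_iff)
  qed fact
  ultimately show ?thesis by (simp add: algebra_simps abs_less_iff)
qed

lemma lift_le:
  assumes g: "lift S T x w g" and s: "s0 \<in> {0..T}" "s1 \<in> {0..T}"
  shows "\<bar>g s1 - g s0\<bar> \<le> norm w * \<bar>s1 - s0\<bar>"
proof -
  have *: "\<bar>g b - g a\<bar> \<le> norm w * (b - a)" if ab: "0 \<le> a" "a < b" "b \<le> T" for a b
  proof (rule field_le_epsilon)
    fix e :: real assume "e > 0"
    define c where "c = norm w + e / (b - a)"
    have "c > 0" "c \<ge> norm w" using \<open>e > 0\<close> ab by (auto simp: c_def add_nonneg_pos)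
    then have "\<bar>g b - g a\<bar> < c * (b - a)" using lift_less[OF g ab] by blast
    then show "\<bar>g b - g a\<bar> \<le> norm w * (b - a) + e"
      using ab by (simp add: c_def distrib_right)
  qed
  show ?thesis
    using *[of s0 s1] *[of s1 s0] s by (cases s0 s1 rule: linorder_cases) auto
qed

text \<open>The set of agreement is open: near such a parameter both lifts stay in a ball in which
  two points of \<open>S\<close> with equal spatial part coincide.\<close>

lemma lift_unique:
  assumes g: "lift S T x w g" and h: "lift S T x w h" and s: "s \<in> {0..T}"
  shows "g s = h s"
proof -
  let ?E = "{s \<in> {0..T}. g s = h s}"
  have cg: "continuous_on {0..T} g" and ch: "continuous_on {0..T} h"
    using g h by (auto simp: lift_def)
  have "closedin (top_of_set {0..T}) {s \<in> {0..T}. (\<lambda>s. g s - h s) s = 0}"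
    by (rule continuous_closedin_preimage_constant) (intro continuous_intros cg ch)
  then have clo: "closedin (top_of_set {0..T}) ?E" by simp
  have op: "openin (top_of_set {0..T}) ?E"
    unfolding openin_euclidean_subtopology_iff
  proof (intro conjI ballI)
    fix s assume s: "s \<in> ?E"
    then have sT: "s \<in> {0..T}" and eq: "g s = h s" by auto
    let ?z = "(g s, snd x + s *\<^sub>R w)"
    have "?z \<in> S" using g sT by (simp add: lift_def)
    then obtain e where "e > 0" and e: "\<And>z1 z2. z1 \<in> S \<inter> ball ?z e \<Longrightarrow> z2 \<in> S \<inter> ball ?z e \<Longrightarrow>
        z1 \<noteq> z2 \<Longrightarrow> \<bar>fst z1 - fst z2\<bar> < norm (snd z1 - snd z2)"
      using locally_acausal by blast
    obtain d1 where "d1 > 0" and d1: "\<And>s'. s' \<in> {0..T} \<Longrightarrow> \<bar>s' - s\<bar> < d1 \<Longrightarrow> (g s', snd x + s' *\<^sub>R w) \<in> S \<inter> ball ?z e"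
      using lift_local[OF g sT \<open>e > 0\<close>] by blast
    obtain d2 where "d2 > 0" and d2: "\<And>s'. s' \<in> {0..T} \<Longrightarrow> \<bar>s' - s\<bar> < d2 \<Longrightarrow> (h s', snd x + s' *\<^sub>R w) \<in> S \<inter> ball ?z e"
      using lift_local[OF h sT \<open>e > 0\<close>] unfolding eq by blast
    have "g s' = h s'" if "s' \<in> {0..T}" "dist s' s < min d1 d2" for s'
      using e[OF d1[of s'] d2[of s']] that by (auto simp: dist_real_def)
    then show "\<exists>e>0. \<forall>x'\<in>{0..T}. dist x' s < e \<longrightarrow> x' \<in> ?E"
      using \<open>d1 > 0\<close> \<open>d2 > 0\<close> by (intro exI[of _ "min d1 d2"]) auto
  qed auto
  have "0 \<in> ?E" using g h s by (auto simp: lift_def)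
  moreover have "?E = {} \<or> ?E = {0..T}"
    using connected_clopen[of "{0..T}"] op clo connected_Icc by blast
  ultimately show ?thesis using s by blast
qed

text \<open>Arzela-Ascoli applies because the Lipschitz constants \<open>norm (w k)\<close> are
  bounded, and the limit stays in \<open>S\<close> since \<open>S\<close> is closed.\<close>

lemma lift_compactness:
  assumes g: "\<And>k. lift S 1 (x k) (w k) (g k)" and x: "x \<longlonglongrightarrow> x'" and w: "w \<longlonglongrightarrow> w'"
  obtains r h where "strict_mono r" "lift S 1 x' w' h" "(\<lambda>k. g (r k) 1) \<longlonglongrightarrow> h 1"
proof -
  obtain X where X: "\<And>k. norm (x k) \<le> X"
    using convergent_imp_Bseq[of x] x unfolding convergent_def Bseq_def by blast
  obtain W where "W > 0" and W: "\<And>k. norm (w k) \<le> W"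
    using convergent_imp_Bseq[of w] w unfolding convergent_def Bseq_def by blast
  have lip: "\<bar>g k b - g k a\<bar> \<le> W * \<bar>b - a\<bar>" if "a \<in> {0..1}" "b \<in> {0..1}" for k a b
  proof -
    have "\<bar>g k b - g k a\<bar> \<le> norm (w k) * \<bar>b - a\<bar>" by (rule lift_le[OF g that])
    also have "\<dots> \<le> W * \<bar>b - a\<bar>" by (intro mult_right_mono W) auto
    finally show ?thesis .
  qed
  have bound: "norm (g k s) \<le> X + W" if s: "s \<in> {0..1}" for k s
  proof -
    have "\<bar>g k s - g k 0\<bar> \<le> W * \<bar>s - 0\<bar>" by (rule lip) (use s in auto)
    also have "\<dots> \<le> W" using s \<open>W > 0\<close> by (simp add: mult_left_le)
    finally have "\<bar>g k s - g k 0\<bar> \<le> W" .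
    moreover have "\<bar>g k 0\<bar> \<le> X"
      using g[of k] X[of k] norm_fst_le[of "fst (x k)" "snd (x k)"] by (simp add: lift_def)
    ultimately show ?thesis by simp
  qed
  have equi: "\<exists>d>0. \<forall>n y. y \<in> {0..1} \<and> norm (s - y) < d \<longrightarrow> norm (g n s - g n y) < e"
    if "s \<in> {0..1}" "e > 0" for s e
  proof (intro exI conjI allI impI)
    show "e / W > 0" using \<open>W > 0\<close> that by simp
    fix n y assume y: "y \<in> {0..1} \<and> norm (s - y) < e / W"
    have "\<bar>g n s - g n y\<bar> \<le> W * \<bar>s - y\<bar>" using y that by (intro lip) auto
    also have "\<dots> < e" using y \<open>W > 0\<close> by (simp add: field_simps)
    finally show "norm (g n s - g n y) < e" by simp
  qed
  obtain h r where h: "continuous_on {0..1} h" and r: "strict_mono (r :: nat \<Rightarrow> nat)"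
    and unif: "\<And>e. 0 < e \<Longrightarrow> \<exists>N. \<forall>n s. n \<ge> N \<and> s \<in> {0..1} \<longrightarrow> norm (g (r n) s - h s) < e"
    using Arzela_Ascoli[OF compact_Icc bound equi] by blast
  have lim: "(\<lambda>n. g (r n) s) \<longlonglongrightarrow> h s" if "s \<in> {0..1}" for s
    unfolding LIMSEQ_iff using unif that by blast
  have xr: "(\<lambda>n. x (r n)) \<longlonglongrightarrow> x'" and wr: "(\<lambda>n. w (r n)) \<longlonglongrightarrow> w'"
    using LIMSEQ_subseq_LIMSEQ[OF x r] LIMSEQ_subseq_LIMSEQ[OF w r] by (auto simp: o_def)
  have "lift S 1 x' w' h"
    unfolding lift_def
  proof (intro conjI ballI h)
    have "(\<lambda>n. g (r n) 0) \<longlonglongrightarrow> fst x'"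
      using g tendsto_fst[OF xr] by (simp add: lift_def)
    then show "h 0 = fst x'" using lim[of 0] LIMSEQ_unique by auto
    fix s :: real assume s: "s \<in> {0..1}"
    show "(h s, snd x' + s *\<^sub>R w') \<in> S"
    proof (rule closed_sequentially[OF closed])
      show "(\<lambda>n. (g (r n) s, snd (x (r n)) + s *\<^sub>R w (r n))) \<longlonglongrightarrow> (h s, snd x' + s *\<^sub>R w')"
        by (intro tendsto_intros lim s xr wr)
      show "(g (r n) s, snd (x (r n)) + s *\<^sub>R w (r n)) \<in> S" for n
        using g[of "r n"] s by (simp add: lift_def)
    qed
  qed
  then show thesis using that r lim[of 1] by auto
qed

lemma lift_extend:
  assumes g: "lift S T x w g" and T: "T \<ge> 0"
  shows "\<exists>d>0. \<forall>T'. T \<le> T' \<and> T' \<le> T + d \<longrightarrow> (\<exists>h. lift S T' x w h)"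
proof -
  let ?z = "(g T, snd x + T *\<^sub>R w)"
  have z: "?z \<in> S" using g T by (simp add: lift_def)
  then obtain e where "e > 0" and e: "\<And>z1 z2. z1 \<in> S \<inter> ball ?z e \<Longrightarrow> z2 \<in> S \<inter> ball ?z e \<Longrightarrow>
        z1 \<noteq> z2 \<Longrightarrow> \<bar>fst z1 - fst z2\<bar> < norm (snd z1 - snd z2)"
    using locally_acausal by blast
  obtain \<eta> where "\<eta> > 0" and \<eta>: "\<And>y. y \<in> ball (snd ?z) \<eta> \<Longrightarrow> \<exists>t. \<bar>t - fst ?z\<bar> < e / 2 \<and> (t, y) \<in> S"
    using locally_onto[OF z, of "e / 2"] \<open>e > 0\<close> by auto
  \<comment> \<open>The spatial part then moves by less than \<eta>, so that points of
    \<open>S\<close> above it exist, and by less than \<open>e / 2\<close>, so that they stay in the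
    ball where acausality holds. The \<open>+ 1\<close> covers \<open>w = 0\<close>.\<close>
  define d where "d = min \<eta> (e / 2) / (norm w + 1)"
  have "d > 0" using \<open>\<eta> > 0\<close> \<open>e > 0\<close> by (simp add: d_def add_nonneg_pos)
  have dw: "(s - T) * norm w < \<eta>" "(s - T) * norm w < e / 2" if "T \<le> s" "s \<le> T + d" for s
  proof -
    have "(s - T) * norm w \<le> d * norm w" using that by (intro mult_right_mono) auto
    also have "\<dots> < d * (norm w + 1)" using \<open>d > 0\<close> by simp
    also have "\<dots> = min \<eta> (e / 2)" by (simp add: d_def add_nonneg_eq_0_iff)
    finally show "(s - T) * norm w < \<eta>" "(s - T) * norm w < e / 2" by auto
  qed
  have dist_snd: "dist (snd x + T *\<^sub>R w) (snd x + s *\<^sub>R w) = (s - T) * norm w" if "T \<le> s" for s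
  proof -
    have "dist (snd x + T *\<^sub>R w) (snd x + s *\<^sub>R w) = norm ((T - s) *\<^sub>R w)"
      by (simp add: dist_norm algebra_simps)
    then show ?thesis using that by simp
  qed
  have "\<exists>t. \<bar>t - g T\<bar> < e / 2 \<and> (t, snd x + s *\<^sub>R w) \<in> S" if "T \<le> s" "s \<le> T + d" for s
    using \<eta>[of "snd x + s *\<^sub>R w"] dw[OF that] dist_snd[of s] that by simp
  \<comment> \<open>An arbitrary choice of heights; acausality in the ball makes it Lipschitz and
    forces it to agree with \<open>g\<close> at \<open>T\<close>.\<close>
  then obtain \<tau> where \<tau>: "\<And>s. T \<le> s \<Longrightarrow> s \<le> T + d \<Longrightarrow> \<bar>\<tau> s - g T\<bar> < e / 2 \<and> (\<tau> s, snd x + s *\<^sub>R w) \<in> S"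
    by metis
  have ball: "(\<tau> s, snd x + s *\<^sub>R w) \<in> S \<inter> ball ?z e" if "T \<le> s" "s \<le> T + d" for s
  proof -
    have "dist ?z (\<tau> s, snd x + s *\<^sub>R w) \<le> dist (g T) (\<tau> s) + dist (snd x + T *\<^sub>R w) (snd x + s *\<^sub>R w)"
      unfolding dist_Pair_Pair by (rule sqrt_sum_squares_le_sum) auto
    also have "\<dots> < e" using \<tau>[OF that] dw(2)[OF that] dist_snd[of s] that by (simp add: dist_real_def abs_minus_commute)
    finally show ?thesis using \<tau>[OF that] by simp
  qed
  define G where "G s = (if s \<le> T then g s else \<tau> s)" for s
  have \<tau>T: "\<tau> T = g T"
  proof (rule ccontr)
    assume "\<tau> T \<noteq> g T"
    then show False using e[of "(\<tau> T, snd x + T *\<^sub>R w)" ?z] ball[of T] z \<open>d > 0\<close> \<open>e > 0\<close> by auto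
  qed
  have lip: "\<bar>\<tau> a - \<tau> b\<bar> \<le> norm w * \<bar>a - b\<bar>" if "a \<in> {T..T + d}" "b \<in> {T..T + d}" for a b
  proof (cases "\<tau> a = \<tau> b")
    case False
    then have "\<bar>\<tau> a - \<tau> b\<bar> < norm ((snd x + a *\<^sub>R w) - (snd x + b *\<^sub>R w))"
      using e[OF ball[of a] ball[of b]] that by auto
    also have "\<dots> = norm ((a - b) *\<^sub>R w)" by (simp add: algebra_simps)
    finally show ?thesis by (simp add: mult.commute)
  qed simp
  have "continuous_on {T..T + d} \<tau>"
    unfolding continuous_on_iff
  proof (intro ballI allI impI)
    fix a e :: real assume a: "a \<in> {T..T + d}" "e > 0"
    show "\<exists>\<delta>>0. \<forall>b\<in>{T..T + d}. dist b a < \<delta> \<longrightarrow> dist (\<tau> b) (\<tau> a) < e"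
    proof (intro exI conjI ballI impI)
      show "e / (norm w + 1) > 0" using a by (simp add: add_nonneg_pos)
      fix b assume b: "b \<in> {T..T + d}" "dist b a < e / (norm w + 1)"
      have "\<bar>\<tau> b - \<tau> a\<bar> \<le> norm w * \<bar>b - a\<bar>" using a b by (intro lip)
      also have "\<dots> \<le> (norm w + 1) * \<bar>b - a\<bar>" by (intro mult_right_mono) auto
      also have "\<dots> < e" using b by (simp add: dist_real_def pos_less_divide_eq add_nonneg_pos mult.commute)
      finally show "dist (\<tau> b) (\<tau> a) < e" by (simp add: dist_real_def)
    qed
  qed
  then have "continuous_on {T..T + d} G"
    by (rule continuous_on_eq) (auto simp: G_def \<tau>T)
  moreover have "continuous_on {0..T} G"
    by (rule continuous_on_eq[of _ g]) (use g in \<open>auto simp: G_def lift_def\<close>)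
  ultimately have "continuous_on ({0..T} \<union> {T..T + d}) G"
    by (intro continuous_on_closed_Un) auto
  then have "lift S T' x w G" if "T \<le> T'" "T' \<le> T + d" for T'
    unfolding lift_def
  proof (intro conjI ballI)
    show "continuous_on {0..T'} G"
      by (rule continuous_on_subset[OF \<open>continuous_on ({0..T} \<union> {T..T + d}) G\<close>]) (use that T in auto)
    show "G 0 = fst x" using g T by (simp add: G_def lift_def)
    show "(G s, snd x + s *\<^sub>R w) \<in> S" if "s \<in> {0..T'}" for s
      using that \<open>T' \<le> T + d\<close> g \<tau>[of s] by (auto simp: G_def lift_def)
  qed
  then show ?thesis using \<open>d > 0\<close> by blast
qed

text \<open>Continuation: the liftable lengths form a closed set by compactness, and a supremum
  below 1 could be exceeded by \<open>lift_extend\<close>.\<close>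

lemma lift_exists:
  assumes x: "x \<in> S"
  shows "\<exists>g. lift S 1 x w g"
proof -
  define A where "A = {T \<in> {0..1}. \<exists>g. lift S T x w g}"
  have lift0: "lift S 0 x w (\<lambda>_. fst x)" using x by (simp add: lift_def)
  have "closed A"
    unfolding closed_sequential_limits
  proof (intro allI impI, elim conjE)
    fix T l assume T: "\<forall>n. T n \<in> A" and l: "T \<longlonglongrightarrow> l"
    have l01: "l \<in> {0..1}"
      using closed_sequentially[OF closed_atLeastAtMost _ l, of 0 1] T by (auto simp: A_def)
    have "\<exists>g. lift S 1 x (T n *\<^sub>R w) g" for n
      using T lift_rescale unfolding A_def by fastforce
    then obtain g where g: "\<And>n. lift S 1 x (T n *\<^sub>R w) (g n)" by metis
    obtain h where h: "lift S 1 x (l *\<^sub>R w) h"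
      using lift_compactness[of "\<lambda>_. x" "\<lambda>n. T n *\<^sub>R w" g, OF g tendsto_const tendsto_scaleR[OF l tendsto_const]]
      by metis
    have "\<exists>g. lift S l x w g"
    proof (cases "l = 0")
      case True
      then show ?thesis using lift0 by blast
    next
      case False
      then show ?thesis using lift_rescale'[OF h] l01 by auto
    qed
    then show "l \<in> A" using l01 by (simp add: A_def)
  qed
  have "0 \<in> A" using lift0 unfolding A_def by auto
  then have "A \<noteq> {}" by blast
  moreover have bdd: "bdd_above A" by (auto simp: A_def intro!: bdd_aboveI[of _ 1])
  ultimately have Sup: "Sup A \<in> A" using closed_contains_Sup \<open>closed A\<close> bdd by blast
  then obtain g where g: "lift S (Sup A) x w g" and S01: "Sup A \<in> {0..1}" by (auto simp: A_def)
  obtain d where "d > 0" and d: "\<And>T'. Sup A \<le> T' \<Longrightarrow> T' \<le> Sup A + d \<Longrightarrow> \<exists>h. lift S T' x w h"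
    using lift_extend[OF g] S01 by auto
  define T' where "T' = min 1 (Sup A + d)"
  have "T' \<in> A" using d[of T'] S01 \<open>d > 0\<close> by (auto simp: A_def T'_def)
  then have "T' \<le> Sup A" using bdd by (rule cSup_upper)
  then have "T' = 1" using \<open>d > 0\<close> by (auto simp: T'_def min_def split: if_splits)
  then show ?thesis using \<open>T' \<in> A\<close> by (auto simp: A_def)
qed

text \<open>For \<open>x\<close> in \<open>S\<close>, the end points of the lifts of all segments
  from \<open>snd x\<close>, one over each spatial point. It is shown to contain the component of
  \<open>x\<close>.\<close>

definition reachable :: "real \<times> 'a \<Rightarrow> (real \<times> 'a) set"
  where "reachable x = {y \<in> S. \<exists>g. lift S 1 x (snd y - snd x) g \<and> g 1 = fst y}"

lemma closed_reachable: "closed (reachable x)"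
  unfolding closed_sequential_limits
proof (intro allI impI, elim conjE)
  fix y l assume y: "\<forall>n. y n \<in> reachable x" and l: "y \<longlonglongrightarrow> l"
  have "l \<in> S" using closed_sequentially[OF closed _ l] y by (auto simp: reachable_def)
  obtain g where g: "\<And>n. lift S 1 x (snd (y n) - snd x) (g n)" "\<And>n. g n 1 = fst (y n)"
    using y unfolding reachable_def mem_Collect_eq by metis
  obtain r h where r: "strict_mono r" and h: "lift S 1 x (snd l - snd x) h" "(\<lambda>k. g (r k) 1) \<longlonglongrightarrow> h 1"
    using lift_compactness[of "\<lambda>_. x" "\<lambda>n. snd (y n) - snd x" g x, OF g(1) tendsto_const
        tendsto_diff[OF tendsto_snd[OF l] tendsto_const]] by metis
  have "(\<lambda>k. fst (y (r k))) \<longlonglongrightarrow> fst l"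
    using tendsto_fst[OF LIMSEQ_subseq_LIMSEQ[OF l r]] by (simp add: o_def)
  then have "h 1 = fst l" using h(2) g(2) LIMSEQ_unique by auto
  then show "l \<in> reachable x" using h(1) \<open>l \<in> S\<close> by (auto simp: reachable_def)
qed

lemma lift_end:
  assumes "lift S 1 x w g"
  shows "(g 1, snd x + w) \<in> S"
proof -
  have "(g 1, snd x + 1 *\<^sub>R w) \<in> S" using assms unfolding lift_def by (meson atLeastAtMost_iff order_refl zero_le_one)
  then show ?thesis by simp
qed

text \<open>If the limit \<open>l\<close> is reachable, lifts running backwards from
  \<open>y n\<close> to \<open>snd x\<close> converge along a subsequence to the reversed lift from
  \<open>l\<close>, which ends at \<open>x\<close>. One of their end points is so near to
  \<open>x\<close>, over the same spatial point, that it equals \<open>x\<close>; reversing that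
  lift reaches \<open>y n\<close>.\<close>

lemma closed_unreachable:
  assumes x: "x \<in> S"
  shows "closed (S - reachable x)"
  unfolding closed_sequential_limits
proof (intro allI impI, elim conjE)
  fix y l assume y: "\<forall>n. y n \<in> S - reachable x" and l: "y \<longlonglongrightarrow> l"
  have lS: "l \<in> S" using closed_sequentially[OF closed _ l] y by auto
  have "l \<notin> reachable x"
  proof
    assume "l \<in> reachable x"
    then obtain g where g: "lift S 1 x (snd l - snd x) g" "g 1 = fst l" by (auto simp: reachable_def)
    define g' where "g' s = g (1 - s)" for s
    have g': "lift S 1 l (snd x - snd l) g'" "g' 1 = fst x"
      using lift_reverse[OF g(1)] g unfolding g'_def by (auto simp: lift_def)
    have "\<exists>h. lift S 1 (y n) (snd x - snd (y n)) h" for n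
      using lift_exists y by blast
    then obtain h where h: "\<And>n. lift S 1 (y n) (snd x - snd (y n)) (h n)" by metis
    obtain r h' where r: "strict_mono r" and h': "lift S 1 l (snd x - snd l) h'"
      and lim: "(\<lambda>k. h (r k) 1) \<longlonglongrightarrow> h' 1"
      using lift_compactness[OF h l tendsto_diff[OF tendsto_const tendsto_snd[OF l]]] by metis
    have "h' 1 = fst x" using lift_unique[OF h' g'(1), of 1] g' by simp
    then have "(\<lambda>k. (h (r k) 1, snd x)) \<longlonglongrightarrow> x"
      using tendsto_Pair[OF lim tendsto_const[of "snd x"]] by simp
    obtain e where "e > 0" and e: "\<And>z1 z2. z1 \<in> S \<inter> ball x e \<Longrightarrow> z2 \<in> S \<inter> ball x e \<Longrightarrow>
        z1 \<noteq> z2 \<Longrightarrow> \<bar>fst z1 - fst z2\<bar> < norm (snd z1 - snd z2)"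
      using locally_acausal x by blast
    obtain k where k: "dist (h (r k) 1, snd x) x < e"
      using \<open>(\<lambda>k. (h (r k) 1, snd x)) \<longlonglongrightarrow> x\<close> \<open>e > 0\<close> unfolding lim_sequentially by blast
    have inS: "(h (r k) 1, snd x) \<in> S" using lift_end[OF h[of "r k"]] by simp
    have eq: "(h (r k) 1, snd x) = x"
    proof (rule ccontr)
      assume "(h (r k) 1, snd x) \<noteq> x"
      then have "\<bar>fst (h (r k) 1, snd x) - fst x\<bar> < norm (snd (h (r k) 1, snd x) - snd x)"
        by (intro e) (use inS x k \<open>e > 0\<close> in \<open>auto simp: dist_commute\<close>)
      then show False by simp
    qed
    have "lift S 1 x (snd (y (r k)) - snd x) (\<lambda>s. h (r k) (1 - s))"
      using lift_reverse[OF h[of "r k"]] eq by simp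
    moreover have "h (r k) (1 - 1) = fst (y (r k))" using h[of "r k"] by (simp add: lift_def)
    ultimately have "y (r k) \<in> reachable x" using y unfolding reachable_def by blast
    then show False using y by blast
  qed
  then show "l \<in> S - reachable x" using lS by blast
qed

lemma component_subset_reachable:
  assumes x: "x \<in> S"
  shows "connected_component_set S x \<subseteq> reachable x"
proof (rule ccontr)
  assume not: "\<not> ?thesis"
  let ?C = "connected_component_set S x"
  have "lift S 1 x 0 (\<lambda>_. fst x)" using x by (simp add: lift_def)
  then have "x \<in> reachable x" using x by (auto simp: reachable_def)
  moreover have "x \<in> ?C" using x by simp
  moreover have "?C \<subseteq> reachable x \<union> (S - reachable x)" using connected_component_subset[of S x] by blast
  moreover have "(S - reachable x) \<inter> ?C \<noteq> {}" using not connected_component_subset[of S x] by blast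
  moreover have "connected ?C" by (rule connected_connected_component)
  ultimately show False
    using closed_reachable[of x] closed_unreachable[OF x]
    unfolding connected_closed by blast
qed

lemma component_acausal:
  assumes x: "x \<in> S" and y: "y \<in> connected_component_set S x" "y \<noteq> x"
  shows "\<bar>fst y - fst x\<bar> < norm (snd y - snd x)"
proof -
  obtain g where g: "lift S 1 x (snd y - snd x) g" "g 1 = fst y"
    using component_subset_reachable[OF x] y(1) by (auto simp: reachable_def)
  have g0: "g 0 = fst x" using g(1) by (simp add: lift_def)
  have "snd y \<noteq> snd x"
  proof
    assume eq: "snd y = snd x"
    then have "g 1 = g 0" using lift_le[OF g(1), of 0 1] by simp
    then show False using g(2) g0 eq y(2) by (simp add: prod_eq_iff)
  qed
  then show ?thesis
    using lift_less[OF g(1), of 0 1 "norm (snd y - snd x)"] g(2) g0 by simp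
qed

lemma component_onto:
  assumes x: "x \<in> S"
  shows "\<exists>t. (t, y) \<in> connected_component_set S x"
proof -
  obtain g where g: "lift S 1 x (y - snd x) g" using lift_exists[OF x] by blast
  let ?p = "\<lambda>s. (g s, snd x + s *\<^sub>R (y - snd x))"
  have "connected (?p ` {0..1})"
    by (intro connected_continuous_image) (use g in \<open>auto simp: lift_def intro!: continuous_intros\<close>)
  moreover have "?p ` {0..1} \<subseteq> S" using g by (auto simp: lift_def)
  moreover have "x \<in> ?p ` {0..1}"
    using g by (intro image_eqI[of _ _ 0]) (auto simp: lift_def)
  moreover have "(g 1, y) \<in> ?p ` {0..1}"
    by (intro image_eqI[of _ _ 1]) auto
  ultimately show ?thesis
    unfolding connected_component_def mem_Collect_eq by blast
qed

end

section \<open>Unit normal and local graphs of a spacelike hypersurface\<close>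

text \<open>Chooses a nearly smallest correction where a smallest one might not exist.\<close>

lemma infdist_almost_attained:
  assumes "A \<noteq> {}" "e > 0"
  shows "\<exists>a\<in>A. dist x a < infdist x A + e"
proof -
  have "(INF a\<in>A. dist x a) < infdist x A + e"
    using assms by (simp flip: infdist_notempty)
  then show ?thesis
    using assms(1) by (subst (asm) cINF_less_iff) auto
qed

text \<open>
  A curve with velocity \<open>v\<close> need only be differentiable at its base point. So its correction along a
  transversal vector \<open>w\<close> can be chosen for each parameter separately, of nearly minimal size.
\<close>

lemma tangent_space_level_set:
  fixes f :: "'m::finite minkowski \<Rightarrow> real"
  assumes U: "open U" "q \<in> U" and S: "S \<inter> U = {x \<in> U. f x = 0}" and q: "q \<in> S"
    and cont: "continuous_on U f" and D: "(f has_derivative D) (at q)" and D0: "\<exists>v. D v \<noteq> 0"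
  shows "tangent_space S q = {v. D v = 0}"
proof (intro set_eqI iffI)
  interpret D: bounded_linear D using D by (rule has_derivative_bounded_linear)
  have fq: "f q = 0" using S U q by blast
  fix v
  {
    assume "v \<in> tangent_space S q"
    then obtain \<gamma> where \<gamma>: "\<gamma> 0 = q" "\<forall>\<^sub>F t in at (0::real). \<gamma> t \<in> S"
      "(\<gamma> has_vector_derivative v) (at 0)"
      by (auto simp: tangent_space_def)
    have "isCont \<gamma> 0" using \<gamma>(3) by (rule has_vector_derivative_continuous)
    then have "\<forall>\<^sub>F t in at 0. \<gamma> t \<in> U"
      using U \<gamma>(1) unfolding isCont_def by (auto dest: topological_tendstoD)
    with \<gamma>(2) have ev: "\<forall>\<^sub>F t in at 0. f (\<gamma> t) = 0"
      by eventually_elim (use S in blast)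
    have "((\<lambda>t. f (\<gamma> t)) has_derivative (\<lambda>t. D (t *\<^sub>R v))) (at 0)"
      using has_derivative_compose[OF \<gamma>(3)[unfolded has_vector_derivative_def], of f D] D \<gamma>(1) by simp
    moreover have "((\<lambda>t. f (\<gamma> t)) has_derivative (\<lambda>t. 0)) (at 0)"
    proof (rule has_derivative_transform_eventually[OF has_derivative_const])
      show "\<forall>\<^sub>F t in at 0. 0 = f (\<gamma> t)" using ev by eventually_elim simp
      show "0 = f (\<gamma> 0)" using fq \<gamma>(1) by simp
    qed simp
    ultimately have "(\<lambda>t. D (t *\<^sub>R v)) = (\<lambda>t. 0)" by (rule has_derivative_unique)
    then have "D (1 *\<^sub>R v) = 0" by metis
    then show "v \<in> {v. D v = 0}" by simp
  }
  assume "v \<in> {v. D v = 0}"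
  then have Dv: "D v = 0" by simp
  obtain w0 where w0: "D w0 \<noteq> 0" using D0 by blast
  define w where "w = (1 / D w0) *\<^sub>R w0"
  have Dw: "D w = 1" using w0 by (simp add: w_def D.scaleR)
  let ?y = "\<lambda>t s. q + t *\<^sub>R v + s *\<^sub>R w"
  \<comment> \<open>To first order \<open>f\<close> equals \<open>s\<close> at
    \<open>?y t s\<close>, so it changes sign between
    \<open>s = - (\<epsilon> * \<bar>t\<bar>)\<close> and
    \<open>s = \<epsilon> * \<bar>t\<bar>\<close>, and the intermediate value theorem gives a point
    of \<open>S\<close>.\<close>
  have near: "\<exists>\<delta>>0. \<forall>t. \<bar>t\<bar> < \<delta> \<longrightarrow> (\<exists>s. \<bar>s\<bar> \<le> \<epsilon> * \<bar>t\<bar> \<and> ?y t s \<in> S)" if \<epsilon>: "0 < \<epsilon>" "\<epsilon> \<le> 1" for \<epsilon>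
  proof -
    define M where "M = norm v + norm w + 1"
    have M: "M > 0" unfolding M_def by (intro add_nonneg_pos add_nonneg_nonneg) auto
    define e where "e = \<epsilon> / M"
    have "e > 0" using \<epsilon> M by (simp add: e_def)
    obtain d1 where "d1 > 0" and d1: "\<And>y. norm (y - q) < d1 \<Longrightarrow> norm (f y - f q - D (y - q)) \<le> e * norm (y - q)"
      using D \<open>e > 0\<close> unfolding has_derivative_at_alt by blast
    obtain d2 where "d2 > 0" and d2: "ball q d2 \<subseteq> U" using U by (meson openE)
    define \<delta> where "\<delta> = min d1 d2 / M"
    have "\<delta> > 0" using \<open>d1 > 0\<close> \<open>d2 > 0\<close> M by (simp add: \<delta>_def)
    moreover have "\<exists>s. \<bar>s\<bar> \<le> \<epsilon> * \<bar>t\<bar> \<and> ?y t s \<in> S" if t: "\<bar>t\<bar> < \<delta>" for t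
    proof -
      have nrm: "norm (?y t s - q) \<le> \<bar>t\<bar> * M" if "\<bar>s\<bar> \<le> \<epsilon> * \<bar>t\<bar>" for s
      proof -
        have "\<bar>s\<bar> \<le> \<bar>t\<bar>" using that \<epsilon> by (meson abs_ge_zero mult_left_le_one_le order_trans less_imp_le)
        have "norm (?y t s - q) \<le> \<bar>t\<bar> * norm v + \<bar>s\<bar> * norm w"
          using norm_triangle_ineq[of "t *\<^sub>R v" "s *\<^sub>R w"] by simp
        also have "\<dots> \<le> \<bar>t\<bar> * norm v + \<bar>t\<bar> * norm w"
          using \<open>\<bar>s\<bar> \<le> \<bar>t\<bar>\<close> by (intro add_left_mono mult_right_mono) auto
        also have "\<dots> \<le> \<bar>t\<bar> * M" by (simp add: M_def algebra_simps)
        finally show ?thesis .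
      qed
      have tM: "\<bar>t\<bar> * M < min d1 d2" using t M by (simp add: \<delta>_def pos_less_divide_eq)
      have est: "\<bar>f (?y t s) - s\<bar> \<le> \<epsilon> * \<bar>t\<bar>" if s: "\<bar>s\<bar> \<le> \<epsilon> * \<bar>t\<bar>" for s
      proof -
        have "D (?y t s - q) = s" using Dv Dw by (simp add: D.add D.scaleR)
        then have "\<bar>f (?y t s) - s\<bar> \<le> e * norm (?y t s - q)"
          using d1[of "?y t s"] nrm[OF s] tM fq by simp
        also have "\<dots> \<le> e * (\<bar>t\<bar> * M)" using nrm[OF s] \<open>e > 0\<close> by (intro mult_left_mono) auto
        also have "\<dots> = \<epsilon> * \<bar>t\<bar>" using M by (simp add: e_def)
        finally show ?thesis .
      qed
      have inU: "?y t s \<in> U" if s: "\<bar>s\<bar> \<le> \<epsilon> * \<bar>t\<bar>" for s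
      proof -
        have "dist (?y t s) q < d2" using nrm[OF s] tM unfolding dist_norm by linarith
        then have "dist q (?y t s) < d2" by (simp only: dist_commute)
        then show ?thesis using d2 by auto
      qed
      have "\<exists>s\<ge>- (\<epsilon> * \<bar>t\<bar>). s \<le> \<epsilon> * \<bar>t\<bar> \<and> f (?y t s) = 0"
      proof (rule IVT')
        show "f (?y t (- (\<epsilon> * \<bar>t\<bar>))) \<le> 0" using est[of "- (\<epsilon> * \<bar>t\<bar>)"] \<epsilon> by simp
        show "0 \<le> f (?y t (\<epsilon> * \<bar>t\<bar>))" using est[of "\<epsilon> * \<bar>t\<bar>"] \<epsilon> by simp
        show "- (\<epsilon> * \<bar>t\<bar>) \<le> \<epsilon> * \<bar>t\<bar>" using \<epsilon> by simp
        show "continuous_on {- (\<epsilon> * \<bar>t\<bar>)..\<epsilon> * \<bar>t\<bar>} (\<lambda>s. f (?y t s))"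
          by (rule continuous_on_compose2[OF cont]) (use inU in \<open>auto intro!: continuous_intros simp: abs_le_iff\<close>)
      qed
      then show ?thesis using inU S by (force simp: abs_le_iff)
    qed
    ultimately show ?thesis by blast
  qed
  define A where "A t = {s. ?y t s \<in> S}" for t
  \<comment> \<open>The slack \<open>t\<^sup>2\<close> is o(t), so the choice, which is made once
    and without reference to any \<epsilon>, inherits all the bounds of \<open>near\<close>.\<close>
  have "\<exists>\<sigma>. (t = 0 \<longrightarrow> \<sigma> = 0) \<and> (t \<noteq> 0 \<longrightarrow> A t \<noteq> {} \<longrightarrow> \<sigma> \<in> A t \<and> dist 0 \<sigma> < infdist 0 (A t) + t\<^sup>2)" for t
    using infdist_almost_attained[of "A t" "t\<^sup>2" 0] by (cases "t = 0") auto
  then obtain \<sigma> where \<sigma>0: "\<sigma> 0 = 0" and \<sigma>: "\<And>t. t \<noteq> 0 \<Longrightarrow> A t \<noteq> {} \<Longrightarrow>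
      \<sigma> t \<in> A t \<and> dist 0 (\<sigma> t) < infdist 0 (A t) + t\<^sup>2"
    by metis
  have small: "\<exists>\<delta>>0. \<forall>t. \<bar>t\<bar> < \<delta> \<longrightarrow> ?y t (\<sigma> t) \<in> S \<and> \<bar>\<sigma> t\<bar> \<le> \<epsilon> * \<bar>t\<bar>" if \<epsilon>: "0 < \<epsilon>" "\<epsilon> \<le> 1" for \<epsilon>
  proof -
    obtain \<delta> where "\<delta> > 0" and \<delta>: "\<And>t. \<bar>t\<bar> < \<delta> \<Longrightarrow> \<exists>s. \<bar>s\<bar> \<le> \<epsilon> / 2 * \<bar>t\<bar> \<and> ?y t s \<in> S"
      using near[of "\<epsilon> / 2"] \<epsilon> by auto
    have "?y t (\<sigma> t) \<in> S \<and> \<bar>\<sigma> t\<bar> \<le> \<epsilon> * \<bar>t\<bar>" if t: "\<bar>t\<bar> < min \<delta> (\<epsilon> / 2)" for t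
    proof (cases "t = 0")
      case True
      then show ?thesis using \<sigma>0 q by simp
    next
      case False
      obtain s where s: "\<bar>s\<bar> \<le> \<epsilon> / 2 * \<bar>t\<bar>" "s \<in> A t" using \<delta>[of t] t by (auto simp: A_def)
      then have \<sigma>t: "\<sigma> t \<in> A t" "dist 0 (\<sigma> t) < infdist 0 (A t) + t\<^sup>2" using \<sigma>[of t] False by auto
      have "infdist 0 (A t) \<le> \<epsilon> / 2 * \<bar>t\<bar>" using s by (intro infdist_le2[OF s(2)]) (simp add: dist_real_def)
      moreover have "t\<^sup>2 \<le> \<epsilon> / 2 * \<bar>t\<bar>"
      proof -
        have "\<bar>t\<bar> * \<bar>t\<bar> \<le> \<epsilon> / 2 * \<bar>t\<bar>" using t by (intro mult_right_mono) auto
        then show ?thesis by (simp add: power2_eq_square)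
      qed
      moreover have "dist 0 (\<sigma> t) = \<bar>\<sigma> t\<bar>" by (simp add: dist_real_def)
      ultimately show ?thesis using \<sigma>t by (simp add: A_def)
    qed
    then show ?thesis using \<open>\<delta> > 0\<close> \<epsilon> by (intro exI[of _ "min \<delta> (\<epsilon> / 2)"]) auto
  qed
  define \<gamma> where "\<gamma> t = ?y t (\<sigma> t)" for t
  have "\<gamma> 0 = q" by (simp add: \<gamma>_def \<sigma>0)
  moreover have "\<forall>\<^sub>F t in at 0. \<gamma> t \<in> S"
    using small[of 1] unfolding eventually_at \<gamma>_def by (auto simp: dist_real_def)
  moreover have "(\<gamma> has_vector_derivative v) (at 0)"
    unfolding has_vector_derivative_def has_derivative_at_alt
  proof (intro conjI allI impI)
    show "bounded_linear (\<lambda>t. t *\<^sub>R v)" by (rule bounded_linear_scaleR_left)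
    fix e :: real assume "e > 0"
    have nw: "norm w + 1 > 0" by (simp add: add_nonneg_pos)
    define \<epsilon> where "\<epsilon> = min 1 (e / (norm w + 1))"
    have \<epsilon>: "0 < \<epsilon>" "\<epsilon> \<le> 1" "\<epsilon> * (norm w + 1) \<le> e"
    proof -
      show "0 < \<epsilon>" "\<epsilon> \<le> 1" using \<open>e > 0\<close> nw by (auto simp: \<epsilon>_def)
      have "\<epsilon> \<le> e / (norm w + 1)" by (simp add: \<epsilon>_def)
      then show "\<epsilon> * (norm w + 1) \<le> e" using nw by (simp add: pos_le_divide_eq)
    qed
    obtain \<delta> where "\<delta> > 0" and \<delta>: "\<And>t. \<bar>t\<bar> < \<delta> \<Longrightarrow> \<bar>\<sigma> t\<bar> \<le> \<epsilon> * \<bar>t\<bar>"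
      using small[OF \<epsilon>(1,2)] by blast
    have "norm (\<gamma> t - \<gamma> 0 - (t - 0) *\<^sub>R v) \<le> e * norm (t - 0)" if "norm (t - 0) < \<delta>" for t
    proof -
      have "norm (\<gamma> t - \<gamma> 0 - (t - 0) *\<^sub>R v) = \<bar>\<sigma> t\<bar> * norm w"
        by (simp add: \<gamma>_def \<sigma>0)
      also have "\<dots> \<le> (\<epsilon> * \<bar>t\<bar>) * (norm w + 1)"
        using \<delta>[of t] that \<epsilon> by (intro mult_mono) auto
      also have "\<dots> = (\<epsilon> * (norm w + 1)) * \<bar>t\<bar>" by simp
      also have "\<dots> \<le> e * \<bar>t\<bar>" using \<epsilon>(3) by (rule mult_right_mono) simp
      finally show ?thesis by simp
    qed
    then show "\<exists>d>0. \<forall>y. norm (y - 0) < d \<longrightarrow> norm (\<gamma> y - \<gamma> 0 - (y - 0) *\<^sub>R v) \<le> e * norm (y - 0)"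
      using \<open>\<delta> > 0\<close> by blast
  qed
  ultimately show "v \<in> tangent_space S q" unfolding tangent_space_def by blast
qed

section \<open>The metric gradient and the unit normal\<close>

lemma bounded_bilinear_lorentz: "bounded_bilinear (lorentz :: 'm::finite minkowski \<Rightarrow> _)"
proof
  show "\<exists>K. \<forall>(a :: 'm minkowski) b. norm (lorentz a b) \<le> norm a * norm b * K"
    using abs_lorentz_le by (intro exI[of _ 1]) auto
qed simp_all

text \<open>The time reflection of the Euclidean gradient: the vector that represents the derivative
  of \<open>f\<close> in the Lorentzian metric.\<close>

definition lorentz_gradient :: "('m::finite minkowski \<Rightarrow> real) \<Rightarrow> 'm minkowski \<Rightarrow> 'm minkowski"
  where "lorentz_gradient f x = (\<Sum>b\<in>Basis. frechet_derivative f (at x) b *\<^sub>R time_reflection b)"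

lemma has_derivative_lorentz_gradient:
  assumes "f differentiable (at x)"
  shows "(f has_derivative lorentz (lorentz_gradient f x)) (at x)"
proof -
  let ?D = "frechet_derivative f (at x)"
  have D: "(f has_derivative ?D) (at x)" using assms by (simp add: frechet_derivative_works)
  then interpret D: bounded_linear ?D by (rule has_derivative_bounded_linear)
  have "lorentz (lorentz_gradient f x) v = ?D v" for v
  proof -
    have "lorentz (lorentz_gradient f x) v = (\<Sum>b\<in>Basis. ?D b * (b \<bullet> v))"
      unfolding lorentz_gradient_def bounded_bilinear.sum_left[OF bounded_bilinear_lorentz]
      by (simp add: lorentz_time_reflection)
    also have "\<dots> = ?D (\<Sum>b\<in>Basis. (v \<bullet> b) *\<^sub>R b)"
      by (simp add: D.sum D.scaleR inner_commute mult.commute)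
    finally show ?thesis by (simp add: euclidean_representation)
  qed
  then have "lorentz (lorentz_gradient f x) = ?D" by (rule ext)
  then show ?thesis using D by simp
qed

lemma lorentz_gradient_differentiable:
  assumes "smooth_on U f" "x \<in> U"
  shows "lorentz_gradient f differentiable (at x)"
proof -
  have "Ck_on (Suc (Suc 0)) U f" using assms(1) by (simp add: smooth_on_def)
  then have "Ck_on (Suc 0) U (\<lambda>x. frechet_derivative f (at x) b)" for b
    by (simp only: Ck_on.simps(2)[of "Suc 0"])
  then have "(\<lambda>x. frechet_derivative f (at x) b) differentiable (at x)" for b
    using assms(2) unfolding Ck_on.simps by blast
  then show ?thesis
    unfolding lorentz_gradient_def by (intro differentiable_sum differentiable_scaleR) auto
qed

lemma differentiable_imp_pointwise_lipschitz:
  fixes F :: "'a::real_normed_vector \<Rightarrow> 'b::real_normed_vector"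
  assumes "F differentiable (at q)"
  obtains C \<delta> where "C > 0" "\<delta> > 0" "\<And>p. dist p q < \<delta> \<Longrightarrow> norm (F p - F q) \<le> C * dist p q"
proof -
  obtain D where D: "(F has_derivative D) (at q)" using assms by (auto simp: differentiable_def)
  then have bl: "bounded_linear D" by (rule has_derivative_bounded_linear)
  obtain K where "K > 0" and K: "\<And>v. norm (D v) \<le> norm v * K"
    using bounded_linear.pos_bounded[OF bl] by blast
  have "\<exists>d>0. \<forall>y. norm (y - q) < d \<longrightarrow> norm (F y - F q - D (y - q)) \<le> 1 * norm (y - q)"
    using D unfolding has_derivative_at_alt by (meson zero_less_one)
  then obtain d where "d > 0" and d: "\<And>y. norm (y - q) < d \<Longrightarrow> norm (F y - F q - D (y - q)) \<le> norm (y - q)"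
    by auto
  show thesis
  proof (rule that[of "K + 1" d])
    fix p assume p: "dist p q < d"
    have "norm (F p - F q) \<le> norm (F p - F q - D (p - q)) + norm (D (p - q))"
      using norm_triangle_ineq[of "F p - F q - D (p - q)" "D (p - q)"] by simp
    also have "\<dots> \<le> norm (p - q) + norm (p - q) * K"
      using d[of p] K[of "p - q"] p by (simp add: dist_norm)
    finally show "norm (F p - F q) \<le> (K + 1) * dist p q"
      by (simp add: dist_norm algebra_simps)
  qed (use \<open>K > 0\<close> \<open>d > 0\<close> in auto)
qed

definition defining_function :: "'m::finite minkowski set \<Rightarrow> 'm minkowski set \<Rightarrow> ('m minkowski \<Rightarrow> real) \<Rightarrow> bool"
  where "defining_function S U f \<longleftrightarrow> open U \<and> smooth_on U f \<and>
    (\<forall>x\<in>U. \<exists>v. frechet_derivative f (at x) v \<noteq> 0) \<and> S \<inter> U = {x \<in> U. f x = 0}"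

context
  fixes S U :: "'m::finite minkowski set" and f
  assumes S: "spacelike_hypersurface S" and f: "defining_function S U f"
begin

lemma defining_differentiable:
  assumes "x \<in> U"
  shows "f differentiable (at x)"
proof -
  have "Ck_on (Suc 0) U f" using f by (simp add: defining_function_def smooth_on_def)
  then show ?thesis using assms by simp
qed

lemma defining_has_derivative:
  assumes "x \<in> U"
  shows "(f has_derivative lorentz (lorentz_gradient f x)) (at x)"
  by (intro has_derivative_lorentz_gradient defining_differentiable assms)

lemma defining_continuous: "continuous_on U f"
  using defining_differentiable differentiable_imp_continuous_within
  by (intro continuous_at_imp_continuous_on) blast

lemma gradient_isCont:
  assumes "x \<in> U"
  shows "isCont (lorentz_gradient f) x"
  using lorentz_gradient_differentiable[of U f x] assms f differentiable_imp_continuous_within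
  unfolding defining_function_def by blast

lemma tangent_space_gradient:
  assumes "q \<in> S" "q \<in> U"
  shows "tangent_space S q = {v. lorentz (lorentz_gradient f q) v = 0}"
proof (rule tangent_space_level_set[where U = U and f = f])
  obtain v where v: "frechet_derivative f (at q) v \<noteq> 0"
    using f assms by (auto simp: defining_function_def)
  have "frechet_derivative f (at q) = lorentz (lorentz_gradient f q)"
    using frechet_derivative_at[OF defining_has_derivative[OF assms(2)]] by simp
  then show "\<exists>v. lorentz (lorentz_gradient f q) v \<noteq> 0" using v by metis
qed (use f assms defining_continuous defining_has_derivative in \<open>auto simp: defining_function_def\<close>)

lemma gradient_timelike:
  assumes "q \<in> S" "q \<in> U"
  shows "lorentz (lorentz_gradient f q) (lorentz_gradient f q) < 0"
proof -
  let ?g = "lorentz_gradient f q"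
  have pos: "lorentz v v > 0" if "lorentz ?g v = 0" "v \<noteq> 0" for v
    using S assms(1) that tangent_space_gradient[OF assms] by (auto simp: spacelike_hypersurface_def)
  have "?g \<noteq> 0"
  proof
    assume "?g = 0"
    then have "frechet_derivative f (at q) = (\<lambda>v. 0)"
      using frechet_derivative_at[OF defining_has_derivative[OF assms(2)]] by (auto simp: fun_eq_iff)
    then show False using f assms(2) by (auto simp: defining_function_def)
  qed
  show ?thesis
  proof (rule ccontr)
    assume not: "\<not> ?thesis"
    \<comment> \<open>This is \<open>lorentz ?g ?g *\<^sub>R (1, 0) + fst ?g *\<^sub>R ?g\<close>, a
      multiple of the component of the time axis orthogonal to \<open>?g\<close>, written without
      division so that null gradients are covered.\<close>
    define v :: "'m minkowski" where "v = (snd ?g \<bullet> snd ?g, fst ?g *\<^sub>R snd ?g)"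
    have "lorentz ?g v = 0" by (simp add: v_def lorentz_def)
    have s: "snd ?g \<bullet> snd ?g \<ge> (fst ?g)\<^sup>2"
      using not by (simp add: lorentz_def power2_eq_square)
    have "snd ?g \<noteq> 0"
    proof
      assume "snd ?g = 0"
      then have "fst ?g = 0" using s by simp
      then show False using \<open>snd ?g = 0\<close> \<open>?g \<noteq> 0\<close> by (simp add: prod_eq_iff)
    qed
    then have "v \<noteq> 0" by (simp add: v_def zero_prod_def)
    have "lorentz v v = (snd ?g \<bullet> snd ?g) * ((fst ?g)\<^sup>2 - snd ?g \<bullet> snd ?g)"
      by (simp add: v_def lorentz_def power2_eq_square algebra_simps)
    also have "\<dots> \<le> 0" using s by (intro mult_nonneg_nonpos) auto
    finally show False using pos[OF \<open>lorentz ?g v = 0\<close> \<open>v \<noteq> 0\<close>] by simp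
  qed
qed

end

lemma defining_function_exists:
  assumes "spacelike_hypersurface S" "q \<in> S"
  obtains U f where "defining_function S U f" "q \<in> U"
proof -
  have "hypersurface S" using assms(1) by (simp add: spacelike_hypersurface_def)
  then have "\<exists>U (f :: _ \<Rightarrow> real). open U \<and> q \<in> U \<and> smooth_on U f \<and>
      (\<forall>x\<in>U. \<exists>v. frechet_derivative f (at x) v \<noteq> 0) \<and> S \<inter> U = {x \<in> U. f x = 0}"
    unfolding hypersurface_def by (rule bspec) (rule assms(2))
  then show thesis using that unfolding defining_function_def by blast
qed

text \<open>Chosen from the tangent space alone, so it does not refer to a local defining function;
  \<open>future_unit_unique\<close> shows that there is only one candidate.\<close>

definition unit_normal :: "'m::finite minkowski set \<Rightarrow> 'm minkowski \<Rightarrow> 'm minkowski"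
  where "unit_normal S q = (SOME n. future_unit n \<and> tangent_space S q = {v. lorentz n v = 0})"

lemma future_unit_unique:
  assumes "future_unit n" "future_unit n'" "{v. lorentz n v = 0} = {v. lorentz n' v = 0}"
  shows "n = n'"
proof -
  have "n = (- lorentz n n') *\<^sub>R n'"
    by (rule orthogonal_complement_future_unit[OF assms(2)]) (use assms(3) in auto)
  moreover define a where "a = - lorentz n n'"
  ultimately have n: "n = a *\<^sub>R n'" by simp
  have "a \<ge> 1" using future_unit_lorentz(1)[OF assms(1,2)] by (simp add: a_def)
  have "lorentz n n = a * a * lorentz n' n'" by (subst (1 2) n) simp
  then have "a * a = 1" using assms(1,2) by (simp add: future_unit_def)
  then have "a = 1" using \<open>a \<ge> 1\<close> power2_eq_1_iff[of a] by (simp add: power2_eq_square)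
  then show ?thesis using n by simp
qed

lemma unit_normal_eqI:
  assumes "future_unit n" "tangent_space S q = {v. lorentz n v = 0}"
  shows "unit_normal S q = n"
proof -
  have "future_unit (unit_normal S q) \<and> tangent_space S q = {v. lorentz (unit_normal S q) v = 0}"
    unfolding unit_normal_def by (rule someI[of _ n]) (use assms in blast)
  then show ?thesis using assms future_unit_unique by blast
qed

lemma unit_normal_gradient:
  assumes S: "spacelike_hypersurface S" and f: "defining_function S U f" and q: "q \<in> S" "q \<in> U"
  defines "g \<equiv> lorentz_gradient f q"
  shows "unit_normal S q = (sgn (fst g) / sqrt (- lorentz g g)) *\<^sub>R g"
    and "future_unit (unit_normal S q)"
    and "tangent_space S q = {v. lorentz (unit_normal S q) v = 0}"
proof -
  have "lorentz g g < 0" unfolding g_def by (rule gradient_timelike[OF S f q])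
  then obtain s where s: "s = sgn (fst g) / sqrt (- lorentz g g)" "s \<noteq> 0" "future_unit (s *\<^sub>R g)"
    by (rule timelike_normalize)
  have T: "tangent_space S q = {v. lorentz (s *\<^sub>R g) v = 0}"
    using tangent_space_gradient[OF S f q] s(2) by (simp add: g_def)
  have *: "unit_normal S q = s *\<^sub>R g" by (rule unit_normal_eqI[OF s(3) T])
  show "unit_normal S q = (sgn (fst g) / sqrt (- lorentz g g)) *\<^sub>R g" using * s(1) by simp
  show "future_unit (unit_normal S q)" "tangent_space S q = {v. lorentz (unit_normal S q) v = 0}"
    using * s(3) T by simp_all
qed

lemma unit_normal:
  assumes "spacelike_hypersurface S" "q \<in> S"
  shows "future_unit (unit_normal S q)" "tangent_space S q = {v. lorentz (unit_normal S q) v = 0}"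
  using unit_normal_gradient(2,3) assms defining_function_exists[OF assms] by metis+

text \<open>Near \<open>q\<close> the normal is the normalized gradient of one smooth function. A
  bound relative to the fixed base point \<open>q\<close> is all that the later estimates
  use.\<close>

lemma unit_normal_pointwise_lipschitz:
  assumes S: "spacelike_hypersurface S" and q: "q \<in> S"
  shows "\<exists>C>0. \<exists>\<delta>>0. \<forall>p\<in>S. dist p q < \<delta> \<longrightarrow> norm (unit_normal S p - unit_normal S q) \<le> C * dist p q"
proof -
  obtain U f where f: "defining_function S U f" and qU: "q \<in> U"
    using defining_function_exists[OF assms] by blast
  let ?g = "lorentz_gradient f"
  have gq: "lorentz (?g q) (?g q) < 0" by (rule gradient_timelike[OF S f q qU])
  then have fst0: "fst (?g q) \<noteq> 0" by (auto simp: lorentz_neg_iff)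
  have gd: "?g differentiable (at q)"
    by (rule lorentz_gradient_differentiable[of U]) (use f qU in \<open>auto simp: defining_function_def\<close>)
  then obtain g' where g': "(?g has_derivative g') (at q)" by (auto simp: differentiable_def)
  \<comment> \<open>With the sign frozen at \<open>q\<close> this is differentiable there; the time
    component of the gradient keeps its sign nearby by continuity.\<close>
  define N where "N x = (sgn (fst (?g q)) / sqrt (- lorentz (?g x) (?g x))) *\<^sub>R ?g x" for x
  have "((\<lambda>x. - lorentz (?g x) (?g x)) has_derivative
      (\<lambda>h. - (lorentz (?g q) (g' h) + lorentz (g' h) (?g q)))) (at q)"
    by (intro has_derivative_minus bounded_bilinear.FDERIV[OF bounded_bilinear_lorentz] g')
  then have "(\<lambda>x. sqrt (- lorentz (?g x) (?g x))) differentiable (at q)"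
    using has_derivative_real_sqrt[of "\<lambda>x. - lorentz (?g x) (?g x)" q] gq
    unfolding differentiable_def by fastforce
  then have "N differentiable (at q)"
    unfolding N_def using gq gd by (intro differentiable_scaleR differentiable_divide) auto
  then obtain C \<delta> where "C > 0" "\<delta> > 0" and C: "\<And>p. dist p q < \<delta> \<Longrightarrow> norm (N p - N q) \<le> C * dist p q"
    using differentiable_imp_pointwise_lipschitz by blast
  have "isCont ?g q" by (rule gradient_isCont[OF S f qU])
  then have "((\<lambda>x. fst (?g x) * fst (?g q)) \<longlongrightarrow> fst (?g q) * fst (?g q)) (at q)"
    unfolding isCont_def by (intro tendsto_intros)
  moreover have gg: "fst (?g q) * fst (?g q) > 0" using fst0 not_real_square_gt_zero by blast
  ultimately have "\<forall>\<^sub>F x in at q. fst (?g x) * fst (?g q) > 0" by (rule order_tendstoD)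
  moreover have "\<forall>\<^sub>F x in at q. x \<in> U"
    using f qU by (auto simp: defining_function_def intro: eventually_at_in_open')
  ultimately have "\<forall>\<^sub>F x in at q. fst (?g x) * fst (?g q) > 0 \<and> x \<in> U" by eventually_elim blast
  then obtain d where "d > 0" and d: "\<And>x. x \<noteq> q \<Longrightarrow> dist x q < d \<Longrightarrow> fst (?g x) * fst (?g q) > 0 \<and> x \<in> U"
    unfolding eventually_at by auto
  have eq: "unit_normal S p = N p" if "p \<in> S" "dist p q < d" for p
  proof -
    have p: "fst (?g p) * fst (?g q) > 0 \<and> p \<in> U"
    proof (cases "p = q")
      case True
      then show ?thesis using gg qU by simp
    next
      case False
      then show ?thesis using d[of p] that by blast
    qed
    then have "sgn (fst (?g p)) = sgn (fst (?g q))"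
      by (auto simp: zero_less_mult_iff)
    then show ?thesis
      using unit_normal_gradient(1)[OF S f that(1)] p by (simp add: N_def)
  qed
  have "\<forall>p\<in>S. dist p q < min d \<delta> \<longrightarrow> norm (unit_normal S p - unit_normal S q) \<le> C * dist p q"
    using eq C eq[OF q] \<open>d > 0\<close> by simp
  then show ?thesis using \<open>C > 0\<close> \<open>d > 0\<close> \<open>\<delta> > 0\<close> by (metis min_less_iff_conj)
qed

text \<open>By the mean value theorem a chord of \<open>S\<close> is orthogonal to the gradient at
  some point of the chord, hence spacelike. That point need not lie on \<open>S\<close>, so the
  gradient must be timelike on a whole ball, which continuity provides.\<close>

lemma hypersurface_locally_acausal:
  assumes S: "spacelike_hypersurface S" and z: "z \<in> S"
  shows "\<exists>\<delta>>0. \<forall>z1\<in>S \<inter> ball z \<delta>. \<forall>z2\<in>S \<inter> ball z \<delta>.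
      z1 \<noteq> z2 \<longrightarrow> \<bar>fst z1 - fst z2\<bar> < norm (snd z1 - snd z2)"
proof -
  obtain U f where f: "defining_function S U f" and zU: "z \<in> U"
    using defining_function_exists[OF assms] by blast
  let ?g = "lorentz_gradient f"
  have "((\<lambda>x. lorentz (?g x) (?g x)) \<longlongrightarrow> lorentz (?g z) (?g z)) (at z)"
    using gradient_isCont[OF S f zU] unfolding isCont_def by (intro tendsto_intros)
  then have "\<forall>\<^sub>F x in at z. lorentz (?g x) (?g x) < 0"
    using gradient_timelike[OF S f z zU] by (rule order_tendstoD)
  moreover have "\<forall>\<^sub>F x in at z. x \<in> U"
    using f zU by (auto simp: defining_function_def intro: eventually_at_in_open')
  ultimately have "\<forall>\<^sub>F x in at z. lorentz (?g x) (?g x) < 0 \<and> x \<in> U" by eventually_elim blast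
  then obtain d where "d > 0" and d: "\<And>x. x \<noteq> z \<Longrightarrow> dist x z < d \<Longrightarrow> lorentz (?g x) (?g x) < 0 \<and> x \<in> U"
    unfolding eventually_at by auto
  have d': "lorentz (?g x) (?g x) < 0 \<and> x \<in> U" if "x \<in> ball z d" for x
    using d[of x] that gradient_timelike[OF S f z zU] zU by (cases "x = z") (auto simp: dist_commute)
  have "\<bar>fst z1 - fst z2\<bar> < norm (snd z1 - snd z2)"
    if z1: "z1 \<in> S \<inter> ball z d" and z2: "z2 \<in> S \<inter> ball z d" and ne: "z1 \<noteq> z2" for z1 z2
  proof -
    let ?p = "\<lambda>t::real. z2 + t *\<^sub>R (z1 - z2)"
    have p: "?p t \<in> ball z d" if "0 \<le> t" "t \<le> 1" for t
    proof -
      have "?p t = (1 - t) *\<^sub>R z2 + t *\<^sub>R z1" by (simp add: algebra_simps)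
      then show ?thesis using convexD[OF convex_ball[of z d], of z2 z1 "1 - t" t] z1 z2 that by simp
    qed
    have der: "((\<lambda>t. f (?p t)) has_derivative (\<lambda>t. lorentz (?g (?p s)) (t *\<^sub>R (z1 - z2)))) (at s within {0..1})"
      if "0 \<le> s" "s \<le> 1" for s
    proof (rule has_derivative_compose[where f = ?p])
      show "(?p has_derivative (\<lambda>t. t *\<^sub>R (z1 - z2))) (at s within {0..1})"
        by (auto intro!: derivative_eq_intros)
      show "(f has_derivative lorentz (?g (?p s))) (at (?p s))"
        by (rule defining_has_derivative[OF S f]) (use d' p that in blast)
    qed
    have "\<exists>s\<in>{0<..<1}. f (?p 1) - f (?p 0) = lorentz (?g (?p s)) ((1 - 0) *\<^sub>R (z1 - z2))"
      by (rule mvt_simple) (use der in auto)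
    then obtain s where s: "0 < s" "s < 1" "f (?p 1) - f (?p 0) = lorentz (?g (?p s)) (z1 - z2)"
      by auto
    have "z1 \<in> S \<inter> U" "z2 \<in> S \<inter> U"
      using z1 z2 d'[of z1] d'[of z2] by blast+
    then have "f z1 = 0" "f z2 = 0"
      using f unfolding defining_function_def by blast+
    then have "lorentz (?g (?p s)) (z1 - z2) = 0" using s(3) by simp
    then have "lorentz (z1 - z2) (z1 - z2) > 0"
      using d'[OF p[of s]] s ne by (intro timelike_orthogonal_pos[of "?g (?p s)"]) auto
    then show ?thesis by (simp add: lorentz_pos_iff del: lorentz_algebra)
  qed
  then show ?thesis using \<open>d > 0\<close> by blast
qed

text \<open>A timelike gradient has nonzero time component, so \<open>f\<close> changes sign along
  the time line through \<open>z\<close>. The opposite signs at two fixed heights persist over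
  nearby spatial points, and the intermediate value theorem applies there.\<close>

lemma hypersurface_locally_onto:
  assumes S: "spacelike_hypersurface S" and z: "z \<in> S" and \<epsilon>: "\<epsilon> > 0"
  shows "\<exists>\<eta>>0. \<forall>y\<in>ball (snd z) \<eta>. \<exists>t. \<bar>t - fst z\<bar> < \<epsilon> \<and> (t, y) \<in> S"
proof -
  obtain U f where f: "defining_function S U f" and zU: "z \<in> U"
    using defining_function_exists[OF S z] by blast
  let ?g = "lorentz_gradient f"
  have fst0: "fst (?g z) \<noteq> 0" using gradient_timelike[OF S f z zU] by (auto simp: lorentz_neg_iff)
  have fz: "f z = 0" using f z zU by (auto simp: defining_function_def)
  have cont: "continuous_on U f" by (rule defining_continuous[OF S f])
  have "open U" using f by (simp add: defining_function_def)
  obtain e where "e > 0" and e: "ball z e \<subseteq> U" using \<open>open U\<close> zU by (meson openE)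
  let ?l = "\<lambda>t. z + t *\<^sub>R (1, 0)"
  have "((\<lambda>t. f (?l t)) has_derivative (\<lambda>t. lorentz (?g (?l 0)) (t *\<^sub>R (1, 0)))) (at 0)"
  proof (rule has_derivative_compose[where f = ?l])
    show "(?l has_derivative (\<lambda>t. t *\<^sub>R (1, 0))) (at 0)"
      by (auto intro!: derivative_eq_intros)
    show "(f has_derivative lorentz (?g (?l 0))) (at (?l 0))"
      using defining_has_derivative[OF S f zU] by (simp flip: zero_prod_def)
  qed
  moreover have "(\<lambda>t. lorentz (?g (?l 0)) (t *\<^sub>R (1, 0))) = (*) (- fst (?g z))"
    by (rule ext) (simp add: lorentz_def flip: zero_prod_def)
  ultimately have der: "((\<lambda>t. f (?l t)) has_real_derivative - fst (?g z)) (at 0)"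
    unfolding has_field_derivative_def by (simp only:)
  have fz0: "f (z + (0, 0)) = 0" using fz by (simp flip: zero_prod_def)
  \<comment> \<open>The product covers both signs of the derivative.\<close>
  obtain d where d: "d > 0" and sep: "\<And>h. 0 < h \<Longrightarrow> h < d \<Longrightarrow> f (?l h) * f (?l (- h)) < 0"
  proof (cases "fst (?g z) < 0")
    case True
    then obtain d1 where "d1 > 0" "\<And>h. 0 < h \<Longrightarrow> h < d1 \<Longrightarrow> f (?l 0) < f (?l (0 + h))"
      using DERIV_pos_inc_right[OF der] by auto
    moreover from True obtain d2 where "d2 > 0" "\<And>h. 0 < h \<Longrightarrow> h < d2 \<Longrightarrow> f (?l (0 - h)) < f (?l 0)"
      using DERIV_pos_inc_left[OF der] by auto
    ultimately show thesis
      using fz0 by (intro that[of "min d1 d2"]) (auto simp: mult_less_0_iff)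
  next
    case False
    then have neg: "- fst (?g z) < 0" using fst0 by simp
    then obtain d1 where "d1 > 0" "\<And>h. 0 < h \<Longrightarrow> h < d1 \<Longrightarrow> f (?l 0) > f (?l (0 + h))"
      using DERIV_neg_dec_right[OF der] by auto
    moreover from neg obtain d2 where "d2 > 0" "\<And>h. 0 < h \<Longrightarrow> h < d2 \<Longrightarrow> f (?l (0 - h)) > f (?l 0)"
      using DERIV_neg_dec_left[OF der] by auto
    ultimately show thesis
      using fz0 by (intro that[of "min d1 d2"]) (auto simp: mult_less_0_iff)
  qed
  define h where "h = min (min d \<epsilon>) (min e \<epsilon>) / 2"
  have h: "0 < h" "h < d" "h < \<epsilon>" "h < e" using d \<epsilon> \<open>e > 0\<close> by (auto simp: h_def)
  define \<eta>0 where "\<eta>0 = e - h"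
  have "\<eta>0 > 0" using h by (simp add: \<eta>0_def)
  have inU: "(t, y) \<in> U" if "\<bar>t - fst z\<bar> \<le> h" "dist (snd z) y < \<eta>0" for t y
  proof -
    have "dist z (t, y) \<le> dist (fst z) t + dist (snd z) y"
      by (subst (1) surjective_pairing[of z], subst dist_Pair_Pair) (rule sqrt_sum_squares_le_sum; simp)
    also have "\<dots> < e" using that by (simp add: \<eta>0_def dist_real_def abs_minus_commute)
    finally show ?thesis using e by auto
  qed
  have contH: "isCont (\<lambda>y. f (fst z + h, y) * f (fst z - h, y)) (snd z)"
  proof -
    have "isCont f (fst z + h, snd z)" "isCont f (fst z - h, snd z)"
      using inU[of "fst z + h" "snd z"] inU[of "fst z - h" "snd z"] h \<open>\<eta>0 > 0\<close> cont \<open>open U\<close>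
      by (auto simp: continuous_on_eq_continuous_at)
    then have "isCont (\<lambda>y. f (fst z + h, y)) (snd z)" "isCont (\<lambda>y. f (fst z - h, y)) (snd z)"
      by (auto intro!: isCont_o2[where g = f] continuous_intros)
    then show ?thesis by (intro continuous_intros)
  qed
  have l: "?l t = (fst z + t, snd z)" for t by (simp add: prod_eq_iff)
  have "f (fst z + h, snd z) * f (fst z - h, snd z) < 0"
    using sep[OF h(1,2)] l[of h] l[of "- h"] by simp
  then have "\<forall>\<^sub>F y in at (snd z). f (fst z + h, y) * f (fst z - h, y) < 0"
    using contH unfolding isCont_def by (rule order_tendstoD(2)[rotated])
  then obtain \<eta>1 where "\<eta>1 > 0" and \<eta>1: "\<And>y. y \<noteq> snd z \<Longrightarrow> dist y (snd z) < \<eta>1 \<Longrightarrow>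
      f (fst z + h, y) * f (fst z - h, y) < 0"
    unfolding eventually_at by auto
  have "\<exists>t. \<bar>t - fst z\<bar> < \<epsilon> \<and> (t, y) \<in> S" if y: "y \<in> ball (snd z) (min \<eta>0 \<eta>1)" for y
  proof -
    have sgn: "f (fst z + h, y) * f (fst z - h, y) < 0"
      using \<eta>1[of y] y \<open>f (fst z + h, snd z) * f (fst z - h, snd z) < 0\<close>
      by (cases "y = snd z") (auto simp: dist_commute)
    have cy: "continuous_on {fst z - h..fst z + h} (\<lambda>t. f (t, y))"
      by (rule continuous_on_compose2[OF cont])
         (use inU y in \<open>auto intro!: continuous_intros simp: abs_le_iff\<close>)
    have "\<exists>t. fst z - h \<le> t \<and> t \<le> fst z + h \<and> f (t, y) = 0"
    proof (cases "f (fst z - h, y) < 0")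
      case True
      then have "f (fst z + h, y) > 0" using sgn by (auto simp: mult_less_0_iff)
      then show ?thesis
        using IVT'[of "\<lambda>t. f (t, y)" "fst z - h" 0 "fst z + h"] True cy h by auto
    next
      case False
      then have "f (fst z - h, y) > 0" "f (fst z + h, y) < 0" using sgn by (auto simp: mult_less_0_iff)
      then show ?thesis
        using IVT2'[of "\<lambda>t. f (t, y)" "fst z + h" 0 "fst z - h"] cy h by auto
    qed
    then obtain t where t: "fst z - h \<le> t" "t \<le> fst z + h" "f (t, y) = 0" by blast
    then have "(t, y) \<in> U" using inU[of t y] y by (auto simp: abs_le_iff)
    then have "(t, y) \<in> S" using t f by (auto simp: defining_function_def)
    then show ?thesis using t h by (intro exI[of _ t]) (auto simp: abs_less_iff)
  qed
  then show ?thesis using \<open>\<eta>0 > 0\<close> \<open>\<eta>1 > 0\<close> by (intro exI[of _ "min \<eta>0 \<eta>1"]) auto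
qed

section \<open>Hyperbolic sections of an acausal set\<close>

text \<open>The hyperbola of \<open>future_unit_hyperbola\<close> in null coordinates, with
  \<open>r\<close> the exponential of arc length. For large \<open>r\<close> it runs off along the
  null vector \<open>n + v\<close>.\<close>

lemma future_unit_null_combination:
  assumes "future_unit n" "lorentz v v = 1" "lorentz n v = 0" "r > 0"
  shows "future_unit ((r / 2) *\<^sub>R (n + v) + (1 / (2 * r)) *\<^sub>R (n - v))"
proof -
  define y where "y = (r - 1 / r) / 2"
  have "1 + y\<^sup>2 = ((r + 1 / r) / 2)\<^sup>2"
    using assms(4) by (simp add: y_def power2_eq_square field_simps)
  then have "sqrt (1 + y\<^sup>2) = (r + 1 / r) / 2"
    using assms(4) by simp
  then have "sqrt (1 + y\<^sup>2) *\<^sub>R n + y *\<^sub>R v = (r / 2) *\<^sub>R (n + v) + (1 / (2 * r)) *\<^sub>R (n - v)"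
    by (simp add: y_def algebra_simps diff_divide_distrib add_divide_distrib)
  then show ?thesis using future_unit_hyperbola[OF assms(1-3), of y] by simp
qed

lemma future_unit_nonzero: "future_unit n \<Longrightarrow> n \<noteq> 0"
  by (auto simp: future_unit_def)

lemma unit_parallel:
  assumes "lorentz a a = 1" "lorentz b b = 1" "x *\<^sub>R a = y *\<^sub>R b" "a \<noteq> b" "a \<noteq> - b"
  shows "x = 0"
proof (rule ccontr)
  assume "x \<noteq> 0"
  define t where "t = y / x"
  have "a = (1 / x) *\<^sub>R (x *\<^sub>R a)" using \<open>x \<noteq> 0\<close> by simp
  then have a: "a = t *\<^sub>R b" unfolding assms(3) by (simp add: t_def)
  have "lorentz a a = t * t * lorentz b b" unfolding a by simp
  then have "t * t = 1" using assms(1,2) by simp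
  then have "t = 1 \<or> t = -1" by (simp add: square_eq_1_iff)
  then show False using a assms(4,5) by auto
qed

text \<open>From \<open>(h + X)\<^sup>2 = X\<^sup>2 + 1\<close> follows
  \<open>h\<^sup>2 + 2 * h * X = 1\<close>, so \<open>h\<close> is nonzero and determines
  \<open>X\<close>. This \<open>h\<close> is the height that \<open>section_point\<close> finds for
  the radius \<open>X\<close>.\<close>

lemma height_inj:
  fixes \<sigma> :: real
  assumes "\<sigma> * \<sigma> = 1" "\<sigma> * sqrt (R\<^sup>2 + 1) - R = \<sigma> * sqrt (R'\<^sup>2 + 1) - R'"
  shows "R = R'"
proof -
  have *: "h * h + 2 * h * X = 1" if "h = \<sigma> * sqrt (X\<^sup>2 + 1) - X" for h X
  proof -
    have "(h + X) * (h + X) = (\<sigma> * \<sigma>) * (sqrt (X\<^sup>2 + 1) * sqrt (X\<^sup>2 + 1))" by (simp add: that)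
    also have "\<dots> = X * X + 1" using assms(1) by (simp add: power2_eq_square add_nonneg_nonneg)
    finally show ?thesis by (simp add: algebra_simps)
  qed
  define h where "h = \<sigma> * sqrt (R\<^sup>2 + 1) - R"
  have 1: "h * h + 2 * h * R = 1" by (rule *) (simp add: h_def)
  have 2: "h * h + 2 * h * R' = 1" by (rule *) (use assms(2) in \<open>simp add: h_def\<close>)
  have "h \<noteq> 0" using 1 by auto
  moreover have "2 * h * R = 2 * h * R'" using 1 2 by linarith
  ultimately show ?thesis by simp
qed

lemma hyperbola_has_vector_derivative:
  fixes m v :: "'a::real_normed_vector"
  shows "((\<lambda>y. q + R *\<^sub>R (sqrt (1 + y\<^sup>2) *\<^sub>R m + y *\<^sub>R v - k)) has_vector_derivative R *\<^sub>R v) (at 0)"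
proof -
  have "((\<lambda>y. sqrt (1 + y\<^sup>2)) has_real_derivative 0) (at 0)"
    by (auto intro!: derivative_eq_intros)
  from has_vector_derivative_scaleR[OF this has_vector_derivative_const[of m]]
  have m: "((\<lambda>y. sqrt (1 + y\<^sup>2) *\<^sub>R m) has_vector_derivative 0) (at 0)" by simp
  have v: "((\<lambda>y. y *\<^sub>R v) has_vector_derivative v) (at 0)"
    using has_vector_derivative_scaleR[OF DERIV_ident has_vector_derivative_const[of v]] by simp
  have "((\<lambda>y. R *\<^sub>R (sqrt (1 + y\<^sup>2) *\<^sub>R m + y *\<^sub>R v - k)) has_vector_derivative R *\<^sub>R (0 + v - 0)) (at 0)"
    by (intro bounded_linear.has_vector_derivative[OF bounded_linear_scaleR_right]
        has_vector_derivative_diff has_vector_derivative_add m v has_vector_derivative_const)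
  then show ?thesis
    using has_vector_derivative_add[OF has_vector_derivative_const[of q]] by fastforce
qed

text \<open>The velocities of hyperbolas through \<open>m\<close>. Some nonzero multiple of
  \<open>w\<close> is enough, since it is only tested for orthogonality to the normal.\<close>

lemma hyperbola_tangent:
  assumes sheet: "\<And>m. future_unit m \<Longrightarrow> lorentz a m = 0 \<Longrightarrow> c + R *\<^sub>R m \<in> S" and R: "R \<noteq> 0"
    and m: "future_unit m" "lorentz a m = 0" and w: "lorentz m w = 0" "lorentz a w = 0"
  shows "\<exists>t. t \<noteq> 0 \<and> t *\<^sub>R w \<in> tangent_space S (c + R *\<^sub>R m)"
proof (cases "w = 0")
  case True
  have "0 \<in> tangent_space S (c + R *\<^sub>R m)"
    unfolding tangent_space_def using sheet[OF m]
    by (auto intro!: exI[of _ "\<lambda>_. c + R *\<^sub>R m"])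
  then show ?thesis using True by (intro exI[of _ 1]) simp
next
  case False
  have pos: "lorentz w w > 0"
    using m(1) w(1) False by (intro timelike_orthogonal_pos[of m]) (auto simp: future_unit_def)
  define k where "k = 1 / sqrt (lorentz w w)"
  have k: "k \<noteq> 0" using pos by (simp add: k_def)
  define v where "v = k *\<^sub>R w"
  have v: "lorentz v v = 1" "lorentz m v = 0" "lorentz a v = 0"
    using pos w by (simp_all add: v_def k_def)
  define \<gamma> where "\<gamma> y = c + R *\<^sub>R (sqrt (1 + y\<^sup>2) *\<^sub>R m + y *\<^sub>R v - 0)" for y :: real
  have "\<gamma> y \<in> S" for y
    unfolding \<gamma>_def diff_zero using future_unit_hyperbola[OF m(1) v(1,2), of y]
    by (intro sheet) (auto simp: m v)
  moreover have "\<gamma> 0 = c + R *\<^sub>R m" by (simp add: \<gamma>_def)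
  moreover have "(\<gamma> has_vector_derivative R *\<^sub>R v) (at 0)"
    unfolding \<gamma>_def by (rule hyperbola_has_vector_derivative)
  ultimately have "R *\<^sub>R v \<in> tangent_space S (c + R *\<^sub>R m)" by (auto simp: tangent_space_def)
  then show ?thesis using R k by (intro exI[of _ "R * k"]) (simp add: v_def)
qed

text \<open>
  The hyperbolic space with centre \<open>q - R n\<close> in the hyperplane through \<open>q\<close> orthogonal to \<open>a\<close>,
  where the sign of \<open>R\<close> selects the sheet.
\<close>

definition hyperbolic_section ::
    "'m::finite minkowski set \<Rightarrow> 'm minkowski \<Rightarrow> 'm minkowski \<Rightarrow> real \<Rightarrow> 'm minkowski \<Rightarrow> bool"
  where "hyperbolic_section S q n R a \<longleftrightarrow> lorentz a a = 1 \<and> lorentz n a = 0 \<and> R \<noteq> 0 \<and>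
    (\<forall>m. future_unit m \<and> lorentz m a = 0 \<longrightarrow> q + R *\<^sub>R (m - n) \<in> S)"

lemma hyperbolic_section_mem:
  assumes "hyperbolic_section S q n R a" "future_unit m" "lorentz a m = 0"
  shows "q + R *\<^sub>R (m - n) \<in> S"
  using assms unfolding hyperbolic_section_def by (metis lorentz_commute)

text \<open>The setting of the rigidity argument, to be applied to one component with its unit
  normal. Of the smooth structure only \<open>tangent\<close> and the pointwise Lipschitz bound
  remain. The vector \<open>- a'\<close> is excluded because opposite vectors define the same
  hyperplane; equality of the two radii is proved, not assumed.\<close>

locale acausal_with_sections =
  fixes S :: "'m::finite minkowski set" and n :: "'m minkowski \<Rightarrow> 'm minkowski"
  assumes card: "CARD('m) \<ge> 3"
    and closed: "closed S"
    and acausal: "\<And>x y. x \<in> S \<Longrightarrow> y \<in> S \<Longrightarrow> x \<noteq> y \<Longrightarrow> lorentz (x - y) (x - y) > 0"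
    and normal: "\<And>q. q \<in> S \<Longrightarrow> future_unit (n q)"
    and tangent: "\<And>q v. q \<in> S \<Longrightarrow> v \<in> tangent_space S q \<Longrightarrow> lorentz (n q) v = 0"
    and normal_lipschitz: "\<And>q. q \<in> S \<Longrightarrow>
      \<exists>C>0. \<exists>\<delta>>0. \<forall>p\<in>S. dist p q < \<delta> \<longrightarrow> norm (n p - n q) \<le> C * dist p q"
    and two_sections: "\<And>q. q \<in> S \<Longrightarrow> \<exists>R a R' a'. a \<noteq> a' \<and> a \<noteq> - a' \<and>
      hyperbolic_section S q (n q) R a \<and> hyperbolic_section S q (n q) R' a'"
begin

section \<open>Comparison of two sections\<close>

lemma acausal_nonneg:
  assumes "x \<in> S" "y \<in> S"
  shows "lorentz (x - y) (x - y) \<ge> 0"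
  using acausal[OF assms] by (cases "x = y") (auto simp del: lorentz_algebra(3,4))

lemma normal_tendsto:
  assumes p: "\<And>k. p k \<in> S" "p \<longlonglongrightarrow> q" and q: "q \<in> S"
  shows "(\<lambda>k. n (p k)) \<longlonglongrightarrow> n q"
proof -
  obtain C \<delta> where "C > 0" "\<delta> > 0" and C: "\<And>p. p \<in> S \<Longrightarrow> dist p q < \<delta> \<Longrightarrow> norm (n p - n q) \<le> C * dist p q"
    using normal_lipschitz[OF q] by blast
  have "\<forall>\<^sub>F k in sequentially. dist (p k) q < \<delta>" using p(2) \<open>\<delta> > 0\<close> by (rule tendstoD)
  then have "\<forall>\<^sub>F k in sequentially. norm (n (p k) - n q) \<le> C * dist (p k) q"
    by eventually_elim (use C p in blast)
  moreover have "(\<lambda>k. C * dist (p k) q) \<longlonglongrightarrow> 0"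
    using tendsto_mult_right_zero[OF iffD1[OF tendsto_dist_iff p(2)]] .
  ultimately have "(\<lambda>k. n (p k) - n q) \<longlonglongrightarrow> 0" by (rule Lim_null_comparison)
  then show ?thesis by (rule LIM_zero_cancel)
qed

text \<open>The hyperbola parameter \<open>1 / R\<close> makes the displacement orthogonal to
  \<open>n q\<close> equal to \<open>v\<close>, whatever the radius. Sections of different radius
  thus become comparable over the same displacement.\<close>

lemma section_point:
  assumes "hyperbolic_section S q (n q) R a" "q \<in> S"
    and v: "lorentz v v = 1" "lorentz (n q) v = 0" "lorentz a v = 0"
  shows "q + (sgn R * sqrt (R\<^sup>2 + 1) - R) *\<^sub>R n q + v \<in> S"
proof -
  let ?m = "sqrt (1 + (1 / R)\<^sup>2) *\<^sub>R n q + (1 / R) *\<^sub>R v"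
  have R: "R \<noteq> 0" and a: "lorentz (n q) a = 0" using assms(1) by (auto simp: hyperbolic_section_def)
  have "future_unit ?m" by (intro future_unit_hyperbola normal assms v)
  moreover have "lorentz ?m a = 0" using a v(3) lorentz_commute[of v a] by simp
  ultimately have "q + R *\<^sub>R (?m - n q) \<in> S" using assms(1) unfolding hyperbolic_section_def by blast
  moreover have "R * sqrt (1 + (1 / R)\<^sup>2) = sgn R * sqrt (R\<^sup>2 + 1)"
  proof -
    have "R * sqrt (1 + (1 / R)\<^sup>2) = sgn R * (sqrt (R\<^sup>2) * sqrt (1 + (1 / R)\<^sup>2))"
      by (simp add: mult.assoc[symmetric] sgn_mult_abs)
    also have "sqrt (R\<^sup>2) * sqrt (1 + (1 / R)\<^sup>2) = sqrt (R\<^sup>2 + 1)"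
      unfolding real_sqrt_mult[symmetric] using R by (simp add: distrib_left power_divide)
    finally show ?thesis .
  qed
  then have "R *\<^sub>R (?m - n q) = (sgn R * sqrt (R\<^sup>2 + 1) - R) *\<^sub>R n q + v"
    using R by (simp add: scaleR_diff_right scaleR_add_right scaleR_left_diff_distrib)
  ultimately show ?thesis by (simp add: add.assoc)
qed

lemma vertical_unique:
  assumes "q \<in> S" "q' + h *\<^sub>R n q + v \<in> S" "q' + h' *\<^sub>R n q + v \<in> S"
  shows "h = h'"
proof (rule ccontr)
  assume ne: "h \<noteq> h'"
  have nq: "future_unit (n q)" by (rule normal[OF assms(1)])
  have diff: "(q' + h *\<^sub>R n q + v) - (q' + h' *\<^sub>R n q + v) = (h - h') *\<^sub>R n q" by (simp add: algebra_simps)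
  have "(q' + h *\<^sub>R n q + v) \<noteq> (q' + h' *\<^sub>R n q + v)"
    using ne future_unit_nonzero[OF nq] diff by auto
  from acausal[OF assms(2,3) this] have "lorentz ((h - h') *\<^sub>R n q) ((h - h') *\<^sub>R n q) > 0"
    unfolding diff .
  then have "(h - h') * (h - h') * lorentz (n q) (n q) > 0" by (simp only: lorentz_algebra mult.assoc)
  then show False using nq by (simp add: future_unit_def not_square_less_zero)
qed

text \<open>Sections with radii of opposite sign open in opposite time directions, and points far
  out along suitable null directions would be timelike separated.\<close>

lemma section_same_sign:
  assumes q: "q \<in> S" "hyperbolic_section S q (n q) R a"
    and p: "p \<in> S" "hyperbolic_section S p (n p) R' b"
  shows "R * R' > 0"
proof (rule ccontr)
  assume "\<not> R * R' > 0"
  moreover have "R \<noteq> 0" "R' \<noteq> 0" using q p by (auto simp: hyperbolic_section_def)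
  ultimately have RR: "R * R' < 0" by (simp add: not_less order_le_less)
  let ?k = "n q" and ?l = "n p"
  have k: "future_unit ?k" and l: "future_unit ?l" using normal q p by auto
  obtain v0 where v0: "lorentz v0 v0 = 1" "lorentz ?k v0 = 0" "lorentz a v0 = 0"
    using exists_unit_orthogonal3[OF card, of ?k a a] k by (auto simp: future_unit_def)
  obtain w0 where w0: "lorentz w0 w0 = 1" "lorentz ?l w0 = 0" "lorentz b w0 = 0"
    using exists_unit_orthogonal3[OF card, of ?l b b] l by (auto simp: future_unit_def)
  have kl: "lorentz ?k ?l < 0" using future_unit_lorentz(1)[OF k l] by simp
  \<comment> \<open>The four products have a negative sum, so one pair of null directions has a
    negative product.\<close>
  have "lorentz (?k + v0) (?l + w0) + lorentz (?k + v0) (?l - w0) + lorentz (?k - v0) (?l + w0)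
      + lorentz (?k - v0) (?l - w0) = 4 * lorentz ?k ?l" by simp
  then have "\<exists>v w. (v = v0 \<or> v = - v0) \<and> (w = w0 \<or> w = - w0) \<and> lorentz (?k + v) (?l + w) < 0"
    using kl by (smt (verit) diff_conv_add_uminus)
  then obtain v w where vw: "v = v0 \<or> v = - v0" "w = w0 \<or> w = - w0"
    and neg: "lorentz (?k + v) (?l + w) < 0" by blast
  have v: "lorentz v v = 1" "lorentz ?k v = 0" "lorentz a v = 0" using v0 vw(1) by auto
  have w: "lorentz w w = 1" "lorentz ?l w = 0" "lorentz b w = 0" using w0 vw(2) by auto
  define x where "x r = q + R *\<^sub>R ((r / 2) *\<^sub>R (?k + v) + (1 / (2 * r)) *\<^sub>R (?k - v) - ?k)" for r
  define y where "y r = p + R' *\<^sub>R ((r / 2) *\<^sub>R (?l + w) + (1 / (2 * r)) *\<^sub>R (?l - w) - ?l)" for r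
  have xS: "x r \<in> S" if "r > 0" for r
    unfolding x_def using q(2)
    by (intro hyperbolic_section_mem[OF q(2)] future_unit_null_combination k v that)
       (simp add: v hyperbolic_section_def lorentz_commute[of a "n q"])
  have yS: "y r \<in> S" if "r > 0" for r
    unfolding y_def using p(2)
    by (intro hyperbolic_section_mem[OF p(2)] future_unit_null_combination l w that)
       (simp add: w hyperbolic_section_def lorentz_commute[of b "n p"])
  \<comment> \<open>The difference of the two points divided by \<open>r\<close>. Its limit is a
    combination of two null vectors, so only the mixed product contributes to the square.\<close>
  define z where "z r = (R / 2) *\<^sub>R (?k + v) - (R' / 2) *\<^sub>R (?l + w) + (1 / r) *\<^sub>R (q - R *\<^sub>R ?k - p + R' *\<^sub>R ?l)
      + (1 / r * (1 / r)) *\<^sub>R ((R / 2) *\<^sub>R (?k - v) - (R' / 2) *\<^sub>R (?l - w))" for r :: real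
  have z: "z r = (1 / r) *\<^sub>R (x r - y r)" if "r > 0" for r
  proof -
    have "x r - y r = r *\<^sub>R z r"
      using that by (simp add: x_def y_def z_def algebra_simps)
    then show ?thesis using that by simp
  qed
  have "\<forall>\<^sub>F r in at_top. lorentz (z r) (z r) \<ge> 0"
    using eventually_gt_at_top[of 0]
  proof eventually_elim
    case (elim r)
    have "lorentz (x r - y r) (x r - y r) \<ge> 0" by (intro acausal_nonneg xS yS elim)
    then show ?case unfolding z[OF elim] lorentz_algebra(7,8) using elim by simp
  qed
  moreover have "((\<lambda>r. lorentz (z r) (z r)) \<longlongrightarrow>
      lorentz ((R / 2) *\<^sub>R (?k + v) - (R' / 2) *\<^sub>R (?l + w)) ((R / 2) *\<^sub>R (?k + v) - (R' / 2) *\<^sub>R (?l + w))) at_top"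
  proof -
    have inv: "((\<lambda>r::real. 1 / r) \<longlongrightarrow> 0) at_top"
      by (rule tendsto_divide_0[OF tendsto_const filterlim_at_top_imp_at_infinity[OF filterlim_ident]])
    have "(z \<longlongrightarrow> (R / 2) *\<^sub>R (?k + v) - (R' / 2) *\<^sub>R (?l + w) + 0 *\<^sub>R (q - R *\<^sub>R ?k - p + R' *\<^sub>R ?l)
      + (0 * 0) *\<^sub>R ((R / 2) *\<^sub>R (?k - v) - (R' / 2) *\<^sub>R (?l - w))) at_top"
      unfolding z_def by (intro tendsto_intros inv)
    then show ?thesis by (intro tendsto_lorentz) simp_all
  qed
  ultimately have "lorentz ((R / 2) *\<^sub>R (?k + v) - (R' / 2) *\<^sub>R (?l + w)) ((R / 2) *\<^sub>R (?k + v) - (R' / 2) *\<^sub>R (?l + w)) \<ge> 0"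
    by (intro tendsto_lowerbound) auto
  moreover have "lorentz ((R / 2) *\<^sub>R (?k + v) - (R' / 2) *\<^sub>R (?l + w)) ((R / 2) *\<^sub>R (?k + v) - (R' / 2) *\<^sub>R (?l + w))
    = - (R * R') / 2 * lorentz (?k + v) (?l + w)"
  proof -
    define A B where "A = ?k + v" and "B = ?l + w"
    have "lorentz A A = 0" "lorentz B B = 0"
      using k l v w lorentz_commute[of v ?k] lorentz_commute[of w ?l] by (simp_all add: A_def B_def future_unit_def)
    then have "lorentz ((R / 2) *\<^sub>R A - (R' / 2) *\<^sub>R B) ((R / 2) *\<^sub>R A - (R' / 2) *\<^sub>R B) = - (R * R') / 2 * lorentz A B"
      using lorentz_commute[of B A] by (simp add: algebra_simps)
    then show ?thesis by (simp only: A_def B_def)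
  qed
  moreover have "- (R * R') / 2 * lorentz (?k + v) (?l + w) < 0"
    using neg RR by (intro mult_pos_neg) auto
  ultimately show False by linarith
qed

text \<open>For \<open>v\<close> orthogonal to both \<open>a\<close> and \<open>a'\<close> the two
  sections have points over the same displacement. Different heights would be timelike separated, so
  \<open>height_inj\<close> applies.\<close>

lemma section_radius_unique:
  assumes q: "q \<in> S" "hyperbolic_section S q (n q) R a" "hyperbolic_section S q (n q) R' a'"
  shows "R = R'"
proof -
  have nq: "future_unit (n q)" using normal q by auto
  obtain v where v: "lorentz v v = 1" "lorentz (n q) v = 0" "lorentz a v = 0" "lorentz a' v = 0"
    using exists_unit_orthogonal3[OF card, of "n q" a a'] nq by (auto simp: future_unit_def)
  have "R * R' > 0" by (rule section_same_sign) (use q in auto)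
  then have sg: "sgn R' = sgn R" "sgn R * sgn R = 1" by (auto simp: zero_less_mult_iff)
  have "sgn R * sqrt (R\<^sup>2 + 1) - R = sgn R * sqrt (R'\<^sup>2 + 1) - R'"
    using vertical_unique[OF q(1) section_point[OF q(2,1) v(1-3)] section_point[OF q(3,1) v(1,2,4)]]
    unfolding sg by simp
  then show ?thesis by (rule height_inj[OF sg(2)])
qed

text \<open>The comparison of \<open>section_radius_unique\<close> in the limit. The
  \<open>b k\<close> need not converge, because they only place points in \<open>S\<close>, and
  \<open>S\<close> is closed. The value 0 for \<rho> is not excluded beforehand;
  \<open>height_inj\<close> allows it.\<close>

lemma section_radius_closed:
  assumes p: "\<And>k. p k \<in> S" "\<And>k. hyperbolic_section S (p k) (n (p k)) (R' k) (b k)"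
    and lim: "p \<longlonglongrightarrow> q" "R' \<longlonglongrightarrow> \<rho>" and q: "q \<in> S" "hyperbolic_section S q (n q) R a"
  shows "\<rho> = R"
proof -
  have nlim: "(\<lambda>k. n (p k)) \<longlonglongrightarrow> n q" by (rule normal_tendsto) (use p lim q in auto)
  have np: "future_unit (n (p k))" for k using normal p by auto
  have "\<exists>v. lorentz v v = 1 \<and> lorentz (n (p k)) v = 0 \<and> lorentz a v = 0 \<and> lorentz (b k) v = 0" for k
  proof -
    have "lorentz (n (p k)) (n (p k)) < 0" using np[of k] by (simp add: future_unit_def)
    from exists_unit_orthogonal3[OF card this, of a "b k"] show ?thesis by metis
  qed
  then obtain v where v: "\<And>k. lorentz (v k) (v k) = 1" "\<And>k. lorentz (n (p k)) (v k) = 0"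
    "\<And>k. lorentz a (v k) = 0" "\<And>k. lorentz (b k) (v k) = 0" by metis
  have sg: "sgn (R' k) = sgn R" "sgn R * sgn R = 1" for k
    using section_same_sign[OF q p(1)[of k] p(2)[of k]] by (auto simp: zero_less_mult_iff)
  obtain B where B: "\<And>k. norm (n (p k)) \<le> B"
    using convergent_imp_Bseq[of "\<lambda>k. n (p k)"] nlim unfolding convergent_def Bseq_def by blast
  have "norm (v k) \<le> 2 * B" for k
  proof -
    have "norm (v k) \<le> 2 * fst (n (p k))" by (rule norm_unit_orthogonal_le[OF np v(1,2)])
    also have "fst (n (p k)) \<le> norm (n (p k))"
      using norm_fst_le[of "fst (n (p k))" "snd (n (p k))"] by simp
    finally show ?thesis using B[of k] by linarith
  qed
  then have "bounded (range v)" by (auto simp: bounded_iff)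
  then obtain l r where r: "strict_mono r" and vl: "(v \<circ> r) \<longlonglongrightarrow> l"
    using bounded_imp_convergent_subsequence by blast
  have plim: "(\<lambda>k. p (r k)) \<longlonglongrightarrow> q" and nrlim: "(\<lambda>k. n (p (r k))) \<longlonglongrightarrow> n q" and Rlim: "(\<lambda>k. R' (r k)) \<longlonglongrightarrow> \<rho>"
    and vlim: "(\<lambda>k. v (r k)) \<longlonglongrightarrow> l"
    using LIMSEQ_subseq_LIMSEQ[OF lim(1) r] LIMSEQ_subseq_LIMSEQ[OF nlim r] LIMSEQ_subseq_LIMSEQ[OF lim(2) r] vl
    by (auto simp: o_def)
  have "(\<lambda>k. lorentz (v (r k)) (v (r k))) \<longlonglongrightarrow> lorentz l l" by (intro tendsto_intros vlim)
  then have l1: "lorentz l l = 1" using v(1) LIMSEQ_unique[OF tendsto_const[of 1]] by simp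
  have "(\<lambda>k. lorentz (n (p (r k))) (v (r k))) \<longlonglongrightarrow> lorentz (n q) l" by (intro tendsto_intros vlim nrlim)
  then have l2: "lorentz (n q) l = 0" using v(2) LIMSEQ_unique[OF tendsto_const[of 0]] by simp
  have "(\<lambda>k. lorentz a (v (r k))) \<longlonglongrightarrow> lorentz a l" by (intro tendsto_intros vlim)
  then have l3: "lorentz a l = 0" using v(3) LIMSEQ_unique[OF tendsto_const[of 0]] by simp
  have "q + (sgn R * sqrt (\<rho>\<^sup>2 + 1) - \<rho>) *\<^sub>R n q + l \<in> S"
  proof (rule closed_sequentially[OF closed])
    show "p (r k) + (sgn R * sqrt ((R' (r k))\<^sup>2 + 1) - R' (r k)) *\<^sub>R n (p (r k)) + v (r k) \<in> S" for k
      using section_point[OF p(2) p(1) v(1,2,4), of "r k"] unfolding sg .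
    show "(\<lambda>k. p (r k) + (sgn R * sqrt ((R' (r k))\<^sup>2 + 1) - R' (r k)) *\<^sub>R n (p (r k)) + v (r k)) \<longlonglongrightarrow>
        q + (sgn R * sqrt (\<rho>\<^sup>2 + 1) - \<rho>) *\<^sub>R n q + l"
      by (intro tendsto_intros plim nrlim Rlim vlim)
  qed
  from vertical_unique[OF q(1) this section_point[OF q(2,1) l1 l2 l3]]
  show ?thesis by (rule height_inj[OF sg(2)])
qed

text \<open>
  Two sections have common null directions, and two points of them far out in such a direction
  \<open>\<ell>\<close> are spacelike separated only if the difference of the centres is orthogonal to \<open>\<ell>\<close>.
\<close>

lemma centre_difference:
  assumes q: "q \<in> S" "hyperbolic_section S q (n q) R a"
    and p: "p \<in> S" "hyperbolic_section S p (n p) R' b" and ab: "\<bar>lorentz a b\<bar> < 1"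
  obtains x y where "(p - R' *\<^sub>R n p) - (q - R *\<^sub>R n q) = x *\<^sub>R a + y *\<^sub>R b"
proof (rule orthogonal_null_vectors_span[OF card, of a b "(p - R' *\<^sub>R n p) - (q - R *\<^sub>R n q)"])
  show "lorentz a a = 1" "lorentz b b = 1" "\<bar>lorentz a b\<bar> < 1"
    using q p ab by (auto simp: hyperbolic_section_def)
  fix e w assume e: "future_unit e" and w: "lorentz w w = 1" "lorentz e w = 0"
    and ae: "lorentz a e = 0" "lorentz a w = 0" and be: "lorentz b e = 0" "lorentz b w = 0"
  define d where "d = (p - R' *\<^sub>R n p) - (q - R *\<^sub>R n q)"
  have R: "R \<noteq> 0" "R' \<noteq> 0" using q p by (auto simp: hyperbolic_section_def)
  have pos: "R / R' > 0" using section_same_sign[OF q p] by (simp add: zero_less_mult_iff zero_less_divide_iff)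
  let ?m = "\<lambda>r. (r / 2) *\<^sub>R (e + w) + (1 / (2 * r)) *\<^sub>R (e - w)"
  have xS: "q + R *\<^sub>R (?m r - n q) \<in> S" if "r > 0" for r
    by (intro hyperbolic_section_mem[OF q(2)] future_unit_null_combination e w that) (simp add: ae)
  have yS: "p + R' *\<^sub>R (?m r - n p) \<in> S" if "r > 0" for r
    by (intro hyperbolic_section_mem[OF p(2)] future_unit_null_combination e w that) (simp add: be)
  have nonneg: "lorentz (d + T *\<^sub>R (e + w)) (d + T *\<^sub>R (e + w)) \<ge> 0" for T
  proof -
    \<comment> \<open>Both sections are followed along the same hyperbola, with parameters
      \<open>r\<close> and \<open>r' r\<close> such that the growing terms differ by exactly
      \<open>T *\<^sub>R (e + w)\<close>. As \<open>R / R'\<close> is positive, \<open>r' r\<close>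
      tends to infinity as well.\<close>
    define r' where "r' r = (R / R') * r + 2 * T / R'" for r
    have "filterlim (\<lambda>r. 2 * T / R' + (R / R') * r) at_top at_top"
      by (intro filterlim_tendsto_add_at_top[OF tendsto_const]
          filterlim_tendsto_pos_mult_at_top[OF tendsto_const pos] filterlim_ident)
    then have r'_top: "filterlim r' at_top at_top"
      unfolding r'_def by (simp add: add.commute)
    define z where "z r = d + T *\<^sub>R (e + w) + (R' / 2 * (1 / r' r) - R / 2 * (1 / r)) *\<^sub>R (e - w)" for r
    have z: "z r = (p + R' *\<^sub>R (?m (r' r) - n p)) - (q + R *\<^sub>R (?m r - n q))" for r
    proof -
      have "R' * (r' r / 2) - R * (r / 2) = T" using R by (simp add: r'_def field_simps)
      then have "T *\<^sub>R (e + w) = (R' * (r' r / 2)) *\<^sub>R (e + w) - (R * (r / 2)) *\<^sub>R (e + w)"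
        by (metis scaleR_left_diff_distrib)
      moreover have "(R' / 2 * (1 / r' r) - R / 2 * (1 / r)) *\<^sub>R (e - w)
          = (R' * (1 / (2 * r' r))) *\<^sub>R (e - w) - (R * (1 / (2 * r))) *\<^sub>R (e - w)"
        by (simp add: scaleR_left_diff_distrib)
      ultimately have "z r = d + ((R' * (r' r / 2)) *\<^sub>R (e + w) - (R * (r / 2)) *\<^sub>R (e + w))
          + ((R' * (1 / (2 * r' r))) *\<^sub>R (e - w) - (R * (1 / (2 * r))) *\<^sub>R (e - w))"
        unfolding z_def by simp
      moreover have expand: "\<rho> *\<^sub>R (\<alpha> *\<^sub>R u + \<beta> *\<^sub>R v - \<nu>) = (\<rho> * \<alpha>) *\<^sub>R u + (\<rho> * \<beta>) *\<^sub>R v - \<rho> *\<^sub>R \<nu>"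
        for \<rho> \<alpha> \<beta> :: real and u v \<nu> :: "'m minkowski"
        by (simp add: scaleR_add_right scaleR_diff_right)
      ultimately show ?thesis unfolding d_def by (simp only: expand) (simp only: diff_conv_add_uminus minus_add_distrib minus_minus add_ac)
    qed
    have "\<forall>\<^sub>F r in at_top. r' r > 0" using r'_top by (simp add: filterlim_at_top_dense)
    then have "\<forall>\<^sub>F r in at_top. lorentz (z r) (z r) \<ge> 0"
      using eventually_gt_at_top[of 0]
    proof eventually_elim
      case (elim r)
      then show ?case unfolding z by (intro acausal_nonneg xS yS)
    qed
    moreover have "((\<lambda>r. lorentz (z r) (z r)) \<longlongrightarrow> lorentz (d + T *\<^sub>R (e + w)) (d + T *\<^sub>R (e + w))) at_top"
    proof -
      have inv: "((\<lambda>r::real. 1 / r) \<longlongrightarrow> 0) at_top"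
        by (rule tendsto_divide_0[OF tendsto_const filterlim_at_top_imp_at_infinity[OF filterlim_ident]])
      have inv': "((\<lambda>r. 1 / r' r) \<longlongrightarrow> 0) at_top"
        by (rule tendsto_divide_0[OF tendsto_const filterlim_at_top_imp_at_infinity[OF r'_top]])
      have "(z \<longlongrightarrow> d + T *\<^sub>R (e + w) + (R' / 2 * 0 - R / 2 * 0) *\<^sub>R (e - w)) at_top"
        unfolding z_def by (intro tendsto_intros inv inv')
      then show ?thesis by (intro tendsto_lorentz) simp_all
    qed
    ultimately show ?thesis by (intro tendsto_lowerbound) auto
  qed
  define c where "c = lorentz d (e + w)"
  have "lorentz (e + w) (e + w) = 0"
    using e w lorentz_commute[of w e] by (simp add: future_unit_def)
  then have quad: "lorentz d d + 2 * T * c \<ge> 0" for T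
    using nonneg[of T] lorentz_commute[of "e + w" d] unfolding c_def
    by (simp del: lorentz_algebra(1,2) add: lorentz_algebra(1)[of d] lorentz_algebra(2)[of _ d "T *\<^sub>R (e + w)"])
  \<comment> \<open>Since \<open>e + w\<close> is null, the bound is affine in \<open>T\<close>, and
    an affine function bounded below has slope zero.\<close>
  have "c = 0"
  proof (rule ccontr)
    assume "c \<noteq> 0"
    then have "lorentz d d + 2 * ((- 1 - lorentz d d) / (2 * c)) * c = - 1" by (simp add: field_simps)
    then show False using quad[of "(- 1 - lorentz d d) / (2 * c)"] by linarith
  qed
  then show "lorentz ((p - R' *\<^sub>R n p) - (q - R *\<^sub>R n q)) (e + w) = 0"
    unfolding c_def d_def .
qed (rule that)

end

section \<open>The radius at neighbouring points\<close>

lemma abs_fst_le_norm: "\<bar>fst z\<bar> \<le> norm z" for z :: "real \<times> 'a::real_normed_vector"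
  using norm_fst_le[of "fst z" "snd z"] by (simp only: prod.collapse real_norm_def)

lemma norm_le_fst_snd: "norm z \<le> norm (fst z) + norm (snd z)"
  using norm_Pair_le[of "fst z" "snd z"] by (simp only: prod.collapse)

context acausal_with_sections
begin

text \<open>The vectors orthogonal to \<open>m\<close> and \<open>a\<close> are, up to scaling,
  tangent to the section, so the normal lies in the plane of \<open>m\<close> and \<open>a\<close>;
  its coefficients there are a hyperbolic cosine and sine.\<close>

lemma section_normal:
  assumes sec: "hyperbolic_section S q (n q) R a" and q: "q \<in> S"
    and m: "future_unit m" "lorentz a m = 0"
  defines "p \<equiv> q + R *\<^sub>R (m - n q)"
  shows "n p = (- lorentz (n p) m) *\<^sub>R m + lorentz (n p) a *\<^sub>R a"
    and "(lorentz (n p) m)\<^sup>2 = 1 + (lorentz (n p) a)\<^sup>2" and "- lorentz (n p) m \<ge> 1"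
proof -
  have pS: "p \<in> S" unfolding p_def by (rule hyperbolic_section_mem[OF sec m])
  have R: "R \<noteq> 0" and a: "lorentz a a = 1" using sec by (auto simp: hyperbolic_section_def)
  have np: "future_unit (n p)" by (rule normal[OF pS])
  define c where "c = q - R *\<^sub>R n q"
  have pc: "p = c + R *\<^sub>R m" by (simp add: p_def c_def scaleR_diff_right)
  have sheet: "c + R *\<^sub>R m' \<in> S" if "future_unit m'" "lorentz a m' = 0" for m'
    using hyperbolic_section_mem[OF sec that] by (simp add: c_def scaleR_diff_right algebra_simps)
  have orth: "lorentz (n p) w = 0" if w: "lorentz m w = 0" "lorentz a w = 0" for w
  proof -
    obtain t where "t \<noteq> 0" "t *\<^sub>R w \<in> tangent_space S p"
      using hyperbola_tangent[of a c R S, OF sheet R m w] pc by blast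
    then show ?thesis using tangent[OF pS, of "t *\<^sub>R w"] by simp
  qed
  show eq: "n p = (- lorentz (n p) m) *\<^sub>R m + lorentz (n p) a *\<^sub>R a"
    by (rule orthogonal_complement_unit[OF m(1) orth a trans[OF lorentz_commute m(2)]])
  show "- lorentz (n p) m \<ge> 1" using future_unit_lorentz(1)[OF np m(1)] by simp
  define \<alpha> \<beta> where "\<alpha> = lorentz (n p) m" and "\<beta> = lorentz (n p) a"
  have eq': "n p = (- \<alpha>) *\<^sub>R m + \<beta> *\<^sub>R a" using eq unfolding \<alpha>_def \<beta>_def .
  have "lorentz (n p) (n p) = - (\<alpha> * \<alpha>) + \<beta> * \<beta>"
    unfolding eq' using m a lorentz_commute[of m a] by (simp add: future_unit_def)
  then show "\<alpha>\<^sup>2 = 1 + \<beta>\<^sup>2" using np by (simp add: future_unit_def power2_eq_square)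
qed

text \<open>At \<open>p = q\<close> this is Cauchy-Schwarz in the definite complement of
  \<open>n q\<close>: equality would force \<open>b\<close> to be a multiple of both
  \<open>a\<close> and \<open>a'\<close>. Near \<open>q\<close> the vector \<open>b\<close> is
  almost orthogonal to \<open>n q\<close>, and the equality case must be made quantitative.\<close>

lemma normal_direction_cases:
  assumes q: "q \<in> S" and a: "lorentz a a = 1" "lorentz (n q) a = 0"
    and a': "lorentz a' a' = 1" "lorentz (n q) a' = 0" and ne: "a \<noteq> a'" "a \<noteq> - a'"
  shows "\<exists>\<delta>>0. \<forall>p\<in>S. dist p q < \<delta> \<longrightarrow>
    (\<forall>b. lorentz b b = 1 \<longrightarrow> lorentz (n p) b = 0 \<longrightarrow> \<bar>lorentz a b\<bar> < 1 \<or> \<bar>lorentz a' b\<bar> < 1)"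
proof -
  have nq: "future_unit (n q)" using normal q by auto
  then have nn: "lorentz (n q) (n q) = -1" by (simp add: future_unit_def)
  define \<mu> where "\<mu> = min (lorentz (a - a') (a - a')) (lorentz (a + a') (a + a'))"
  have "lorentz (a - a') (a - a') > 0" "lorentz (a + a') (a + a') > 0"
  proof -
    have "lorentz (n q) (n q) < 0" "lorentz (n q) (a - a') = 0" "lorentz (n q) (a + a') = 0"
      "a - a' \<noteq> 0" "a + a' \<noteq> 0"
      using ne a a' nn eq_neg_iff_add_eq_0[of a a'] by simp_all
    then show "lorentz (a - a') (a - a') > 0" "lorentz (a + a') (a + a') > 0"
      using timelike_orthogonal_pos by blast+
  qed
  then have "\<mu> > 0" by (simp add: \<mu>_def)
  obtain C \<delta>0 where "C > 0" "\<delta>0 > 0" and C: "\<And>p. p \<in> S \<Longrightarrow> dist p q < \<delta>0 \<Longrightarrow> norm (n p - n q) \<le> C * dist p q"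
    using normal_lipschitz[OF q] by blast
  have fq: "fst (n q) > 0" using nq by (simp add: future_unit_def)
  \<comment> \<open>Keeps \<open>norm b * norm (n p - n q)\<close>, and with it
    \<open>\<bar>\<epsilon>\<bar>\<close>, below \<open>sqrt \<mu> / 2\<close>. The minimum with 1
    yields \<open>fst (n p) \<le> fst (n q) + 1\<close>, which bounds \<open>norm b\<close>.\<close>
  define \<kappa> where "\<kappa> = min 1 (sqrt \<mu> / 2 / (2 * (fst (n q) + 1)))"
  have "\<kappa> > 0" using \<open>\<mu> > 0\<close> fq by (simp add: \<kappa>_def)
  define \<delta> where "\<delta> = min \<delta>0 (\<kappa> / C)"
  have "\<delta> > 0" using \<open>\<delta>0 > 0\<close> \<open>\<kappa> > 0\<close> \<open>C > 0\<close> by (simp add: \<delta>_def)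
  moreover have "\<bar>lorentz a b\<bar> < 1 \<or> \<bar>lorentz a' b\<bar> < 1"
    if p: "p \<in> S" "dist p q < \<delta>" and b: "lorentz b b = 1" "lorentz (n p) b = 0" for p b
  proof (rule ccontr)
    assume not: "\<not> ?thesis"
    have "norm (n p - n q) \<le> C * dist p q" using C p by (simp add: \<delta>_def)
    also have "\<dots> < \<kappa>" using p \<open>C > 0\<close> by (simp add: \<delta>_def pos_less_divide_eq mult.commute)
    finally have close: "norm (n p - n q) < \<kappa>" .
    define \<epsilon> where "\<epsilon> = lorentz b (n q)"
    have "fst (n p) - fst (n q) \<le> norm (n p - n q)"
      using abs_fst_le_norm[of "n p - n q"] by simp
    then have fp: "fst (n p) \<le> fst (n q) + 1" using close by (simp add: \<kappa>_def)
    have nb: "norm b \<le> 2 * (fst (n q) + 1)"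
      using norm_unit_orthogonal_le[OF normal[OF p(1)] b] fp by simp
    have "\<epsilon> = lorentz b (n q - n p)" using b(2) lorentz_commute[of b "n p"] by (simp add: \<epsilon>_def)
    then have "\<bar>\<epsilon>\<bar> \<le> norm b * norm (n p - n q)"
      using abs_lorentz_le[of b "n q - n p"] by (simp add: norm_minus_commute)
    also have "\<dots> \<le> (2 * (fst (n q) + 1)) * norm (n p - n q)" using nb by (intro mult_right_mono) auto
    also have "\<dots> < (2 * (fst (n q) + 1)) * \<kappa>" using close fq by (intro mult_strict_left_mono) auto
    also have "\<dots> \<le> (2 * (fst (n q) + 1)) * (sqrt \<mu> / 2 / (2 * (fst (n q) + 1)))"
      using fq by (intro mult_left_mono) (auto simp: \<kappa>_def)
    also have "\<dots> = sqrt \<mu> / 2" using fq nonzero_mult_div_cancel_left[of "2 * (fst (n q) + 1)" "sqrt \<mu> / 2"] by simp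
    finally have "\<bar>\<epsilon>\<bar> < sqrt \<mu> / 2" .
    then have "\<bar>\<epsilon>\<bar>\<^sup>2 < (sqrt \<mu> / 2)\<^sup>2" by (intro power_strict_mono) auto
    then have eps: "4 * \<epsilon>\<^sup>2 < \<mu>" using \<open>\<mu> > 0\<close> by (simp add: power_divide)
    \<comment> \<open>The projection of \<open>b\<close> to the complement of \<open>n q\<close>. If
      both bounds fail, it has squared distance at most \<open>\<epsilon>\<^sup>2\<close> from a
      signed copy of \<open>a\<close> and of \<open>a'\<close>; the parallelogram identity then puts
      these closer together than \<mu> permits.\<close>
    define b' where "b' = b + \<epsilon> *\<^sub>R n q"
    have b'n: "lorentz (n q) b' = 0"
      using nn by (simp add: b'_def \<epsilon>_def lorentz_commute[of "n q" b])
    have b'b': "lorentz b' b' = 1 + \<epsilon>\<^sup>2"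
      using b(1) nn lorentz_commute[of "n q" b]
      by (simp add: b'_def \<epsilon>_def[symmetric] power2_eq_square)
    define s s' where "s = sgn (lorentz a b)" and "s' = sgn (lorentz a' b)"
    have ss: "s * lorentz a b = \<bar>lorentz a b\<bar>" "s' * lorentz a' b = \<bar>lorentz a' b\<bar>"
      by (simp_all add: s_def s'_def abs_sgn mult.commute)
    have s: "s = 1 \<or> s = -1" "s' = 1 \<or> s' = -1"
      using not by (auto simp: s_def s'_def sgn_real_def)
    have le: "lorentz (t *\<^sub>R x - b') (t *\<^sub>R x - b') \<le> \<epsilon>\<^sup>2"
      if "lorentz x x = 1" "lorentz (n q) x = 0" "t = 1 \<or> t = -1" "t * lorentz x b \<ge> 1" for x t
    proof -
      have "lorentz x b' = lorentz x b"
        using that(2) lorentz_commute[of x "n q"] by (simp add: b'_def)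
      then have "lorentz (t *\<^sub>R x - b') (t *\<^sub>R x - b') = t * t - 2 * (t * lorentz x b) + lorentz b' b'"
        using that(1) lorentz_commute[of b' x] by (simp add: right_diff_distrib)
      also have "\<dots> = 2 - 2 * (t * lorentz x b) + \<epsilon>\<^sup>2" using that(3) b'b' by auto
      finally show ?thesis using that(4) by linarith
    qed
    define u u' where "u = s *\<^sub>R a - b'" and "u' = s' *\<^sub>R a' - b'"
    have uu: "lorentz u u \<le> \<epsilon>\<^sup>2" "lorentz u' u' \<le> \<epsilon>\<^sup>2"
      unfolding u_def u'_def using le[OF a s(1)] le[OF a' s(2)] ss not by auto
    have "lorentz (n q) (u + u') = 0"
      using a a' b'n by (simp add: u_def u'_def)
    then have "lorentz (u + u') (u + u') \<ge> 0"
      using nn by (intro timelike_orthogonal_nonneg[of "n q"]) auto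
    moreover have "lorentz (u - u') (u - u') + lorentz (u + u') (u + u') = 2 * lorentz u u + 2 * lorentz u' u'"
      by simp
    ultimately have "lorentz (u - u') (u - u') \<le> 4 * \<epsilon>\<^sup>2" using uu by linarith
    moreover have "lorentz (u - u') (u - u') \<ge> \<mu>"
    proof -
      have "u - u' = s *\<^sub>R a - s' *\<^sub>R a'" by (simp add: u_def u'_def)
      then have "u - u' = a - a' \<or> u - u' = a + a' \<or> u - u' = - (a - a') \<or> u - u' = - (a + a')"
        using s by auto
      then have "lorentz (u - u') (u - u') = lorentz (a - a') (a - a') \<or>
          lorentz (u - u') (u - u') = lorentz (a + a') (a + a')"
        by (elim disjE) (simp_all only: lorentz_algebra minus_minus, simp_all)
      then show ?thesis
        unfolding \<mu>_def by (elim disjE) (simp_all only: min.cobounded1 min.cobounded2)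
    qed
    ultimately show False using eps by linarith
  qed
  ultimately show ?thesis by blast
qed

text \<open>
  The factor \<open>- lorentz (n p) m\<close> is the hyperbolic cosine of the angle between the normal at \<open>p\<close> and the hyperplane of
  the section, hence \<open>1\<close> to first order in the distance of \<open>p\<close> and \<open>q\<close>.
\<close>

lemma radius_along_section:
  assumes q: "q \<in> S" and sec: "hyperbolic_section S q (n q) R a" "hyperbolic_section S q (n q) R a'"
    and ne: "a \<noteq> a'" "a \<noteq> - a'"
  shows "\<exists>\<delta>>0. \<forall>m R' b. future_unit m \<longrightarrow> lorentz a m = 0 \<longrightarrow>
    (let p = q + R *\<^sub>R (m - n q) in dist p q < \<delta> \<longrightarrow> hyperbolic_section S p (n p) R' b \<longrightarrow>
      R = R' * (- lorentz (n p) m) \<or> R' = R * (- lorentz (n p) m))"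
proof -
  have a: "lorentz a a = 1" "lorentz (n q) a = 0" "lorentz a' a' = 1" "lorentz (n q) a' = 0"
    using sec by (auto simp: hyperbolic_section_def)
  obtain \<delta> where "\<delta> > 0" and \<delta>: "\<And>p b. p \<in> S \<Longrightarrow> dist p q < \<delta> \<Longrightarrow> lorentz b b = 1 \<Longrightarrow> lorentz (n p) b = 0 \<Longrightarrow>
      \<bar>lorentz a b\<bar> < 1 \<or> \<bar>lorentz a' b\<bar> < 1"
    using normal_direction_cases[OF q a ne] by blast
  have "R = R' * (- lorentz (n p) m) \<or> R' = R * (- lorentz (n p) m)"
    if m: "future_unit m" "lorentz a m = 0" and p: "p = q + R *\<^sub>R (m - n q)" "dist p q < \<delta>"
      and secp: "hyperbolic_section S p (n p) R' b" for m R' b p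
  proof -
    have pS: "p \<in> S" unfolding p(1) by (rule hyperbolic_section_mem[OF sec(1) m])
    define \<alpha> \<beta> where "\<alpha> = - lorentz (n p) m" and "\<beta> = lorentz (n p) a"
    have np: "n p = \<alpha> *\<^sub>R m + \<beta> *\<^sub>R a"
      using section_normal(1)[OF sec(1) q m] unfolding \<alpha>_def \<beta>_def p(1) .
    have am: "lorentz m a = 0" "lorentz m m = -1"
      using m by (auto simp: lorentz_commute[of m a] future_unit_def)
    define d where "d = (p - R' *\<^sub>R n p) - (q - R *\<^sub>R n q)"
    have d1: "d = R *\<^sub>R m - R' *\<^sub>R n p" by (simp add: d_def p(1) scaleR_diff_right)
    have d2: "d = (R - R' * \<alpha>) *\<^sub>R m - (R' * \<beta>) *\<^sub>R a"
      unfolding d1 np by (simp add: algebra_simps)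
    \<comment> \<open>By this and \<open>dn\<close>, the two alternatives to be shown say that
      \<open>d\<close> is orthogonal to \<open>m\<close> or to \<open>n p\<close>.\<close>
    have dm: "lorentz d m = R' * \<alpha> - R"
      unfolding d2 using am lorentz_commute[of a m] by simp
    have dn: "lorentz d (n p) = R' - R * \<alpha>"
      unfolding d1 \<alpha>_def using normal[OF pS] by (simp add: future_unit_def lorentz_commute[of m])
    \<comment> \<open>Here \<open>d\<close> lies in the plane of \<open>m\<close> and
      \<open>a\<close> and in that of \<open>a\<close> and \<open>c\<close>. If it is not a multiple
      of \<open>a\<close>, then \<open>c\<close> lies in the Lorentzian plane of \<open>m\<close>
      and \<open>a\<close>, where a unit vector has
      \<open>\<bar>lorentz a c\<bar> \<ge> 1\<close>.\<close>
    have case1: "R = R' * \<alpha>" if ab: "\<bar>lorentz a c\<bar> < 1" and c: "hyperbolic_section S p (n p) R' c" for c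
    proof -
      obtain x y where xy: "d = x *\<^sub>R a + y *\<^sub>R c"
        using centre_difference[OF q sec(1) pS c ab] unfolding d_def by blast
      show ?thesis
      proof (cases "y = 0")
        case True
        then have "lorentz d m = 0" unfolding xy using am lorentz_commute[of a m] by simp
        then show ?thesis using dm by simp
      next
        case False
        define l k where "l = (R - R' * \<alpha>) / y" and "k = (- (R' * \<beta>) - x) / y"
        have "y *\<^sub>R c = d - x *\<^sub>R a" using xy by simp
        also have "\<dots> = (R - R' * \<alpha>) *\<^sub>R m + (- (R' * \<beta>) - x) *\<^sub>R a"
          unfolding d2 by (simp add: algebra_simps)
        also have "\<dots> = y *\<^sub>R (l *\<^sub>R m + k *\<^sub>R a)" using False by (simp add: l_def k_def scaleR_add_right)
        finally have ceq: "c = l *\<^sub>R m + k *\<^sub>R a" using False by simp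
        have "lorentz a c = k" unfolding ceq using a am lorentz_commute[of a m] by simp
        moreover have "lorentz c c = k * k - l * l"
          unfolding ceq using a am lorentz_commute[of a m] by simp
        moreover have "lorentz c c = 1" using c by (simp add: hyperbolic_section_def)
        ultimately have "k * k = 1 + l * l" "\<bar>k\<bar> < 1" using ab by simp_all
        then have "k\<^sup>2 \<ge> 1" "\<bar>k\<bar> < 1" using zero_le_square[of l] by (simp_all add: power2_eq_square)
        then show ?thesis using abs_square_less_1[of k] by linarith
      qed
    qed
    have unit: "lorentz c c = 1" "lorentz (n p) c = 0" if "hyperbolic_section S p (n p) X c" for c X
      using that by (auto simp: hyperbolic_section_def)
    obtain R1 b1 R2 b2 where b: "b1 \<noteq> b2" "b1 \<noteq> - b2"
      and b1': "hyperbolic_section S p (n p) R1 b1" and b2': "hyperbolic_section S p (n p) R2 b2"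
      using two_sections[OF pS] by blast
    have "R1 = R'" "R2 = R'" using section_radius_unique pS secp b1' b2' by blast+
    then have b1: "hyperbolic_section S p (n p) R' b1" and b2: "hyperbolic_section S p (n p) R' b2"
      using b1' b2' by auto
    have "R = R' * \<alpha> \<or> R' = R * \<alpha>"
    proof (cases "\<bar>lorentz a b1\<bar> < 1 \<or> \<bar>lorentz a b2\<bar> < 1")
      case True
      then show ?thesis using case1 b1 b2 by blast
    next
      case False
      \<comment> \<open>Neither section at \<open>p\<close> can be compared with \<open>a\<close>,
        so both are compared with \<open>a'\<close>. The product with \<open>n p\<close> annihilates
        \<open>b1\<close> and \<open>b2\<close>: either it vanishes on \<open>d\<close>, or the
        coefficients of \<open>a'\<close> agree and \<open>d\<close> is a multiple of
        \<open>a'\<close>, hence orthogonal to \<open>n q\<close>.\<close>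
      then have ab: "\<bar>lorentz a' b1\<bar> < 1" "\<bar>lorentz a' b2\<bar> < 1"
        using \<delta>[OF pS p(2) unit[OF b1]] \<delta>[OF pS p(2) unit[OF b2]] by auto
      obtain x1 y1 where d3: "d = x1 *\<^sub>R a' + y1 *\<^sub>R b1"
        using centre_difference[OF q sec(2) pS b1 ab(1)] unfolding d_def by blast
      obtain x2 y2 where d4: "d = x2 *\<^sub>R a' + y2 *\<^sub>R b2"
        using centre_difference[OF q sec(2) pS b2 ab(2)] unfolding d_def by blast
      have e1: "lorentz d (n p) = x1 * lorentz a' (n p)"
        unfolding d3 using unit[OF b1] lorentz_commute[of b1 "n p"] by simp
      have e2: "lorentz d (n p) = x2 * lorentz a' (n p)"
        unfolding d4 using unit[OF b2] lorentz_commute[of b2 "n p"] by simp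
      show ?thesis
      proof (cases "lorentz d (n p) = 0")
        case True
        then show ?thesis using dn by simp
      next
        case False
        then have "x1 = x2" using e1 e2 by auto
        then have "y1 *\<^sub>R b1 = y2 *\<^sub>R b2" using d3 d4 by simp
        then have "y1 = 0" using unit_parallel[OF unit(1)[OF b1] unit(1)[OF b2] _ b] by blast
        then have "lorentz d (n q) = 0" unfolding d3 using a lorentz_commute[of a' "n q"] by simp
        moreover have "lorentz d (n q) = (R - R' * \<alpha>) * lorentz m (n q)"
          unfolding d2 using a lorentz_commute[of a "n q"] by simp
        moreover have "lorentz m (n q) \<noteq> 0"
          using future_unit_lorentz(1)[OF m(1) normal[OF q]] by simp
        ultimately show ?thesis by simp
      qed
    qed
    then show ?thesis by (simp add: \<alpha>_def)
  qed
  then show ?thesis using \<open>\<delta> > 0\<close> unfolding Let_def by blast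
qed

text \<open>
  Add a small multiple of the squared distance to \<open>x\<^sub>0\<close> and minimise. Along both sections through
  the minimiser the given function is flat to first order, so that the minimiser can only be \<open>x\<^sub>0\<close>.
\<close>

lemma constant_if_flat_along_sections:
  fixes f :: "'m minkowski \<Rightarrow> real"
  assumes nonneg: "\<And>p. p \<in> S \<Longrightarrow> f p \<ge> 0"
    and lsc: "\<And>p q \<phi>. (\<And>k. p k \<in> S) \<Longrightarrow> q \<in> S \<Longrightarrow> p \<longlonglongrightarrow> q \<Longrightarrow> (\<lambda>k. f (p k)) \<longlonglongrightarrow> \<phi> \<Longrightarrow> f q \<le> \<phi>"
    and flat: "\<And>q R a a'. q \<in> S \<Longrightarrow> hyperbolic_section S q (n q) R a \<Longrightarrow> hyperbolic_section S q (n q) R a' \<Longrightarrow>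
      a \<noteq> a' \<Longrightarrow> a \<noteq> - a' \<Longrightarrow> \<exists>K. \<exists>\<delta>>0. \<forall>m. future_unit m \<longrightarrow> lorentz a m = 0 \<longrightarrow>
      (let p = q + R *\<^sub>R (m - n q) in dist p q < \<delta> \<longrightarrow> f p \<le> f q + K * (dist p q)\<^sup>2)"
    and x0: "x0 \<in> S" and p0: "p0 \<in> S"
  shows "f x0 \<le> f p0"
proof -
  have snd_less: "\<bar>fst x - fst y\<bar> < norm (snd x - snd y)" if "x \<in> S" "y \<in> S" "x \<noteq> y" for x y
    using acausal[OF that] by (simp add: lorentz_pos_iff del: lorentz_algebra)
  have main: "f x0 \<le> f p + l * (norm (snd p - snd x0))\<^sup>2" if l: "l > 0" and pS: "p \<in> S" for l p
  proof -
    define F where "F p = f p + l * (norm (snd p - snd x0))\<^sup>2" for p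
    have F0: "F p \<ge> 0" if "p \<in> S" for p using nonneg[OF that] l by (simp add: F_def)
    define I where "I = Inf (F ` S)"
    have bdd: "bdd_below (F ` S)" using F0 by (intro bdd_belowI[of _ 0]) auto
    have I_le: "I \<le> F p" if "p \<in> S" for p unfolding I_def using that bdd by (intro cInf_lower) auto
    have "\<exists>p\<in>S. F p < I + 1 / real (Suc k)" for k
    proof -
      have "Inf (F ` S) < I + 1 / real (Suc k)" by (simp add: I_def)
      then show ?thesis using cInf_lessD[of "F ` S"] x0 by blast
    qed
    then obtain x where x: "\<And>k. x k \<in> S" "\<And>k. F (x k) < I + 1 / real (Suc k)" by metis
    \<comment> \<open>Nonnegativity of \<open>f\<close> bounds the spatial distance of almost
      minimal points from \<open>x0\<close>, and acausality bounds the time difference by the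
      spatial one.\<close>
    define M where "M = sqrt ((I + 1) / l)"
    have sndM: "norm (snd (x k) - snd x0) \<le> M" for k
    proof -
      have "1 / real (Suc k) \<le> 1" by simp
      then have "l * (norm (snd (x k) - snd x0))\<^sup>2 \<le> I + 1"
        using x[of k] nonneg[OF x(1)[of k]] unfolding F_def by linarith
      then have "(norm (snd (x k) - snd x0))\<^sup>2 \<le> (I + 1) / l" using l by (simp add: field_simps)
      then show ?thesis unfolding M_def by (rule real_le_rsqrt)
    qed
    have "dist x0 (x k) \<le> 2 * M" for k
    proof -
      have "\<bar>fst (x k) - fst x0\<bar> \<le> norm (snd (x k) - snd x0)"
        using snd_less[OF x(1)[of k] x0] by (cases "x k = x0") auto
      moreover have "norm (x k - x0) \<le> norm (fst (x k - x0)) + norm (snd (x k - x0))"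
        by (rule norm_le_fst_snd)
      ultimately show ?thesis using sndM[of k] by (simp add: dist_norm norm_minus_commute)
    qed
    then have "bounded (range x)" unfolding bounded_def by blast
    then obtain q r where r: "strict_mono r" and xq: "(x \<circ> r) \<longlonglongrightarrow> q"
      using bounded_imp_convergent_subsequence by blast
    have xq': "(\<lambda>k. x (r k)) \<longlonglongrightarrow> q" using xq by (simp add: o_def)
    have qS: "q \<in> S" using closed_sequentially[OF closed _ xq'] x(1) by blast
    \<comment> \<open>Convergence of \<open>F\<close> along the minimising sequence also makes
      \<open>f\<close> converge along the subsequence, as \<open>lsc\<close> requires.\<close>
    have FI: "(\<lambda>k. F (x k)) \<longlonglongrightarrow> I"
    proof (rule tendsto_sandwich)
      show "\<forall>\<^sub>F k in sequentially. I \<le> F (x k)" using I_le x(1) by simp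
      show "\<forall>\<^sub>F k in sequentially. F (x k) \<le> I + 1 / real (Suc k)" using x(2) by (simp add: less_imp_le)
      show "(\<lambda>k. I + 1 / real (Suc k)) \<longlonglongrightarrow> I"
        using tendsto_add[OF tendsto_const LIMSEQ_inverse_real_of_nat] by (simp add: inverse_eq_divide)
    qed simp
    then have "(\<lambda>k. F (x (r k))) \<longlonglongrightarrow> I" using LIMSEQ_subseq_LIMSEQ[OF FI r] by (simp add: o_def)
    then have "(\<lambda>k. F (x (r k)) - l * (norm (snd (x (r k)) - snd x0))\<^sup>2) \<longlonglongrightarrow> I - l * (norm (snd q - snd x0))\<^sup>2"
      by (intro tendsto_intros xq')
    then have "(\<lambda>k. f (x (r k))) \<longlonglongrightarrow> I - l * (norm (snd q - snd x0))\<^sup>2" by (simp add: F_def)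
    then have "f q \<le> I - l * (norm (snd q - snd x0))\<^sup>2" 
      by (intro lsc[OF _ qS xq'] x(1))
    then have min: "F q \<le> F p" if "p \<in> S" for p using I_le[OF that] by (simp add: F_def)
    have nq: "future_unit (n q)" by (rule normal[OF qS])
    define z where "z = snd q - snd x0"
    have orth: "z \<bullet> snd w = 0"
      if sec: "hyperbolic_section S q (n q) R a" "hyperbolic_section S q (n q) R a'" "a \<noteq> a'" "a \<noteq> - a'"
        and w: "lorentz (n q) w = 0" "lorentz a w = 0" for R a a' w
    proof (cases "w = 0")
      case False
      have "lorentz w w > 0"
        using nq w(1) False by (intro timelike_orthogonal_pos[of "n q"]) (auto simp: future_unit_def)
      define c where "c = 1 / sqrt (lorentz w w)"
      have c: "c \<noteq> 0" using \<open>lorentz w w > 0\<close> by (simp add: c_def)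
      define v where "v = c *\<^sub>R w"
      have v: "lorentz v v = 1" "lorentz (n q) v = 0" "lorentz a v = 0"
        using \<open>lorentz w w > 0\<close> w by (simp_all add: v_def c_def)
      have R: "R \<noteq> 0" and na: "lorentz a (n q) = 0"
        using sec(1) lorentz_commute[of a "n q"] by (auto simp: hyperbolic_section_def)
      obtain K \<delta> where "\<delta> > 0" and K: "\<And>m. future_unit m \<Longrightarrow> lorentz a m = 0 \<Longrightarrow>
          dist (q + R *\<^sub>R (m - n q)) q < \<delta> \<Longrightarrow> f (q + R *\<^sub>R (m - n q)) \<le> f q + K * (dist (q + R *\<^sub>R (m - n q)) q)\<^sup>2"
        using flat[OF qS sec] unfolding Let_def by blast
      define \<gamma> where "\<gamma> y = q + R *\<^sub>R (sqrt (1 + y\<^sup>2) *\<^sub>R n q + y *\<^sub>R v - n q)" for y :: real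
      have fu: "future_unit (sqrt (1 + y\<^sup>2) *\<^sub>R n q + y *\<^sub>R v)" "lorentz a (sqrt (1 + y\<^sup>2) *\<^sub>R n q + y *\<^sub>R v) = 0" for y
        using future_unit_hyperbola[OF nq v(1,2)] na v(3) by simp_all
      have \<gamma>S: "\<gamma> y \<in> S" for y unfolding \<gamma>_def by (intro hyperbolic_section_mem[OF sec(1)] fu)
      have \<gamma>0: "\<gamma> 0 = q" by (simp add: \<gamma>_def)
      have der: "(\<gamma> has_derivative (\<lambda>h. h *\<^sub>R (R *\<^sub>R v))) (at 0)"
        using hyperbola_has_vector_derivative unfolding \<gamma>_def has_vector_derivative_def .
      \<comment> \<open>Near 0, \<open>f q + G\<close> is an upper bound for \<open>F\<close> on the
        hyperbola, attained at 0, so minimality of \<open>q\<close> makes 0 a local minimum of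
        \<open>G\<close>. The term with \<open>K\<close> has derivative zero there.\<close>
      define G where "G y = l * ((snd (\<gamma> y) - snd x0) \<bullet> (snd (\<gamma> y) - snd x0)) + K * ((\<gamma> y - q) \<bullet> (\<gamma> y - q))" for y
      have derG: "(G has_real_derivative 2 * l * R * (z \<bullet> snd v)) (at 0)"
      proof -
        have "(G has_derivative (\<lambda>h. l * ((snd (\<gamma> 0) - snd x0) \<bullet> snd (h *\<^sub>R (R *\<^sub>R v)) + snd (h *\<^sub>R (R *\<^sub>R v)) \<bullet> (snd (\<gamma> 0) - snd x0))
            + K * ((\<gamma> 0 - q) \<bullet> (h *\<^sub>R (R *\<^sub>R v)) + (h *\<^sub>R (R *\<^sub>R v)) \<bullet> (\<gamma> 0 - q)))) (at 0)"
          unfolding G_def by (auto intro!: derivative_eq_intros der)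
        then show ?thesis
          unfolding has_field_derivative_def
          by (rule has_derivative_eq_rhs) (auto simp: fun_eq_iff \<gamma>0 z_def inner_commute algebra_simps)
      qed
      have "isCont \<gamma> 0" using der by (rule has_derivative_continuous)
      then have "\<forall>\<^sub>F y in at 0. dist (\<gamma> y) q < \<delta>"
        using \<open>\<delta> > 0\<close> \<gamma>0 unfolding isCont_def by (auto dest: tendstoD)
      then obtain d where "d > 0" and d: "\<And>y. y \<noteq> 0 \<Longrightarrow> dist y 0 < d \<Longrightarrow> dist (\<gamma> y) q < \<delta>"
        unfolding eventually_at by auto
      have "2 * l * R * (z \<bullet> snd v) = 0"
      proof (rule DERIV_local_min[OF derG \<open>d > 0\<close>], intro allI impI)
        fix y :: real assume y: "\<bar>0 - y\<bar> < d"
        have "dist (\<gamma> y) q < \<delta>" using d[of y] y \<gamma>0 \<open>\<delta> > 0\<close> by (cases "y = 0") (auto simp: dist_real_def)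
        then have "f (\<gamma> y) \<le> f q + K * (dist (\<gamma> y) q)\<^sup>2"
          unfolding \<gamma>_def by (intro K fu)
        moreover have "F q \<le> F (\<gamma> y)" by (rule min[OF \<gamma>S])
        ultimately show "G 0 \<le> G y"
          by (simp add: G_def F_def \<gamma>0 dist_norm power2_norm_eq_inner)
      qed
      then show ?thesis using l R c by (simp add: v_def)
    qed simp
    obtain R a R' a' where ne: "a \<noteq> a'" "a \<noteq> - a'"
      and sec: "hyperbolic_section S q (n q) R a" and sec'': "hyperbolic_section S q (n q) R' a'"
      using two_sections[OF qS] by blast
    have "R' = R" by (rule section_radius_unique[OF qS sec'' sec])
    then have sec': "hyperbolic_section S q (n q) R a'" using sec'' by simp
    have a: "lorentz a a = 1" "lorentz (n q) a = 0" "lorentz a' a' = 1" "lorentz (n q) a' = 0"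
      using sec sec' by (auto simp: hyperbolic_section_def)
    \<comment> \<open>Being orthogonal to the tangent vectors of both sections, \<open>Z\<close>
      lies in the plane of \<open>n q\<close> and \<open>a\<close> and in that of \<open>n q\<close>
      and \<open>a'\<close>, hence on the line of \<open>n q\<close>. Only 0 on that line has no
      time component.\<close>
    define Z :: "'m minkowski" where "Z = (0, z)"
    have Zw: "lorentz Z w = z \<bullet> snd w" for w by (simp add: Z_def lorentz_def)
    have "Z = (- lorentz Z (n q)) *\<^sub>R n q + lorentz Z a *\<^sub>R a"
      by (rule orthogonal_complement_unit[OF nq _ a(1,2)]) (use orth[OF sec sec' ne] Zw in auto)
    moreover have "Z = (- lorentz Z (n q)) *\<^sub>R n q + lorentz Z a' *\<^sub>R a'"
    proof (rule orthogonal_complement_unit[OF nq _ a(3,4)])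
      have "a' \<noteq> a" "a' \<noteq> - a" using ne by auto
      then show "lorentz Z w = 0" if "lorentz (n q) w = 0" "lorentz a' w = 0" for w
        using orth[OF sec' sec _ _ that] Zw by simp
    qed
    ultimately have "lorentz Z a *\<^sub>R a = lorentz Z a' *\<^sub>R a'" by (metis add_left_cancel)
    then have "lorentz Z a = 0" by (rule unit_parallel[OF a(1,3) _ ne])
    with \<open>Z = (- lorentz Z (n q)) *\<^sub>R n q + lorentz Z a *\<^sub>R a\<close>
    have Zn: "Z = (- lorentz Z (n q)) *\<^sub>R n q" by (metis add.right_neutral scaleR_zero_left)
    have "fst Z = - lorentz Z (n q) * fst (n q)" by (subst Zn) simp
    then have "lorentz Z (n q) = 0" using nq by (simp add: Z_def future_unit_def)
    then have "Z = 0" using Zn by (metis minus_zero scaleR_zero_left)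
    then have "snd q = snd x0" by (simp add: Z_def z_def zero_prod_def)
    then have "q = x0" using snd_less[OF qS x0] by force
    then show ?thesis using min[OF pS] by (simp add: F_def)
  qed
  \<comment> \<open>The weight \<open>l\<close> of the penalty can now tend to 0, with
    \<open>x0\<close> and \<open>p0\<close> fixed.\<close>
  define N where "N = (norm (snd p0 - snd x0))\<^sup>2"
  have "f x0 \<le> f p0 + e" if "e > 0" for e
  proof -
    have "N \<ge> 0" by (simp add: N_def)
    have "f x0 \<le> f p0 + e / (N + 1) * N"
    proof -
      have "e / (N + 1) > 0" using that \<open>N \<ge> 0\<close> by (intro divide_pos_pos) auto
      then show ?thesis unfolding N_def by (rule main[OF _ p0])
    qed
    also have "e / (N + 1) * N \<le> e" using \<open>N \<ge> 0\<close> that by (simp add: field_simps)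
    finally show ?thesis by simp
  qed
  then show ?thesis by (rule field_le_epsilon)
qed

section \<open>Constancy of the radius and of the centre\<close>

definition radius :: "'m minkowski \<Rightarrow> real"
  where "radius q = (SOME R. \<exists>a. hyperbolic_section S q (n q) R a)"

lemma section_imp_radius:
  assumes "q \<in> S" "hyperbolic_section S q (n q) R a"
  shows "R = radius q"
proof -
  have "\<exists>a. hyperbolic_section S q (n q) (radius q) a"
    unfolding radius_def by (rule someI[of _ R]) (use assms in blast)
  then show ?thesis using section_radius_unique assms by blast
qed

lemma radius_section:
  assumes "q \<in> S"
  shows "\<exists>a. hyperbolic_section S q (n q) (radius q) a"
  using two_sections[OF assms] section_imp_radius[OF assms] by metis

text \<open>Semicontinuity comes from \<open>section_radius_closed\<close>, with the sign fixed by
  \<open>section_same_sign\<close>; flatness from \<open>radius_along_section\<close>, whose factor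
  differs from 1 only in second order.\<close>

lemma abs_radius_constant:
  assumes "q \<in> S" "p \<in> S"
  shows "\<bar>radius q\<bar> \<le> \<bar>radius p\<bar>"
proof (rule constant_if_flat_along_sections[of "\<lambda>q. \<bar>radius q\<bar>", OF _ _ _ assms])
  fix x :: "nat \<Rightarrow> 'm minkowski" and y \<phi>
  assume x: "\<And>k. x k \<in> S" and y: "y \<in> S" and lim: "x \<longlonglongrightarrow> y" "(\<lambda>k. \<bar>radius (x k)\<bar>) \<longlonglongrightarrow> \<phi>"
  obtain a where a: "hyperbolic_section S y (n y) (radius y) a" using radius_section[OF y] by blast
  have "\<exists>b. hyperbolic_section S (x k) (n (x k)) (radius (x k)) b" for k by (rule radius_section[OF x])
  then obtain b where b: "\<And>k. hyperbolic_section S (x k) (n (x k)) (radius (x k)) (b k)" by metis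
  have sg: "sgn (radius (x k)) = sgn (radius y)" for k
    using section_same_sign[OF y a x b, of k] by (auto simp: zero_less_mult_iff)
  have "(\<lambda>k. sgn (radius y) * \<bar>radius (x k)\<bar>) \<longlonglongrightarrow> sgn (radius y) * \<phi>" by (intro tendsto_intros lim)
  moreover have "sgn (radius y) * \<bar>radius (x k)\<bar> = radius (x k)" for k
    unfolding sg[of k, symmetric] by (rule sgn_mult_abs)
  ultimately have "(\<lambda>k. radius (x k)) \<longlonglongrightarrow> sgn (radius y) * \<phi>"
    by (simp only:)
  then have "sgn (radius y) * \<phi> = radius y"
    using section_radius_closed[OF x b lim(1) _ y a] by blast
  moreover have "\<phi> \<ge> 0" using lim(2) by (rule LIMSEQ_le_const) auto
  ultimately show "\<bar>radius y\<bar> \<le> \<phi>"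
    by (metis abs_mult abs_of_nonneg abs_sgn_eq mult_cancel_right1 mult_zero_left order_refl)
next
  fix y R a a'
  assume y: "y \<in> S" and sec: "hyperbolic_section S y (n y) R a" "hyperbolic_section S y (n y) R a'"
    and ne: "a \<noteq> a'" "a \<noteq> - a'"
  have R: "R = radius y" by (rule section_imp_radius[OF y sec(1)])
  obtain \<delta> where "\<delta> > 0" and \<delta>: "\<And>m R' b. future_unit m \<Longrightarrow> lorentz a m = 0 \<Longrightarrow>
      dist (y + R *\<^sub>R (m - n y)) y < \<delta> \<Longrightarrow>
      hyperbolic_section S (y + R *\<^sub>R (m - n y)) (n (y + R *\<^sub>R (m - n y))) R' b \<Longrightarrow>
      R = R' * (- lorentz (n (y + R *\<^sub>R (m - n y))) m) \<or> R' = R * (- lorentz (n (y + R *\<^sub>R (m - n y))) m)"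
    using radius_along_section[OF y sec ne] unfolding Let_def by blast
  obtain C \<delta>' where "C > 0" "\<delta>' > 0" and C: "\<And>p. p \<in> S \<Longrightarrow> dist p y < \<delta>' \<Longrightarrow> norm (n p - n y) \<le> C * dist p y"
    using normal_lipschitz[OF y] by blast
  \<comment> \<open>As \<open>n y\<close> is orthogonal to \<open>a\<close>, the hyperbolic sine
    \<beta> is the product of \<open>n p - n y\<close> with \<open>a\<close>, hence at most
    \<open>C * norm a\<close> times the distance.\<close>
  define K where "K = \<bar>R\<bar> * (C * norm a)\<^sup>2"
  have "\<bar>radius p\<bar> \<le> \<bar>radius y\<bar> + K * (dist p y)\<^sup>2"
    if m: "future_unit m" "lorentz a m = 0" and p: "p = y + R *\<^sub>R (m - n y)" "dist p y < min \<delta> \<delta>'" for m p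
  proof -
    have pS: "p \<in> S" unfolding p(1) by (rule hyperbolic_section_mem[OF sec(1) m])
    obtain b where b: "hyperbolic_section S p (n p) (radius p) b" using radius_section[OF pS] by blast
    define \<alpha> \<beta> where "\<alpha> = - lorentz (n p) m" and "\<beta> = lorentz (n p) a"
    have \<alpha>: "\<alpha> \<ge> 1" "\<alpha>\<^sup>2 = 1 + \<beta>\<^sup>2"
      using section_normal(2,3)[OF sec(1) y m] by (simp_all add: \<alpha>_def \<beta>_def p(1))
    have "\<beta> = lorentz (n p - n y) a" using sec(1) by (simp add: \<beta>_def hyperbolic_section_def)
    then have "\<bar>\<beta>\<bar> \<le> norm (n p - n y) * norm a" by (simp only: abs_lorentz_le)
    also have "\<dots> \<le> (C * dist p y) * norm a" using C[OF pS] p(2) by (intro mult_right_mono) auto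
    finally have "\<bar>\<beta>\<bar>\<^sup>2 \<le> ((C * norm a) * dist p y)\<^sup>2" by (intro power_mono) (auto simp: mult_ac)
    then have \<beta>: "\<beta>\<^sup>2 \<le> (C * norm a)\<^sup>2 * (dist p y)\<^sup>2" by (simp add: power_mult_distrib)
    have "R = radius p * \<alpha> \<or> radius p = R * \<alpha>"
      using \<delta>[OF m, of "radius p" b] b p unfolding \<alpha>_def by auto
    \<comment> \<open>A common bound for both alternatives: in the first one the radius does not
      grow, and in the second \<alpha> is at most its square.\<close>
    then have "\<bar>radius p\<bar> \<le> \<bar>R\<bar> * \<alpha>\<^sup>2"
    proof
      assume "R = radius p * \<alpha>"
      then have "\<bar>R\<bar> * \<alpha>\<^sup>2 = \<bar>radius p\<bar> * (\<alpha> * \<alpha>\<^sup>2)" using \<alpha>(1) by (simp add: abs_mult)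
      moreover have ge: "\<alpha> * \<alpha>\<^sup>2 \<ge> 1" using \<alpha>(1) by (metis mult_ge1_I one_le_power)
      moreover have "\<bar>radius p\<bar> * 1 \<le> \<bar>radius p\<bar> * (\<alpha> * \<alpha>\<^sup>2)" by (rule mult_left_mono[OF ge]) simp
      ultimately show ?thesis by (simp only: mult_1_right)
    next
      assume "radius p = R * \<alpha>"
      then have "\<bar>radius p\<bar> = \<bar>R\<bar> * \<alpha>" using \<alpha>(1) by (simp add: abs_mult)
      also have "\<dots> \<le> \<bar>R\<bar> * \<alpha>\<^sup>2" using \<alpha>(1) by (intro mult_left_mono) (auto simp: power2_eq_square)
      finally show ?thesis .
    qed
    also have "\<dots> = \<bar>R\<bar> + \<bar>R\<bar> * \<beta>\<^sup>2" by (simp add: \<alpha>(2) distrib_left)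
    also have "\<dots> \<le> \<bar>R\<bar> + \<bar>R\<bar> * ((C * norm a)\<^sup>2 * (dist p y)\<^sup>2)"
      using \<beta> by (intro add_left_mono mult_left_mono) auto
    finally show ?thesis by (simp add: K_def R mult.assoc)
  qed
  then show "\<exists>K. \<exists>\<delta>>0. \<forall>m. future_unit m \<longrightarrow> lorentz a m = 0 \<longrightarrow>
      (let p = y + R *\<^sub>R (m - n y) in dist p y < \<delta> \<longrightarrow> \<bar>radius p\<bar> \<le> \<bar>radius y\<bar> + K * (dist p y)\<^sup>2)"
    using \<open>\<delta> > 0\<close> \<open>\<delta>' > 0\<close> unfolding Let_def by (intro exI[of _ K] exI[of _ "min \<delta> \<delta>'"]) auto
qed simp

lemma radius_constant:
  assumes "q \<in> S" "p \<in> S"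
  shows "radius p = radius q"
proof -
  obtain a b where "hyperbolic_section S q (n q) (radius q) a" "hyperbolic_section S p (n p) (radius p) b"
    using radius_section assms by blast
  then have "radius q * radius p > 0" using section_same_sign assms by blast
  moreover have "\<bar>radius p\<bar> = \<bar>radius q\<bar>"
    using abs_radius_constant[OF assms] abs_radius_constant[OF assms(2,1)] by simp
  ultimately show ?thesis by (auto simp: abs_if zero_less_mult_iff split: if_splits)
qed

text \<open>With equal radii both alternatives of \<open>radius_along_section\<close> give
  \<open>lorentz (n p) m = -1\<close>, so \<open>n p = m\<close> and the centre does not move along
  the sections near the base point. The minimum principle, applied to the distance from
  \<open>c q\<close>, bounds its value at \<open>p\<close> by its value 0 at
  \<open>q\<close>.\<close>

lemma centre_constant:
  assumes q: "q \<in> S" and p: "p \<in> S"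
  shows "p - radius q *\<^sub>R n p = q - radius q *\<^sub>R n q"
proof -
  define \<rho> where "\<rho> = radius q"
  have \<rho>: "radius x = \<rho>" if "x \<in> S" for x unfolding \<rho>_def by (rule radius_constant[OF q that])
  define c where "c x = x - \<rho> *\<^sub>R n x" for x
  have "norm (c p - c q) \<le> norm (c q - c q)"
  proof (rule constant_if_flat_along_sections[of "\<lambda>x. norm (c x - c q)", OF _ _ _ p q])
    fix x :: "nat \<Rightarrow> 'm minkowski" and y \<phi>
    assume x: "\<And>k. x k \<in> S" and y: "y \<in> S" and lim: "x \<longlonglongrightarrow> y" "(\<lambda>k. norm (c (x k) - c q)) \<longlonglongrightarrow> \<phi>"
    have "(\<lambda>k. norm (c (x k) - c q)) \<longlonglongrightarrow> norm (c y - c q)"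
      unfolding c_def by (intro tendsto_intros lim normal_tendsto x y)
    then show "norm (c y - c q) \<le> \<phi>" using lim(2) LIMSEQ_unique by fastforce
  next
    fix y R a a'
    assume y: "y \<in> S" and sec: "hyperbolic_section S y (n y) R a" "hyperbolic_section S y (n y) R a'"
      and ne: "a \<noteq> a'" "a \<noteq> - a'"
    have R: "R = \<rho>" using section_imp_radius[OF y sec(1)] \<rho>[OF y] by simp
    have R0: "R \<noteq> 0" using sec by (simp add: hyperbolic_section_def)
    obtain \<delta> where "\<delta> > 0" and \<delta>: "\<And>m R' b. future_unit m \<Longrightarrow> lorentz a m = 0 \<Longrightarrow>
        dist (y + R *\<^sub>R (m - n y)) y < \<delta> \<Longrightarrow>
        hyperbolic_section S (y + R *\<^sub>R (m - n y)) (n (y + R *\<^sub>R (m - n y))) R' b \<Longrightarrow>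
        R = R' * (- lorentz (n (y + R *\<^sub>R (m - n y))) m) \<or> R' = R * (- lorentz (n (y + R *\<^sub>R (m - n y))) m)"
      using radius_along_section[OF y sec ne] unfolding Let_def by blast
    have "c p = c y"
      if m: "future_unit m" "lorentz a m = 0" and p: "p = y + R *\<^sub>R (m - n y)" "dist p y < \<delta>" for m p
    proof -
      have pS: "p \<in> S" unfolding p(1) by (rule hyperbolic_section_mem[OF sec(1) m])
      obtain b where b: "hyperbolic_section S p (n p) R b" using radius_section[OF pS] \<rho>[OF pS] R by auto
      have "R = R * (- lorentz (n p) m)"
        using \<delta>[OF m, of R b] b p by auto
      then have "R * (1 + lorentz (n p) m) = 0" by (simp add: distrib_left)
      then have "lorentz (n p) m = -1" using R0 by simp
      then have "n p = m" by (rule future_unit_lorentz(2)[OF normal[OF pS] m(1)])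
      then show ?thesis using p(1) R by (simp add: c_def scaleR_diff_right)
    qed
    then show "\<exists>K. \<exists>\<delta>>0. \<forall>m. future_unit m \<longrightarrow> lorentz a m = 0 \<longrightarrow>
      (let p = y + R *\<^sub>R (m - n y) in dist p y < \<delta> \<longrightarrow> norm (c p - c q) \<le> norm (c y - c q) + K * (dist p y)\<^sup>2)"
      using \<open>\<delta> > 0\<close> unfolding Let_def by (intro exI[of _ 0] exI[of _ \<delta>]) auto
  qed simp
  then show ?thesis by (simp add: c_def \<rho>_def)
qed

lemma subset_hyperboloid:
  assumes "S \<noteq> {}"
  obtains c R where "R \<noteq> 0" "\<And>p. p \<in> S \<Longrightarrow> p = c + R *\<^sub>R n p"
proof -
  obtain q where q: "q \<in> S" using assms by blast
  have "radius q \<noteq> 0" using radius_section[OF q] by (auto simp: hyperbolic_section_def)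
  moreover have "p = (q - radius q *\<^sub>R n q) + radius q *\<^sub>R n p" if "p \<in> S" for p
    using centre_constant[OF q that] by (simp add: algebra_simps)
  ultimately show thesis using that by blast
qed

end

section \<open>Hyperbolic spaces and normal sections\<close>

text \<open>For timelike \<open>V\<close>, the hyperbolic space of radius
  \<open>\<bar>R\<bar>\<close> with centre \<open>c\<close> in \<open>c + V\<close>, past-directed
  if \<open>R\<close> is negative.\<close>

definition sheet :: "'m::finite minkowski set \<Rightarrow> 'm minkowski \<Rightarrow> real \<Rightarrow> 'm minkowski set"
  where "sheet V c R = {c + R *\<^sub>R m |m. m \<in> V \<and> future_unit m}"

lemma sheetI: "m \<in> V \<Longrightarrow> future_unit m \<Longrightarrow> c + R *\<^sub>R m \<in> sheet V c R"
  unfolding sheet_def by blast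

lemma sheetE:
  assumes "x \<in> sheet V c R"
  obtains m where "x = c + R *\<^sub>R m" "m \<in> V" "future_unit m"
  using assms unfolding sheet_def by blast

text \<open>Seen from \<open>e\<close>, the unit hyperboloid is a graph over the complement of
  \<open>e\<close>. This presents a sheet as a continuous image of a linear space.\<close>

lemma future_unit_decomposition:
  assumes e: "future_unit e"
  shows "lorentz e w = 0 \<Longrightarrow> future_unit (sqrt (1 + lorentz w w) *\<^sub>R e + w)"
    and "future_unit m \<Longrightarrow> lorentz e (m + lorentz m e *\<^sub>R e) = 0 \<and>
      m = sqrt (1 + lorentz (m + lorentz m e *\<^sub>R e) (m + lorentz m e *\<^sub>R e)) *\<^sub>R e + (m + lorentz m e *\<^sub>R e)"
proof -
  have ee: "lorentz e e = -1" using e by (simp add: future_unit_def)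
  show "future_unit (sqrt (1 + lorentz w w) *\<^sub>R e + w)" if w: "lorentz e w = 0"
  proof -
    have nn: "lorentz w w \<ge> 0" using w ee by (intro timelike_orthogonal_nonneg[of e]) auto
    define s where "s = sqrt (1 + lorentz w w)"
    have s: "s * s = 1 + lorentz w w" "s > 0" using nn by (simp_all add: s_def)
    have we: "lorentz w e = 0" using w by (simp add: lorentz_commute[of w e])
    have "lorentz (s *\<^sub>R e + w) (s *\<^sub>R e + w) = - (s * s) + lorentz w w"
      using w we ee by simp
    then have 1: "lorentz (s *\<^sub>R e + w) (s *\<^sub>R e + w) = -1" using s by simp
    have "lorentz (s *\<^sub>R e + w) e = - s" using we ee by simp
    then have "fst (s *\<^sub>R e + w) > 0"
      using timelike_future[OF _ e, of "s *\<^sub>R e + w"] 1 s(2) by (simp del: lorentz_algebra)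
    then show ?thesis using 1 unfolding future_unit_def s_def by blast
  qed
  assume m: "future_unit m"
  define w where "w = m + lorentz m e *\<^sub>R e"
  have ew: "lorentz e w = 0" using ee by (simp add: w_def lorentz_commute[of e m])
  have "lorentz w w = (lorentz m e)\<^sup>2 - 1"
    using m ee by (simp add: w_def future_unit_def lorentz_commute[of e m] power2_eq_square)
  then have "sqrt (1 + lorentz w w) = \<bar>lorentz m e\<bar>" by simp
  also have "\<dots> = - lorentz m e" using future_unit_lorentz(1)[OF m e] by simp
  finally have "m = sqrt (1 + lorentz w w) *\<^sub>R e + w" by (simp add: w_def)
  then show "lorentz e (m + lorentz m e *\<^sub>R e) = 0 \<and>
      m = sqrt (1 + lorentz (m + lorentz m e *\<^sub>R e) (m + lorentz m e *\<^sub>R e)) *\<^sub>R e + (m + lorentz m e *\<^sub>R e)"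
    using ew unfolding w_def by blast
qed

lemma connected_sheet:
  assumes V: "subspace V" and e: "e \<in> V" "future_unit e"
  shows "connected (sheet V c R)"
proof -
  let ?W = "{w \<in> V. lorentz e w = 0}"
  let ?f = "\<lambda>w. c + R *\<^sub>R (sqrt (1 + lorentz w w) *\<^sub>R e + w)"
  have "subspace ?W" using V by (auto simp: subspace_def)
  then have "connected ?W" by (intro convex_connected subspace_imp_convex)
  moreover have "continuous_on ?W ?f" by (intro continuous_intros)
  ultimately have "connected (?f ` ?W)" by (intro connected_continuous_image)
  moreover have "sheet V c R = ?f ` ?W"
  proof (intro set_eqI iffI)
    fix x assume "x \<in> sheet V c R"
    then obtain m where m: "x = c + R *\<^sub>R m" "m \<in> V" "future_unit m" by (rule sheetE)
    let ?w = "m + lorentz m e *\<^sub>R e"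
    have "?w \<in> ?W"
      using future_unit_decomposition(2)[OF e(2) m(3)] V m(2) e(1) by (auto intro: subspace_add subspace_scale)
    moreover have "x = ?f ?w"
      using future_unit_decomposition(2)[OF e(2) m(3)] m(1) by metis
    ultimately show "x \<in> ?f ` ?W" by blast
  next
    fix x assume "x \<in> ?f ` ?W"
    then obtain w where w: "w \<in> V" "lorentz e w = 0" "x = ?f w" by blast
    show "x \<in> sheet V c R"
      unfolding w(3)
      by (intro sheetI subspace_add subspace_scale V e w future_unit_decomposition(1))
  qed
  ultimately show ?thesis by simp
qed

lemma timelike_subspace_future_unit:
  assumes "timelike_subspace V"
  obtains e where "e \<in> V" "future_unit e"
proof -
  obtain u where u: "u \<in> V" "lorentz u u < 0" using assms by (auto simp: timelike_subspace_def)
  obtain s where "future_unit (s *\<^sub>R u)" using timelike_normalize[OF u(2)] by blast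
  moreover have "s *\<^sub>R u \<in> V" using u assms by (auto simp: timelike_subspace_def intro: subspace_scale)
  ultimately show thesis using that by blast
qed

lemma timelike_subspaceI:
  assumes "subspace V" "e \<in> V" "future_unit e"
  shows "timelike_subspace V"
  unfolding timelike_subspace_def
  using assms timelike_orthogonal_pos[of e]
  by (intro conjI bexI[of _ e]) (auto simp: future_unit_def)

lemma affine_direction_eq:
  assumes "affine E" "c \<in> E"
  shows "affine_direction E = (\<lambda>x. x - c) ` E"
proof (intro set_eqI iffI)
  fix v assume "v \<in> affine_direction E"
  then obtain x y where xy: "x \<in> E" "y \<in> E" "v = x - y" by (auto simp: affine_direction_def)
  have "c + 1 *\<^sub>R (x - y) \<in> E" by (rule mem_affine_3_minus[OF assms(1,2) xy(1,2)])
  then show "v \<in> (\<lambda>x. x - c) ` E" using xy by (intro image_eqI[of _ _ "c + (x - y)"]) auto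
qed (use assms in \<open>auto simp: affine_direction_def\<close>)

lemma mem_affine_iff:
  assumes "affine E" "c \<in> E"
  shows "x \<in> E \<longleftrightarrow> x - c \<in> affine_direction E"
  unfolding affine_direction_eq[OF assms] by (auto simp: image_iff)

lemma subspace_affine_direction:
  assumes "affine E" "c \<in> E"
  shows "subspace (affine_direction E)"
  unfolding affine_direction_eq[OF assms] by (rule affine_diffs_subspace_subtract[OF assms])

lemma components_hyperboloid:
  assumes E: "affine E" "c \<in> E" and V: "timelike_subspace (affine_direction E)" and R: "R > 0"
  shows "components {x \<in> E. lorentz (x - c) (x - c) = - R\<^sup>2} =
    {sheet (affine_direction E) c R, sheet (affine_direction E) c (- R)}"
proof -
  define X where "X = {x \<in> E. lorentz (x - c) (x - c) = - R\<^sup>2}"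
  let ?V = "affine_direction E"
  have sub: "subspace ?V" using V by (simp add: timelike_subspace_def)
  obtain e where e: "e \<in> ?V" "future_unit e" using timelike_subspace_future_unit[OF V] by blast
  have conn: "connected (sheet ?V c \<rho>)" for \<rho> by (rule connected_sheet[OF sub e])
  have ne: "sheet ?V c \<rho> \<noteq> {}" for \<rho> using sheetI[OF e] by blast
  have sheetX: "sheet ?V c \<rho> \<subseteq> X" if "\<rho> = R \<or> \<rho> = - R" for \<rho>
  proof
    fix x assume "x \<in> sheet ?V c \<rho>"
    then obtain m where m: "x = c + \<rho> *\<^sub>R m" "m \<in> ?V" "future_unit m" by (rule sheetE)
    then have "x - c = \<rho> *\<^sub>R m" by simp
    moreover have "\<rho> *\<^sub>R m \<in> ?V" using m sub by (intro subspace_scale)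
    moreover have "lorentz (\<rho> *\<^sub>R m) (\<rho> *\<^sub>R m) = - R\<^sup>2"
      using m(3) that by (auto simp: future_unit_def power2_eq_square)
    ultimately show "x \<in> X" unfolding X_def mem_Collect_eq mem_affine_iff[OF E, of x] by simp
  qed
  have Xsheet: "x \<in> sheet ?V c (sgn (fst (x - c)) * R) \<and> fst (x - c) \<noteq> 0" if x: "x \<in> X" for x
  proof -
    have xc: "lorentz (x - c) (x - c) = - R\<^sup>2" "x - c \<in> ?V" using x mem_affine_iff[OF E, of x] by (auto simp: X_def)
    define u where "u = x - c"
    have u: "lorentz u u = - R\<^sup>2" "u \<in> ?V" using xc by (auto simp only: u_def)
    have "lorentz u u < 0" using u R by simp
    then obtain s where s: "s = sgn (fst u) / sqrt (- lorentz u u)" "s \<noteq> 0" "future_unit (s *\<^sub>R u)"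
      by (rule timelike_normalize)
    have f0: "fst u \<noteq> 0" using s by auto
    have "s = sgn (fst u) / R" using s(1) u(1) R by simp
    then have "(sgn (fst u) * R) *\<^sub>R (s *\<^sub>R u) = u" using R f0 by (simp add: sgn_real_def)
    then have "x = c + (sgn (fst u) * R) *\<^sub>R (s *\<^sub>R u)" by (simp add: u_def)
    moreover have "s *\<^sub>R u \<in> ?V" using u sub by (intro subspace_scale)
    ultimately show ?thesis using s(3) f0 unfolding sheet_def u_def by blast
  qed
  have sgn_sheet: "sgn (fst (x - c)) * R = \<rho>" if "x \<in> sheet ?V c \<rho>" "\<rho> = R \<or> \<rho> = - R" for x \<rho>
    using that R by (auto simp: sheet_def future_unit_def sgn_mult)
  \<comment> \<open>\<open>fst (x - c)\<close> is continuous without zeros on \<open>X\<close>, so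
    it keeps its sign on a connected subset.\<close>
  have const: "D \<subseteq> sheet ?V c (sgn (fst (x - c)) * R)" if D: "connected D" "D \<subseteq> X" "x \<in> D" for D x
  proof
    fix y assume y: "y \<in> D"
    have "sgn (fst (y - c)) = sgn (fst (x - c))"
    proof (rule ccontr)
      assume ns: "sgn (fst (y - c)) \<noteq> sgn (fst (x - c))"
      have "connected ((\<lambda>z. fst (z - c)) ` D)"
        by (intro connected_continuous_image continuous_intros D)
      then have iv: "is_interval ((\<lambda>z. fst (z - c)) ` D)" by (simp add: is_interval_connected_1)
      have "fst (x - c) \<noteq> 0" "fst (y - c) \<noteq> 0" using Xsheet D y by blast+
      then have "fst (x - c) < 0 \<and> 0 < fst (y - c) \<or> fst (y - c) < 0 \<and> 0 < fst (x - c)"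
        using ns by (auto simp: sgn_real_def split: if_splits)
      then have "0 \<in> (\<lambda>z. fst (z - c)) ` D"
        using mem_is_interval_1_I[OF iv imageI[OF D(3)] imageI[OF y], of 0]
          mem_is_interval_1_I[OF iv imageI[OF y] imageI[OF D(3)], of 0] by linarith
      then show False using Xsheet D(2) by force
    qed
    then show "y \<in> sheet ?V c (sgn (fst (x - c)) * R)" using Xsheet[of y] D y by auto
  qed
  have max: "sheet ?V c \<rho> \<in> components X" if \<rho>: "\<rho> = R \<or> \<rho> = - R" for \<rho>
    unfolding in_components_maximal
  proof (intro conjI ne sheetX[OF \<rho>] conn allI impI)
    fix D assume D: "D \<noteq> {} \<and> sheet ?V c \<rho> \<subseteq> D \<and> D \<subseteq> X \<and> connected D"
    obtain x where x: "x \<in> sheet ?V c \<rho>" using ne by blast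
    then have "D \<subseteq> sheet ?V c (sgn (fst (x - c)) * R)" using D by (intro const) auto
    then show "D = sheet ?V c \<rho>" using sgn_sheet[OF x \<rho>] D by auto
  qed
  have "components X = {sheet ?V c R, sheet ?V c (- R)}"
  proof (intro set_eqI iffI)
    fix H assume H: "H \<in> components X"
    then obtain x where x: "x \<in> H" using in_components_nonempty by blast
    have "H \<subseteq> sheet ?V c (sgn (fst (x - c)) * R)"
      using H x by (intro const) (auto dest: in_components_connected in_components_subset)
    moreover have \<rho>: "sgn (fst (x - c)) * R = R \<or> sgn (fst (x - c)) * R = - R"
      using Xsheet[of x] x H in_components_subset by (fastforce simp: sgn_real_def)
    ultimately have "H = sheet ?V c (sgn (fst (x - c)) * R)"
      using max[OF \<rho>] H components_nonoverlap[OF H max[OF \<rho>]] x by blast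
    then show "H \<in> {sheet ?V c R, sheet ?V c (- R)}" using \<rho> by auto
  qed (use max in auto)
  then show ?thesis unfolding X_def .
qed

text \<open>The choice of the component is absorbed into the sign of \<open>R\<close>.\<close>

lemma hyperbolic_space_iff_sheet:
  "hyperbolic_space k H \<longleftrightarrow> (\<exists>E c R. affine E \<and> aff_dim E = int k + 1 \<and>
    timelike_subspace (affine_direction E) \<and> c \<in> E \<and> R \<noteq> 0 \<and> H = sheet (affine_direction E) c R)"
proof
  assume "hyperbolic_space k H"
  then obtain E c R where E: "affine E" "aff_dim E = int k + 1" "timelike_subspace (affine_direction E)" "c \<in> E" "R > 0"
    and H: "H \<in> components {x \<in> E. lorentz (x - c) (x - c) = - R\<^sup>2}"
    unfolding hyperbolic_space_def by blast
  have "H = sheet (affine_direction E) c R \<or> H = sheet (affine_direction E) c (- R)"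
    using H components_hyperboloid[OF E(1,4,3,5)] by auto
  then show "\<exists>E c R. affine E \<and> aff_dim E = int k + 1 \<and>
    timelike_subspace (affine_direction E) \<and> c \<in> E \<and> R \<noteq> 0 \<and> H = sheet (affine_direction E) c R"
    using E by (metis less_irrefl neg_0_equal_iff_equal)
next
  assume "\<exists>E c R. affine E \<and> aff_dim E = int k + 1 \<and>
    timelike_subspace (affine_direction E) \<and> c \<in> E \<and> R \<noteq> 0 \<and> H = sheet (affine_direction E) c R"
  then obtain E c R where E: "affine E" "aff_dim E = int k + 1" "timelike_subspace (affine_direction E)" "c \<in> E" "R \<noteq> 0"
    and H: "H = sheet (affine_direction E) c R" by blast
  have "H \<in> components {x \<in> E. lorentz (x - c) (x - c) = - \<bar>R\<bar>\<^sup>2}"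
    using H components_hyperboloid[OF E(1,4,3), of "\<bar>R\<bar>"] E(5) by (cases "R > 0") auto
  then show "hyperbolic_space k H"
    unfolding hyperbolic_space_def using E by (intro exI[of _ E] exI[of _ c] exI[of _ "\<bar>R\<bar>"]) auto
qed

lemma hyperbolic_space_connected: "hyperbolic_space k H \<Longrightarrow> connected H"
  unfolding hyperbolic_space_def using in_components_connected by blast

lemma unit_normal_sheet:
  assumes \<Sigma>: "spacelike_hypersurface \<Sigma>" and sh: "\<And>m. future_unit m \<Longrightarrow> lorentz a m = 0 \<Longrightarrow> c + R *\<^sub>R m \<in> \<Sigma>"
    and R: "R \<noteq> 0" and m: "future_unit m" "lorentz a m = 0"
    and w: "lorentz m w = 0" "lorentz a w = 0"
  shows "lorentz (unit_normal \<Sigma> (c + R *\<^sub>R m)) w = 0"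
proof -
  obtain t where "t \<noteq> 0" "t *\<^sub>R w \<in> tangent_space \<Sigma> (c + R *\<^sub>R m)"
    using hyperbola_tangent[of a c R \<Sigma>, OF sh R m w] by blast
  then show ?thesis using unit_normal(2)[OF \<Sigma> sh[OF m]] by auto
qed

lemma future_unit_parallel:
  assumes "future_unit n" "future_unit m" "n = (- lorentz n m) *\<^sub>R m"
  shows "n = m"
proof -
  define a where "a = - lorentz n m"
  have n: "n = a *\<^sub>R m" using assms(3) by (simp add: a_def)
  have "{v. lorentz n v = 0} = {v. lorentz m v = 0}"
    using future_unit_nonzero[OF assms(1)] unfolding n by auto
  then show ?thesis by (rule future_unit_unique[OF assms(1,2)])
qed

text \<open>The hyperbolic space spans its hyperplane, and its centre lies on the normal line.\<close>

lemma normal_section: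
  fixes \<Sigma> :: "'m::finite minkowski set"
  assumes card: "CARD('m) \<ge> 3" and \<Sigma>: "spacelike_hypersurface \<Sigma>" and q: "q \<in> \<Sigma>"
    and P: "normal_hyperplane \<Sigma> q P" and H: "hyperbolic_space (CARD('m) - 1) (P \<inter> \<Sigma>)"
  obtains a R where "hyperbolic_section \<Sigma> q (unit_normal \<Sigma> q) R a" "P = {x. lorentz a (x - q) = 0}"
proof -
  obtain E c R where E: "affine E" "aff_dim E = int (CARD('m) - 1) + 1" "timelike_subspace (affine_direction E)" "c \<in> E" "R \<noteq> 0"
    and Hs: "P \<inter> \<Sigma> = sheet (affine_direction E) c R"
    using H unfolding hyperbolic_space_iff_sheet by blast
  have dimE: "aff_dim E = int CARD('m)" using E(2) card by simp
  have affP: "affine P" "aff_dim P = int CARD('m)" "q \<in> P" "normal_line \<Sigma> q \<subseteq> affine_direction P"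
    using P by (auto simp: normal_hyperplane_def)
  define V where "V = affine_direction E"
  have V: "subspace V" unfolding V_def by (rule subspace_affine_direction[OF E(1,4)])
  obtain e where e: "e \<in> V" "future_unit e" using timelike_subspace_future_unit[OF E(3)] unfolding V_def by blast
  have dimV: "dim V = CARD('m)"
    using aff_dim_eq_dim_subtract[of c E] dimE E(4) unfolding V_def affine_direction_eq[OF E(1,4)]
    by (simp add: hull_inc)
  have sh: "c + R *\<^sub>R m \<in> P \<inter> \<Sigma>" if "m \<in> V" "future_unit m" for m
    using that unfolding Hs sheet_def V_def by blast
  define D where "D = affine_direction P"
  have D: "subspace D" unfolding D_def by (rule subspace_affine_direction[OF affP(1,3)])
  have diffD: "x - y \<in> D" if "x \<in> P" "y \<in> P" for x y using that unfolding D_def affine_direction_def by blast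
  \<comment> \<open>The points of the sheet over \<open>w\<close> and \<open>- w\<close> differ by
    \<open>(2 * R) *\<^sub>R w\<close>.\<close>
  have WD: "w \<in> D" if w: "w \<in> V" "lorentz e w = 0" for w
  proof -
    let ?s = "sqrt (1 + lorentz w w)"
    have "?s *\<^sub>R e + w \<in> V" "?s *\<^sub>R e + (- w) \<in> V"
      using V e w by (intro subspace_add subspace_scale subspace_neg; simp)+
    moreover have "future_unit (?s *\<^sub>R e + w)" "future_unit (?s *\<^sub>R e + (- w))"
      using future_unit_decomposition(1)[OF e(2), of w] future_unit_decomposition(1)[OF e(2), of "- w"] w by simp_all
    ultimately have "(c + R *\<^sub>R (?s *\<^sub>R e + w)) - (c + R *\<^sub>R (?s *\<^sub>R e + (- w))) \<in> D"
      by (intro diffD) (use sh in blast)+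
    moreover have "(c + R *\<^sub>R (?s *\<^sub>R e + w)) - (c + R *\<^sub>R (?s *\<^sub>R e + (- w))) = (2 * R) *\<^sub>R w"
      by (simp add: algebra_simps) (simp add: scaleR_2[symmetric])
    ultimately have "(1 / (2 * R)) *\<^sub>R (2 * R) *\<^sub>R w \<in> D" using D by (simp only: subspace_scale)
    then show ?thesis using E(5) by simp
  qed
  have split: "\<exists>w\<in>V. lorentz e w = 0 \<and> v = w + (- lorentz v e) *\<^sub>R e" if "v \<in> V" for v
    using that V e by (intro bexI[of _ "v + lorentz v e *\<^sub>R e"])
      (auto simp: future_unit_def lorentz_commute[of e v] intro: subspace_add subspace_scale)
  have "\<exists>w\<in>V. lorentz e w = 0 \<and> w \<noteq> 0"
  proof (rule ccontr)
    assume not: "\<not> ?thesis"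
    have "V \<subseteq> span {e}"
    proof
      fix v assume "v \<in> V"
      then have "v = (- lorentz v e) *\<^sub>R e" using split not by fastforce
      then show "v \<in> span {e}" by (metis span_base span_scale singletonI)
    qed
    then have "dim V \<le> dim {e}" by (metis dim_span dim_subset)
    also have "\<dots> \<le> 1" by (metis card.empty card_insert_disjoint dim_le_card' empty_iff finite.emptyI finite_insert One_nat_def)
    finally show False using dimV card by simp
  qed
  then obtain w where w: "w \<in> V" "lorentz e w = 0" "w \<noteq> 0" by blast
  \<comment> \<open>Over a nonzero \<open>w\<close> the sheet has height \<open>s > 1\<close> in
    units of \<open>R\<close>. Subtracting the point over 0 and the multiple of \<open>w\<close>
    already known to lie in \<open>D\<close> leaves a nonzero multiple of \<open>e\<close>.\<close>
  have eD: "e \<in> D"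
  proof -
    define s where "s = sqrt (1 + lorentz w w)"
    have "lorentz w w > 0" using w e by (intro timelike_orthogonal_pos[of e]) (auto simp: future_unit_def)
    then have "s > 1" by (simp add: s_def)
    have "s *\<^sub>R e + w \<in> V" using V e w by (auto intro: subspace_add subspace_scale)
    moreover have "future_unit (s *\<^sub>R e + w)" unfolding s_def by (rule future_unit_decomposition(1)[OF e(2) w(2)])
    ultimately have "(c + R *\<^sub>R (s *\<^sub>R e + w)) - (c + R *\<^sub>R e) \<in> D" by (intro diffD) (use sh e in blast)+
    then have "(c + R *\<^sub>R (s *\<^sub>R e + w)) - (c + R *\<^sub>R e) - R *\<^sub>R w \<in> D"
      using subspace_diff[OF D _ subspace_scale[OF D WD[OF w(1,2)]]] by blast
    moreover have "(c + R *\<^sub>R (s *\<^sub>R e + w)) - (c + R *\<^sub>R e) - R *\<^sub>R w = (R * (s - 1)) *\<^sub>R e"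
      by (simp add: algebra_simps)
    ultimately have "(1 / (R * (s - 1))) *\<^sub>R (R * (s - 1)) *\<^sub>R e \<in> D" using D by (simp only: subspace_scale)
    then show ?thesis using E(5) \<open>s > 1\<close> by simp
  qed
  have VD: "V \<subseteq> D"
  proof
    fix v assume "v \<in> V"
    then obtain w' where "w' \<in> V" "lorentz e w' = 0" "v = w' + (- lorentz v e) *\<^sub>R e" using split by blast
    then show "v \<in> D" using WD eD D by (metis subspace_add subspace_scale)
  qed
  have cP: "c \<in> P"
  proof -
    have ce: "c + R *\<^sub>R e \<in> P" using sh e by blast
    have "- R *\<^sub>R e \<in> D" by (rule subspace_scale[OF D eD])
    then have "c - (c + R *\<^sub>R e) \<in> affine_direction P" unfolding D_def by simp
    then show ?thesis using mem_affine_iff[OF affP(1) ce] by blast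
  qed
  have "E \<subseteq> P"
    using VD mem_affine_iff[OF E(1,4)] mem_affine_iff[OF affP(1) cP] unfolding V_def D_def by blast
  then have EP: "E = P" using affine_dim_equal[OF E(1) affP(1)] E(4) dimE affP(2) by auto
  obtain b where b: "b \<noteq> 0" "\<And>v. v \<in> span V \<Longrightarrow> orthogonal b v"
    using orthogonal_to_subspace_exists[of V] dimV by (auto simp: dim_eq_full)
  have "V = {v. b \<bullet> v = 0}"
  proof (rule subspace_dim_equal)
    show "subspace {v. b \<bullet> v = 0}" by (rule subspace_hyperplane)
    show "V \<subseteq> {v. b \<bullet> v = 0}" using b(2) by (auto simp: orthogonal_def span_base)
    show "dim {v. b \<bullet> v = 0} \<le> dim V" using dim_hyperplane[OF b(1)] dimV by simp
  qed fact
  then have Vb: "V = {v. lorentz (time_reflection b) v = 0}" by (simp add: lorentz_time_reflection)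
  define a0 where "a0 = time_reflection b"
  have "a0 \<noteq> 0"
    using b(1) lorentz_time_reflection[of b b] by (auto simp: a0_def)
  have ea0: "lorentz e a0 = 0" using e(1) Vb by (simp add: a0_def lorentz_commute[of e])
  have pos: "lorentz a0 a0 > 0"
    using ea0 e \<open>a0 \<noteq> 0\<close> by (intro timelike_orthogonal_pos[of e]) (auto simp: future_unit_def)
  define a where "a = (1 / sqrt (lorentz a0 a0)) *\<^sub>R a0"
  have aa: "lorentz a a = 1" using pos by (simp add: a_def)
  have Va: "V = {v. lorentz a v = 0}" using Vb pos by (simp add: a_def a0_def)
  have "q \<in> P \<inter> \<Sigma>" using q affP by simp
  then obtain m where m: "q = c + R *\<^sub>R m" "m \<in> V" "future_unit m"
    unfolding Hs sheet_def V_def by blast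
  have am: "lorentz a m = 0" using m(2) Va by simp
  have sh': "c + R *\<^sub>R m' \<in> \<Sigma>" if "future_unit m'" "lorentz a m' = 0" for m'
    using sh that Va by blast
  let ?n = "unit_normal \<Sigma> q"
  have n: "future_unit ?n" by (rule unit_normal(1)[OF \<Sigma> q])
  have "?n \<in> normal_line \<Sigma> q" using unit_normal(2)[OF \<Sigma> q] by (auto simp: normal_line_def)
  then have "?n \<in> V" using affP(4) EP unfolding V_def by blast
  then have an: "lorentz a ?n = 0" using Va by simp
  \<comment> \<open>Tangency to the section puts the normal into the plane of \<open>m\<close> and
    \<open>a\<close>; since \<open>P\<close> is a normal hyperplane, the component along
    \<open>a\<close> vanishes.\<close>
  have "?n = (- lorentz ?n m) *\<^sub>R m + lorentz ?n a *\<^sub>R a"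
  proof (rule orthogonal_complement_unit[OF m(3) _ aa])
    show "lorentz ?n w = 0" if "lorentz m w = 0" "lorentz a w = 0" for w
      using unit_normal_sheet[of \<Sigma> a c R, OF \<Sigma> sh' E(5) m(3) am that] m(1) by simp
    show "lorentz m a = 0" using am by (simp add: lorentz_commute[of m a])
  qed
  then have "?n = (- lorentz ?n m) *\<^sub>R m" using an lorentz_commute[of a ?n] by simp
  then have nm: "?n = m" by (rule future_unit_parallel[OF n m(3)])
  show thesis
  proof (rule that)
    show "hyperbolic_section \<Sigma> q ?n R a"
      unfolding hyperbolic_section_def
    proof (intro conjI allI impI aa E(5))
      show "lorentz ?n a = 0" using an lorentz_commute[of a ?n] by simp
      fix m' assume m': "future_unit m' \<and> lorentz m' a = 0"
      have "q + R *\<^sub>R (m' - ?n) = c + R *\<^sub>R m'" using m(1) nm by (simp add: scaleR_diff_right)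
      then show "q + R *\<^sub>R (m' - ?n) \<in> \<Sigma>" using sh'[of m'] m' lorentz_commute[of a m'] by simp
    qed
    have "x \<in> P \<longleftrightarrow> x - q \<in> V" for x
      using mem_affine_iff[OF affP(1,3)] EP unfolding V_def by blast
    then show "P = {x. lorentz a (x - q) = 0}" using Va by blast
  qed
qed

section \<open>The characterization by normal sections\<close>

lemma hyperplane_distinct:
  assumes "P\<^sub>1 = {x. lorentz a (x - q) = 0}" "P\<^sub>2 = {x. lorentz b (x - q) = 0}" "P\<^sub>1 \<noteq> P\<^sub>2"
  shows "a \<noteq> b" "a \<noteq> - b"
  using assms by auto

lemma component_is_sheet:
  fixes \<Sigma> :: "'m::finite minkowski set"
  assumes card: "CARD('m) \<ge> 3" and \<Sigma>: "spacelike_hypersurface \<Sigma>" and cl: "closed \<Sigma>" and q0: "q0 \<in> \<Sigma>"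
    and sections: "\<forall>q\<in>\<Sigma>. \<exists>P\<^sub>1 P\<^sub>2. P\<^sub>1 \<noteq> P\<^sub>2 \<and>
       normal_hyperplane \<Sigma> q P\<^sub>1 \<and> hyperbolic_space (CARD('m) - 1) (P\<^sub>1 \<inter> \<Sigma>) \<and>
       normal_hyperplane \<Sigma> q P\<^sub>2 \<and> hyperbolic_space (CARD('m) - 1) (P\<^sub>2 \<inter> \<Sigma>)"
  obtains c R where "R \<noteq> 0" "connected_component_set \<Sigma> q0 = sheet UNIV c R"
proof -
  define S where "S = connected_component_set \<Sigma> q0"
  interpret locally_spacelike_graph \<Sigma>
    using cl hypersurface_locally_acausal[OF \<Sigma>] hypersurface_locally_onto[OF \<Sigma>]
    by unfold_locales
  have S\<Sigma>: "S \<subseteq> \<Sigma>" unfolding S_def by (rule connected_component_subset)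
  have SS: "connected_component_set \<Sigma> x = S" if "x \<in> S" for x
    using that unfolding S_def by (rule connected_component_eq)
  \<comment> \<open>A section at \<open>q\<close> is connected and contains \<open>q\<close>, so it
    stays in the component of \<open>q\<close>.\<close>
  have section_in: "hyperbolic_section S q (unit_normal \<Sigma> q) R a"
    if q: "q \<in> S" and sec: "hyperbolic_section \<Sigma> q (unit_normal \<Sigma> q) R a" for q R a
  proof -
    let ?n = "unit_normal \<Sigma> q"
    let ?V = "{v. lorentz a v = 0}"
    have n: "future_unit ?n" using unit_normal(1)[OF \<Sigma>] q S\<Sigma> by blast
    have na: "lorentz a ?n = 0" using sec lorentz_commute[of a ?n] by (simp add: hyperbolic_section_def)
    have "connected (sheet ?V (q - R *\<^sub>R ?n) R)"
      by (rule connected_sheet[of _ ?n]) (use n na in \<open>auto simp: subspace_def\<close>)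
    moreover have "sheet ?V (q - R *\<^sub>R ?n) R \<subseteq> \<Sigma>"
    proof
      fix x assume "x \<in> sheet ?V (q - R *\<^sub>R ?n) R"
      then obtain m where m: "x = q - R *\<^sub>R ?n + R *\<^sub>R m" "lorentz a m = 0" "future_unit m"
        unfolding sheet_def by blast
      then have "x = q + R *\<^sub>R (m - ?n)" by (simp add: scaleR_diff_right)
      then show "x \<in> \<Sigma>" using hyperbolic_section_mem[OF sec m(3,2)] by simp
    qed
    moreover have "q \<in> sheet ?V (q - R *\<^sub>R ?n) R"
      using sheetI[of ?n ?V "q - R *\<^sub>R ?n" R] n na by simp
    ultimately have "sheet ?V (q - R *\<^sub>R ?n) R \<subseteq> S"
      using connected_component_maximal[of q _ \<Sigma>] SS[OF q] by metis
    moreover have "q + R *\<^sub>R (m - ?n) \<in> sheet ?V (q - R *\<^sub>R ?n) R" if "future_unit m" "lorentz m a = 0" for m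
    proof -
      have "m \<in> ?V" using that lorentz_commute[of a m] by simp
      from sheetI[OF this that(1), of "q - R *\<^sub>R ?n" R] show ?thesis
        by (simp add: scaleR_diff_right algebra_simps)
    qed
    ultimately show ?thesis using sec unfolding hyperbolic_section_def by blast
  qed
  interpret acausal_with_sections S "unit_normal \<Sigma>"
  proof
    show "CARD('m) \<ge> 3" by fact
    show "closed S" unfolding S_def by (rule closed_connected_component[OF cl])
    show "lorentz (x - y) (x - y) > 0" if "x \<in> S" "y \<in> S" "x \<noteq> y" for x y
      using component_acausal[of y x] that S\<Sigma> SS[of y] by (auto simp: lorentz_pos_iff simp del: lorentz_algebra)
    fix q assume q: "q \<in> S"
    then have q\<Sigma>: "q \<in> \<Sigma>" using S\<Sigma> by blast
    show "future_unit (unit_normal \<Sigma> q)" by (rule unit_normal(1)[OF \<Sigma> q\<Sigma>])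
    show "lorentz (unit_normal \<Sigma> q) v = 0" if "v \<in> tangent_space S q" for v
    proof -
      have "v \<in> tangent_space \<Sigma> q"
        using that S\<Sigma> unfolding tangent_space_def by (fastforce elim: eventually_mono)
      then show ?thesis using unit_normal(2)[OF \<Sigma> q\<Sigma>] by simp
    qed
    show "\<exists>C>0. \<exists>\<delta>>0. \<forall>p\<in>S. dist p q < \<delta> \<longrightarrow> norm (unit_normal \<Sigma> p - unit_normal \<Sigma> q) \<le> C * dist p q"
      using unit_normal_pointwise_lipschitz[OF \<Sigma> q\<Sigma>] S\<Sigma> by (meson subsetD)
    obtain P\<^sub>1 P\<^sub>2 where P: "P\<^sub>1 \<noteq> P\<^sub>2"
      "normal_hyperplane \<Sigma> q P\<^sub>1" "hyperbolic_space (CARD('m) - 1) (P\<^sub>1 \<inter> \<Sigma>)"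
      "normal_hyperplane \<Sigma> q P\<^sub>2" "hyperbolic_space (CARD('m) - 1) (P\<^sub>2 \<inter> \<Sigma>)"
      using sections q\<Sigma> by blast
    obtain a R where a: "hyperbolic_section \<Sigma> q (unit_normal \<Sigma> q) R a" "P\<^sub>1 = {x. lorentz a (x - q) = 0}"
      using normal_section[OF card \<Sigma> q\<Sigma> P(2,3)] .
    obtain a' R' where a': "hyperbolic_section \<Sigma> q (unit_normal \<Sigma> q) R' a'" "P\<^sub>2 = {x. lorentz a' (x - q) = 0}"
      using normal_section[OF card \<Sigma> q\<Sigma> P(4,5)] .
    show "\<exists>R a R' a'. a \<noteq> a' \<and> a \<noteq> - a' \<and> hyperbolic_section S q (unit_normal \<Sigma> q) R a \<and>
        hyperbolic_section S q (unit_normal \<Sigma> q) R' a'"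
      using hyperplane_distinct[OF a(2) a'(2) P(1)] section_in[OF q a(1)] section_in[OF q a'(1)] by blast
  qed
  have "q0 \<in> S" using q0 by (simp add: S_def)
  then obtain c R where R: "R \<noteq> 0" and c: "\<And>p. p \<in> S \<Longrightarrow> p = c + R *\<^sub>R unit_normal \<Sigma> p"
    using subset_hyperboloid by blast
  have "S = sheet UNIV c R"
  proof (intro set_eqI iffI)
    fix x assume "x \<in> S"
    then show "x \<in> sheet UNIV c R" unfolding sheet_def using c normal by blast
  next
    fix x assume "x \<in> sheet UNIV c R"
    then obtain m where m: "x = c + R *\<^sub>R m" "future_unit m" unfolding sheet_def by blast
    \<comment> \<open>The component has a point over every spatial point and the sheet has only one,
      so the inclusion already proved is an equality.\<close>
    obtain t where t: "(t, snd x) \<in> S" using component_onto[OF q0] unfolding S_def by blast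
    define m' where "m' = unit_normal \<Sigma> (t, snd x)"
    have m': "(t, snd x) = c + R *\<^sub>R m'" "future_unit m'" using c[OF t] normal[OF t] by (auto simp: m'_def)
    have "snd (c + R *\<^sub>R m') = snd (c + R *\<^sub>R m)" using m'(1) m(1) by (metis snd_conv)
    then have snd: "snd m' = snd m" using R by simp
    have fst2: "(fst u)\<^sup>2 = 1 + snd u \<bullet> snd u" "fst u > 0" if "future_unit u" for u :: "'m minkowski"
      using that by (auto simp: future_unit_def lorentz_def power2_eq_square)
    have "(fst m')\<^sup>2 = (fst m)\<^sup>2" using fst2 m(2) m'(2) snd by simp
    then have "fst m' = fst m" using fst2(2)[OF m(2)] fst2(2)[OF m'(2)] by (simp add: power2_eq_iff_nonneg)
    then have "m' = m" using snd by (simp add: prod_eq_iff)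
    then show "x \<in> S" using t m m' by simp
  qed
  then show thesis using that R unfolding S_def by blast
qed

lemma hyperbolic_space_if_sections:
  fixes \<Sigma> :: "'m::finite minkowski set"
  assumes card: "CARD('m) \<ge> 3" and \<Sigma>: "spacelike_hypersurface \<Sigma>" and ne: "\<Sigma> \<noteq> {}" and cl: "closed \<Sigma>"
    and sections: "\<forall>q\<in>\<Sigma>. \<exists>P\<^sub>1 P\<^sub>2. P\<^sub>1 \<noteq> P\<^sub>2 \<and>
       normal_hyperplane \<Sigma> q P\<^sub>1 \<and> hyperbolic_space (CARD('m) - 1) (P\<^sub>1 \<inter> \<Sigma>) \<and>
       normal_hyperplane \<Sigma> q P\<^sub>2 \<and> hyperbolic_space (CARD('m) - 1) (P\<^sub>2 \<inter> \<Sigma>)"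
  shows "hyperbolic_space CARD('m) \<Sigma>"
proof -
  obtain q where q: "q \<in> \<Sigma>" using ne by blast
  define S where "S = connected_component_set \<Sigma> q"
  obtain c R where R: "R \<noteq> 0" and S: "S = sheet UNIV c R"
    unfolding S_def by (rule component_is_sheet[OF card \<Sigma> cl q sections])
  let ?n = "unit_normal \<Sigma> q"
  have n: "future_unit ?n" by (rule unit_normal(1)[OF \<Sigma> q])
  obtain P where P: "normal_hyperplane \<Sigma> q P" "hyperbolic_space (CARD('m) - 1) (P \<inter> \<Sigma>)"
    using sections q by blast
  obtain a R0 where a: "hyperbolic_section \<Sigma> q ?n R0 a" "P = {x. lorentz a (x - q) = 0}"
    using normal_section[OF card \<Sigma> q P] .
  have aa: "lorentz a a = 1" "lorentz ?n a = 0" using a(1) by (auto simp: hyperbolic_section_def)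
  have "q \<in> P \<inter> \<Sigma>" using q P by (simp add: normal_hyperplane_def)
  then have PS: "P \<inter> \<Sigma> \<subseteq> S"
    unfolding S_def using hyperbolic_space_connected[OF P(2)] by (intro connected_component_maximal) auto
  have "x \<in> S" if x: "x \<in> \<Sigma>" for x
  proof -
    define S' where "S' = connected_component_set \<Sigma> x"
    obtain c' R' where R': "R' \<noteq> 0" and S': "S' = sheet UNIV c' R'"
      unfolding S'_def by (rule component_is_sheet[OF card \<Sigma> cl x sections])
    \<comment> \<open>The value of \<open>lorentz a m\<close> for which the point
      \<open>c' + R' *\<^sub>R m\<close> of the other component lies in \<open>P\<close>.\<close>
    define \<kappa> where "\<kappa> = - lorentz a (c' - q) / R'"
    define m where "m = sqrt (1 + \<kappa>\<^sup>2) *\<^sub>R ?n + \<kappa> *\<^sub>R a"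
    have m: "future_unit m" unfolding m_def by (rule future_unit_hyperbola[OF n aa])
    have am: "lorentz a m = \<kappa>" using aa lorentz_commute[of a ?n] by (simp add: m_def)
    let ?y = "c' + R' *\<^sub>R m"
    have yS': "?y \<in> S'" using m unfolding S' sheet_def by blast
    have "lorentz a (?y - q) = lorentz a (c' - q) + R' * \<kappa>" using am by simp
    also have "\<dots> = 0" using R' by (simp add: \<kappa>_def)
    finally have "?y \<in> P" using a(2) by blast
    moreover have "?y \<in> \<Sigma>" using yS' connected_component_subset[of \<Sigma> x] unfolding S'_def by blast
    ultimately have "?y \<in> S" using PS by blast
    then have "S = S'"
      using yS' connected_component_eq[of ?y \<Sigma>] unfolding S_def S'_def by metis
    moreover have "x \<in> S'" using x by (simp add: S'_def)
    ultimately show ?thesis by simp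
  qed
  then have "\<Sigma> = sheet UNIV c R" using S connected_component_subset[of \<Sigma> q] unfolding S_def by blast
  moreover have U: "affine_direction (UNIV :: 'm minkowski set) = UNIV"
    using affine_direction_eq[of UNIV 0] by simp
  moreover have "timelike_subspace (UNIV :: 'm minkowski set)"
    by (rule timelike_subspaceI[OF _ _ n]) auto
  moreover have "aff_dim (UNIV :: 'm minkowski set) = int CARD('m) + 1" by simp
  ultimately show ?thesis
    unfolding hyperbolic_space_iff_sheet using R
    by (intro exI[of _ UNIV] exI[of _ c] exI[of _ R]) simp
qed

lemma sections_if_hyperbolic_space:
  fixes \<Sigma> :: "'m::finite minkowski set"
  assumes card: "CARD('m) \<ge> 3" and \<Sigma>: "spacelike_hypersurface \<Sigma>" and H: "hyperbolic_space CARD('m) \<Sigma>"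
    and q: "q \<in> \<Sigma>"
  shows "\<exists>P\<^sub>1 P\<^sub>2. P\<^sub>1 \<noteq> P\<^sub>2 \<and>
       normal_hyperplane \<Sigma> q P\<^sub>1 \<and> hyperbolic_space (CARD('m) - 1) (P\<^sub>1 \<inter> \<Sigma>) \<and>
       normal_hyperplane \<Sigma> q P\<^sub>2 \<and> hyperbolic_space (CARD('m) - 1) (P\<^sub>2 \<inter> \<Sigma>)"
proof -
  obtain E c R where E: "affine E" "aff_dim E = int CARD('m) + 1" "c \<in> E" "R \<noteq> 0"
    and Hs: "\<Sigma> = sheet (affine_direction E) c R"
    using H unfolding hyperbolic_space_iff_sheet by blast
  have "aff_dim E = DIM('m minkowski)" using E(2) by simp
  then have "affine hull E = UNIV" using aff_dim_eq_full by blast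
  then have "E = UNIV" using E(1) by (metis affine_hull_eq)
  then have \<Sigma>s: "\<Sigma> = sheet UNIV c R" using Hs affine_direction_eq[of "UNIV :: 'm minkowski set" 0] by simp
  then have sh: "c + R *\<^sub>R m \<in> \<Sigma>" if "future_unit m" for m using sheetI[OF _ that] \<Sigma>s by blast
  obtain m where m: "q = c + R *\<^sub>R m" "future_unit m" using q \<Sigma>s unfolding sheet_def by blast
  let ?n = "unit_normal \<Sigma> q"
  have n: "future_unit ?n" by (rule unit_normal(1)[OF \<Sigma> q])
  have "?n = (- lorentz ?n m) *\<^sub>R m"
  proof (rule orthogonal_complement_future_unit[OF m(2)])
    \<comment> \<open>With 0 as the vector defining the hyperplane, the condition on
      \<open>m\<close> is void and the statement covers the whole hyperboloid.\<close>
    show "lorentz ?n w = 0" if "lorentz m w = 0" for w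
      using unit_normal_sheet[of \<Sigma> 0 c R, OF \<Sigma> _ E(4) m(2) _ that] sh m(1) by simp
  qed
  then have nm: "?n = m" by (rule future_unit_parallel[OF n m(2)])
  have mm: "lorentz m m < 0" using m by (simp add: future_unit_def)
  \<comment> \<open>A normal hyperplane at \<open>q\<close> contains the centre, because
    \<open>q - c\<close> is a multiple of the normal, and so cuts \<Sigma> in a sheet with the same
    centre and radius.\<close>
  have P: "normal_hyperplane \<Sigma> q {x. lorentz a (x - q) = 0} \<and>
      hyperbolic_space (CARD('m) - 1) ({x. lorentz a (x - q) = 0} \<inter> \<Sigma>)"
    if a: "lorentz a a = 1" "lorentz m a = 0" for a
  proof -
    let ?P = "{x. lorentz a (x - q) = 0}"
    have am: "lorentz a m = 0" using a(2) by (simp add: lorentz_commute[of a m])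
    have P: "?P = {x. time_reflection a \<bullet> x = lorentz a q}"
      by (simp add: lorentz_eq_inner[symmetric])
    have "time_reflection a \<noteq> 0" using a(1) by (auto simp: time_reflection_def zero_prod_def lorentz_def)
    then have dim: "aff_dim ?P = int CARD('m)" unfolding P by (simp add: aff_dim_hyperplane)
    have aff: "affine ?P" unfolding P by (rule affine_hyperplane)
    have qP: "q \<in> ?P" by simp
    have dir: "affine_direction ?P = {v. lorentz a v = 0}"
      unfolding affine_direction_eq[OF aff qP]
    proof (intro set_eqI iffI)
      fix v assume "v \<in> {v. lorentz a v = 0}"
      then show "v \<in> (\<lambda>x. x - q) ` ?P" by (intro image_eqI[of _ _ "v + q"]) auto
    qed blast
    have cP: "c \<in> ?P" using am by (simp add: m(1))
    have tl: "timelike_subspace (affine_direction ?P)"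
      unfolding dir by (rule timelike_subspaceI[OF _ _ m(2)]) (use am in \<open>auto simp: subspace_def\<close>)
    have "?P \<inter> \<Sigma> = sheet (affine_direction ?P) c R"
    proof -
      have "lorentz a (c + R *\<^sub>R k - q) = R * lorentz a k" for k using am by (simp add: m(1))
      then have "c + R *\<^sub>R k \<in> ?P \<longleftrightarrow> k \<in> {v. lorentz a v = 0}" for k using E(4) by simp
      then show ?thesis unfolding dir \<Sigma>s sheet_def by blast
    qed
    then have hyp: "hyperbolic_space (CARD('m) - 1) (?P \<inter> \<Sigma>)"
      unfolding hyperbolic_space_iff_sheet using aff dim tl cP E(4) card
      by (intro exI[of _ ?P] exI[of _ c] exI[of _ R]) simp
    have "normal_line \<Sigma> q \<subseteq> affine_direction ?P"
    proof
      fix w assume "w \<in> normal_line \<Sigma> q"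
      then have "\<And>v. lorentz m v = 0 \<Longrightarrow> lorentz w v = 0"
        using unit_normal(2)[OF \<Sigma> q] nm by (auto simp: normal_line_def)
      from orthogonal_complement_future_unit[OF m(2) this]
      obtain t where "w = t *\<^sub>R m" by blast
      then show "w \<in> affine_direction ?P" unfolding dir using am by simp
    qed
    then show ?thesis using aff dim qP hyp by (simp add: normal_hyperplane_def)
  qed
  obtain a where a: "lorentz a a = 1" "lorentz m a = 0"
    using exists_unit_orthogonal3[OF card mm, of m m] by blast
  obtain b where b: "lorentz b b = 1" "lorentz m b = 0" "lorentz a b = 0"
    using exists_unit_orthogonal3[OF card mm, of a a] by blast
  have "q + a \<in> {x. lorentz b (x - q) = 0}" "q + a \<notin> {x. lorentz a (x - q) = 0}"
    using a b lorentz_commute[of b a] by simp_all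
  then have "{x. lorentz a (x - q) = 0} \<noteq> {x. lorentz b (x - q) = 0}" by blast
  with P[OF a] P[OF b(1,2)] show ?thesis
    by (intro exI[of _ "{x. lorentz a (x - q) = 0}"] exI[of _ "{x. lorentz b (x - q) = 0}"] conjI) simp_all
qed

theorem corollary20:
  fixes \<Sigma> :: "'m::finite minkowski set"
  assumes "CARD('m) \<ge> 3"
    and "spacelike_hypersurface \<Sigma>"
    and "\<Sigma> \<noteq> {}"
    and "closed \<Sigma>"
  shows "hyperbolic_space CARD('m) \<Sigma> \<longleftrightarrow>
    (\<forall>q\<in>\<Sigma>. \<exists>P\<^sub>1 P\<^sub>2. P\<^sub>1 \<noteq> P\<^sub>2 \<and>
       normal_hyperplane \<Sigma> q P\<^sub>1 \<and> hyperbolic_space (CARD('m) - 1) (P\<^sub>1 \<inter> \<Sigma>) \<and>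
       normal_hyperplane \<Sigma> q P\<^sub>2 \<and> hyperbolic_space (CARD('m) - 1) (P\<^sub>2 \<inter> \<Sigma>))"
proof (intro iffI ballI)
  show "\<exists>P\<^sub>1 P\<^sub>2. P\<^sub>1 \<noteq> P\<^sub>2 \<and>
       normal_hyperplane \<Sigma> q P\<^sub>1 \<and> hyperbolic_space (CARD('m) - 1) (P\<^sub>1 \<inter> \<Sigma>) \<and>
       normal_hyperplane \<Sigma> q P\<^sub>2 \<and> hyperbolic_space (CARD('m) - 1) (P\<^sub>2 \<inter> \<Sigma>)"
    if "hyperbolic_space CARD('m) \<Sigma>" "q \<in> \<Sigma>" for q
    by (rule sections_if_hyperbolic_space[OF assms(1,2) that])
qed (rule hyperbolic_space_if_sections[OF assms])

end
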